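(* Let $\kappa\in\mathbb{R}$ and let $X\subset\mathbb{R}^N$ be a geodesic subspace, compact and path-connected in the topology of its induced length metric $d^L_X$, such that $(X,d^L_X)$ has curvature $\leq\kappa$. Let $\xi\in\left(0,\tfrac{1}{14}\right]$ be a fixed number. Let $\beta$ be any number satisfying $0<\beta<\frac{1}{1+2\xi}\Delta(X)$, and let $0<\varepsilon\leq\beta$ be such that $\delta^{\varepsilon}_{2\xi\beta}(X)\leq 1+\frac{\xi}{1+\xi}$. Then for any (non-empty) compact subset $S\subset\mathbb{R}^N$, $$d_H(X,S)<\tfrac12\xi\varepsilon\quad\Longrightarrow\quad \mathcal{R}^{\varepsilon}_{\beta}(S)\simeq X,$$ where $\simeq$ denotes homotopy equivalence and $X$ carries the topology of $d^L_X$.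
   Context: **Lengths and geodesic subspaces.** For a metric space $(X,d)$ the length of a continuous path $\gamma:[a,b]\to X$ is $L(\gamma)=\sup\sum_i d(\gamma(t_i),\gamma(t_{i+1}))$ over all partitions of $[a,b]$, and the induced length metric $d^L(x_1,x_2)$ is the infimum of lengths of paths joining $x_1,x_2$. $(X,d)$ is a length space if $d=d^L$, and a complete length space (geodesic space) if moreover any two points are joined by a shortest path, i.e. a path of length $d^L(x_1,x_2)$. For $X\subset\mathbb{R}^N$ (with the Euclidean metric), $d^L_X$ is its induced length metric; $X$ is a geodesic subspace of $\mathbb{R}^N$ if $(X,d^L_X)$ is a complete length space. **Convexity radius.** A subset $A$ of a length space is convex if any two points of $A$ are joined by a unique shortest path and this path lies in $A$. The convexity radius is $\rho(X)=\inf_{x\in X}\sup\{r\ge 0\mid \mathbb{B}_X(x,s)\text{ is convex for all }0<s<r\}$, where $\mathbb{B}_X(x,s)$ is the open metric ball (here with respect to $d^L_X$). **Curvature $\leq\kappa$.** A complete length space $(X,d)$ has curvature $\leq\kappa$ if for any $x_1,x_2,x_3$ in a convex ball of $X$ (and, if $\kappa>0$, with $d(x_1,x_2)+d(x_2,x_3)+d(x_3,x_1)<2\pi/\sqrt{\kappa}$) and any $y$ on a shortest path joining $x_1$ and $x_3$, we have $d(y,x_2)\le d(\overline y,\overline x_2)$, where $\overline x_1,\overline x_2,\overline x_3$ are points of the model surface of constant curvature $\kappa$ with $d(\overline x_i,\overline x_j)=d(x_i,x_j)$ and $\overline y$ is the point on the shortest path joining $\overline x_1$ and $\overline x_3$ with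 $d(\overline x_1,\overline y)=d(x_1,y)$. **$\Delta(X)$.** $\Delta(X)=\min\{\frac{\pi}{4\sqrt{\kappa}},\rho(X)\}$ if $\kappa>0$, and $\Delta(X)=\rho(X)$ if $\kappa\le0$. **Large scale distortion.** For $\varepsilon>0$, $X^\varepsilon=\bigcup_{x\in X}\{z\in\mathbb{R}^N: \|z-x\|<\varepsilon\}$, and $d^L_{X^\varepsilon}$ is the induced length metric on $X^\varepsilon\subset\mathbb{R}^N$. For $\varepsilon,R>0$, $$\delta^\varepsilon_R(X)=\sup_{x_1,x_2\in X,\ d^L_X(x_1,x_2)\ge R}\frac{d^L_X(x_1,x_2)}{d^L_{X^\varepsilon}(x_1,x_2)}$$ (with the value $1$ if there is no such pair). **Path metric.** For $\varepsilon>0$ and non-empty $S\subset\mathbb{R}^N$, an $\varepsilon$-path of $S$ from $a$ to $b$ is a finite sequence $y_0=a,y_1,\dots,y_{k+1}=b$ in $S$ with $\|y_i-y_{i+1}\|<\varepsilon$ for all $i$; its length is $\sum_{i=0}^k\|y_i-y_{i+1}\|$. $d^\varepsilon_S(a,b)$ is the infimum of lengths of $\varepsilon$-paths of $S$ from $a$ to $b$. **Vietoris–Rips complex.** $\mathcal{R}^\varepsilon_\beta(S)$ is (the geometric realization of) the Vietoris–Rips complex of $(S,d^\varepsilon_S)$ at scale $\beta$: the abstract simplicial complex whose simplices are the non-empty finite subsets of $S$ with all pairwise distances $d^\varepsilon_S$ strictly less than $\beta$. **Hausdorff distance.** $d_H(X,S)=\inf\{\eta>0\mid S\subset X^\eta,\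 X\subset S^\eta\}$ with Euclidean thickenings. *)

theory Defs
  imports "HOL-Analysis.Analysis"
begin

section \<open>Lengths and length spaces\<close>

text \<open>Lengths and induced length metrics take values in \<^typ>\<open>ennreal\<close>; the infimum over no paths is
  \<open>\<infinity>\<close>. A metric space is given, as in the library, by a carrier \<open>M\<close> and a distance \<open>d\<close>.\<close>

definition path_between ::
    "'a set \<Rightarrow> ('a \<Rightarrow> 'a \<Rightarrow> real) \<Rightarrow> 'a \<Rightarrow> 'a \<Rightarrow> (real \<Rightarrow> 'a) \<Rightarrow> real \<Rightarrow> real \<Rightarrow> bool" where
  "path_between M d x y g a b \<longleftrightarrow>
     a \<le> b \<and> continuous_map (top_of_set {a..b}) (Metric_space.mtopology M d) g \<and> g a = x \<and> g b = y"

definition path_length :: "('a \<Rightarrow> 'a \<Rightarrow> real) \<Rightarrow> (real \<Rightarrow> 'a) \<Rightarrow> real \<Rightarrow> real \<Rightarrow> ennreal" where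
  "path_length d g a b =
     (SUP (n, t) \<in> {(n :: nat, t :: nat \<Rightarrow> real). t 0 = a \<and> t n = b \<and> (\<forall>i<n. t i \<le> t (Suc i))}.
        ennreal (\<Sum>i<n. d (g (t i)) (g (t (Suc i)))))"

definition induced_length :: "'a set \<Rightarrow> ('a \<Rightarrow> 'a \<Rightarrow> real) \<Rightarrow> 'a \<Rightarrow> 'a \<Rightarrow> ennreal" where
  "induced_length M d x y = (INF (g, a, b) \<in> {(g, a, b). path_between M d x y g a b}. path_length d g a b)"

definition shortest_path ::
    "'a set \<Rightarrow> ('a \<Rightarrow> 'a \<Rightarrow> real) \<Rightarrow> 'a \<Rightarrow> 'a \<Rightarrow> (real \<Rightarrow> 'a) \<Rightarrow> real \<Rightarrow> real \<Rightarrow> bool" where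
  "shortest_path M d x y g a b \<longleftrightarrow>
     path_between M d x y g a b \<and> path_length d g a b = induced_length M d x y"

definition length_space :: "'a set \<Rightarrow> ('a \<Rightarrow> 'a \<Rightarrow> real) \<Rightarrow> bool" where
  "length_space M d \<longleftrightarrow>
     Metric_space M d \<and> (\<forall>x\<in>M. \<forall>y\<in>M. ennreal (d x y) = induced_length M d x y)"

definition complete_length_space :: "'a set \<Rightarrow> ('a \<Rightarrow> 'a \<Rightarrow> real) \<Rightarrow> bool" where
  "complete_length_space M d \<longleftrightarrow>
     length_space M d \<and> (\<forall>x\<in>M. \<forall>y\<in>M. \<exists>g a b. shortest_path M d x y g a b)"

text \<open>The induced length metric of a subset of Euclidean space, made real-valued so that
  \<^const>\<open>Metric_space\<close> applies; it is meaningful only where the induced length is finite.\<close>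

definition len_dist :: "(real^'n) set \<Rightarrow> real^'n \<Rightarrow> real^'n \<Rightarrow> real" where
  "len_dist X x y = enn2real (induced_length X dist x y)"

definition geodesic_subspace :: "(real^'n) set \<Rightarrow> bool" where
  "geodesic_subspace X \<longleftrightarrow>
     (\<forall>x\<in>X. \<forall>y\<in>X. induced_length X dist x y < \<infinity>) \<and> complete_length_space X (len_dist X)"

abbreviation len_topology :: "(real^'n) set \<Rightarrow> (real^'n) topology" where
  "len_topology X \<equiv> Metric_space.mtopology X (len_dist X)"


section \<open>Convexity radius\<close>

text \<open>Equality of the curves traced by two paths: equality up to (weakly monotone)
  reparametrization. Uniqueness of shortest paths is understood in this sense.\<close>

definition same_curve ::
    "(real \<Rightarrow> 'a) \<Rightarrow> real \<Rightarrow> real \<Rightarrow> (real \<Rightarrow> 'a) \<Rightarrow> real \<Rightarrow> real \<Rightarrow> bool" where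
  "same_curve g a b h a' b' \<longleftrightarrow>
     (\<exists>\<phi> \<psi>. continuous_on {0..1} \<phi> \<and> mono_on {0..1} \<phi> \<and> \<phi> 0 = a \<and> \<phi> 1 = b \<and>
            continuous_on {0..1} \<psi> \<and> mono_on {0..1} \<psi> \<and> \<psi> 0 = a' \<and> \<psi> 1 = b' \<and>
            (\<forall>t\<in>{0..1::real}. g (\<phi> t) = h (\<psi> t)))"

definition metric_convex :: "'a set \<Rightarrow> ('a \<Rightarrow> 'a \<Rightarrow> real) \<Rightarrow> 'a set \<Rightarrow> bool" where
  "metric_convex M d A \<longleftrightarrow>
     A \<subseteq> M \<and>
     (\<forall>x\<in>A. \<forall>y\<in>A. \<exists>g a b. shortest_path M d x y g a b \<and> g ` {a..b} \<subseteq> A \<and>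
        (\<forall>h a' b'. shortest_path M d x y h a' b' \<longrightarrow> same_curve g a b h a' b'))"

definition convexity_radius :: "'a set \<Rightarrow> ('a \<Rightarrow> 'a \<Rightarrow> real) \<Rightarrow> ennreal" where
  "convexity_radius M d =
     (INF x\<in>M. SUP r \<in> {r. 0 \<le> r \<and> (\<forall>s. 0 < s \<and> s < r \<longrightarrow> metric_convex M d (Metric_space.mball M d x s))}.
        ennreal r)"


section \<open>Curvature bounded above\<close>

text \<open>The model surface of curvature \<open>\<kappa>\<close> inside \<open>\<real>\<^sup>3\<close>: the round sphere of radius \<open>1/\<surd>\<kappa>\<close> with its
  angular metric, the Euclidean plane, or the upper sheet of the hyperboloid \<open>\<langle>u,u\<rangle> = 1/\<kappa>\<close> for the
  Lorentz form. The distance is set to 0 off the surface, where arccos and arcosh need not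
  make sense.\<close>

definition lorentz :: "real^3 \<Rightarrow> real^3 \<Rightarrow> real" where
  "lorentz u v = u$1 * v$1 + u$2 * v$2 - u$3 * v$3"

definition model_surface :: "real \<Rightarrow> (real^3) set" where
  "model_surface \<kappa> =
     (if \<kappa> > 0 then sphere 0 (1 / sqrt \<kappa>)
      else if \<kappa> = 0 then {u. u$3 = 0}
      else {u. lorentz u u = 1 / \<kappa> \<and> u$3 > 0})"

definition model_dist :: "real \<Rightarrow> real^3 \<Rightarrow> real^3 \<Rightarrow> real" where
  "model_dist \<kappa> u v =
     (if u \<notin> model_surface \<kappa> \<or> v \<notin> model_surface \<kappa> then 0
      else if \<kappa> > 0 then arccos (\<kappa> * (u \<bullet> v)) / sqrt \<kappa>
      else if \<kappa> = 0 then dist u v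
      else arcosh (\<kappa> * lorentz u v) / sqrt (- \<kappa>))"

definition curvature_le :: "real \<Rightarrow> 'a set \<Rightarrow> ('a \<Rightarrow> 'a \<Rightarrow> real) \<Rightarrow> bool" where
  "curvature_le \<kappa> M d \<longleftrightarrow>
     (\<forall>p\<in>M. \<forall>s>0. metric_convex M d (Metric_space.mball M d p s) \<longrightarrow>
       (\<forall>x1 \<in> Metric_space.mball M d p s. \<forall>x2 \<in> Metric_space.mball M d p s.
        \<forall>x3 \<in> Metric_space.mball M d p s.
          (\<kappa> > 0 \<longrightarrow> d x1 x2 + d x2 x3 + d x3 x1 < 2 * pi / sqrt \<kappa>) \<longrightarrow>
          (\<forall>g a b y. shortest_path M d x1 x3 g a b \<and> y \<in> g ` {a..b} \<longrightarrow>
            (\<forall>z1 \<in> model_surface \<kappa>. \<forall>z2 \<in> model_surface \<kappa>. \<forall>z3 \<in> model_surface \<kappa>.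
              model_dist \<kappa> z1 z2 = d x1 x2 \<and> model_dist \<kappa> z2 z3 = d x2 x3 \<and>
              model_dist \<kappa> z3 z1 = d x3 x1 \<longrightarrow>
              (\<forall>h a' b' w.
                shortest_path (model_surface \<kappa>) (model_dist \<kappa>) z1 z3 h a' b' \<and> w \<in> h ` {a'..b'} \<and>
                model_dist \<kappa> z1 w = d x1 y \<longrightarrow>
                d y x2 \<le> model_dist \<kappa> w z2)))))"

definition Delta :: "real \<Rightarrow> (real^'n) set \<Rightarrow> ennreal" where
  "Delta \<kappa> X =
     (if \<kappa> > 0 then min (ennreal (pi / (4 * sqrt \<kappa>))) (convexity_radius X (len_dist X))
      else convexity_radius X (len_dist X))"


section \<open>Large scale distortion and Hausdorff distance\<close>

definition thickening :: "real \<Rightarrow> (real^'n) set \<Rightarrow> (real^'n) set" where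
  "thickening \<epsilon> X = (\<Union>x\<in>X. {z. norm (z - x) < \<epsilon>})"

definition large_scale_distortion :: "real \<Rightarrow> real \<Rightarrow> (real^'n) set \<Rightarrow> ennreal" where
  "large_scale_distortion \<epsilon> R X =
     (let P = {(x, y). x \<in> X \<and> y \<in> X \<and> ennreal R \<le> induced_length X dist x y}
      in if P = {} then 1
         else (SUP (x, y) \<in> P. induced_length X dist x y / induced_length (thickening \<epsilon> X) dist x y))"

definition hausdorff_distance :: "(real^'n) set \<Rightarrow> (real^'n) set \<Rightarrow> ennreal" where
  "hausdorff_distance X S =
     (INF \<eta> \<in> {\<eta>. \<eta> > 0 \<and> S \<subseteq> thickening \<eta> X \<and> X \<subseteq> thickening \<eta> S}. ennreal \<eta>)"


section \<open>Path metric and Vietoris--Rips complex\<close>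

definition eps_path :: "real \<Rightarrow> (real^'n) set \<Rightarrow> real^'n \<Rightarrow> real^'n \<Rightarrow> nat \<Rightarrow> (nat \<Rightarrow> real^'n) \<Rightarrow> bool" where
  "eps_path \<epsilon> S a b k y \<longleftrightarrow>
     y 0 = a \<and> y (Suc k) = b \<and> (\<forall>i\<le>Suc k. y i \<in> S) \<and> (\<forall>i\<le>k. norm (y i - y (Suc i)) < \<epsilon>)"

definition path_metric :: "real \<Rightarrow> (real^'n) set \<Rightarrow> real^'n \<Rightarrow> real^'n \<Rightarrow> ennreal" where
  "path_metric \<epsilon> S a b =
     (INF (k, y) \<in> {(k, y). eps_path \<epsilon> S a b k y}. ennreal (\<Sum>i\<le>k. norm (y i - y (Suc i))))"

definition vietoris_rips :: "'v set \<Rightarrow> ('v \<Rightarrow> 'v \<Rightarrow> ennreal) \<Rightarrow> real \<Rightarrow> 'v set set" where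
  "vietoris_rips S d \<beta> =
     {\<sigma>. \<sigma> \<noteq> {} \<and> finite \<sigma> \<and> \<sigma> \<subseteq> S \<and> (\<forall>x\<in>\<sigma>. \<forall>y\<in>\<sigma>. d x y < ennreal \<beta>)}"

text \<open>Geometric realization of an abstract simplicial complex: points are barycentric coordinates,
  each closed simplex has its Euclidean topology (a subspace of the product topology, which is the
  \<^const>\<open>euclidean\<close> topology of the function type), and the whole has the weak (coherent) topology.\<close>

definition geom_simplex :: "'v set \<Rightarrow> ('v \<Rightarrow> real) set" where
  "geom_simplex \<sigma> = {t. (\<forall>v. 0 \<le> t v) \<and> (\<forall>v. v \<notin> \<sigma> \<longrightarrow> t v = 0) \<and> sum t \<sigma> = 1}"

definition geom_realization :: "'v set set \<Rightarrow> ('v \<Rightarrow> real) topology" where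
  "geom_realization K =
     topology (\<lambda>U. U \<subseteq> (\<Union>\<sigma>\<in>K. geom_simplex \<sigma>) \<and>
                   (\<forall>\<sigma>\<in>K. openin (top_of_set (geom_simplex \<sigma>)) (U \<inter> geom_simplex \<sigma>)))"

lemma openin_geom_realization:
  "openin (geom_realization K) U \<longleftrightarrow>
     U \<subseteq> (\<Union>\<sigma>\<in>K. geom_simplex \<sigma>) \<and>
     (\<forall>\<sigma>\<in>K. openin (top_of_set (geom_simplex \<sigma>)) (U \<inter> geom_simplex \<sigma>))"
proof -
  let ?L = "\<lambda>U. U \<subseteq> (\<Union>\<sigma>\<in>K. geom_simplex \<sigma>) \<and>
              (\<forall>\<sigma>\<in>K. openin (top_of_set (geom_simplex \<sigma>)) (U \<inter> geom_simplex \<sigma>))"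
  have 1: "?L (S \<inter> T)" if S: "?L S" and T: "?L T" for S T
  proof (intro conjI ballI)
    show "S \<inter> T \<subseteq> (\<Union>\<sigma>\<in>K. geom_simplex \<sigma>)"
      using S by (meson inf.coboundedI1)
    fix \<sigma> assume "\<sigma> \<in> K"
    with S T have "openin (top_of_set (geom_simplex \<sigma>)) ((S \<inter> geom_simplex \<sigma>) \<inter> (T \<inter> geom_simplex \<sigma>))"
      by (simp only: openin_Int)
    moreover have "(S \<inter> geom_simplex \<sigma>) \<inter> (T \<inter> geom_simplex \<sigma>) = S \<inter> T \<inter> geom_simplex \<sigma>"
      by (simp only: Int_ac Int_absorb Int_left_absorb)
    ultimately show "openin (top_of_set (geom_simplex \<sigma>)) (S \<inter> T \<inter> geom_simplex \<sigma>)"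
      by (simp only:)
  qed
  have 2: "?L (\<Union>\<K>)" if L: "\<And>S. S \<in> \<K> \<Longrightarrow> ?L S" for \<K>
  proof (intro conjI ballI)
    show "\<Union>\<K> \<subseteq> (\<Union>\<sigma>\<in>K. geom_simplex \<sigma>)"
      using L by (simp only: Union_least)
    fix \<sigma> assume "\<sigma> \<in> K"
    have "openin (top_of_set (geom_simplex \<sigma>)) (\<Union>((\<lambda>S. S \<inter> geom_simplex \<sigma>) ` \<K>))"
    proof (rule openin_Union)
      fix W assume "W \<in> (\<lambda>S. S \<inter> geom_simplex \<sigma>) ` \<K>"
      then obtain S where "S \<in> \<K>" and W: "W = S \<inter> geom_simplex \<sigma>"
        by (rule imageE)
      then show "openin (top_of_set (geom_simplex \<sigma>)) W"
        using L[OF \<open>S \<in> \<K>\<close>] \<open>\<sigma> \<in> K\<close> by (simp only: W)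
    qed
    then show "openin (top_of_set (geom_simplex \<sigma>)) (\<Union>\<K> \<inter> geom_simplex \<sigma>)"
      by (simp only: Int_Union2)
  qed
  have "istopology ?L"
    unfolding istopology_def by (rule conjI; intro allI impI) (rule 1, assumption+, rule 2, erule (1) bspec)
  then show ?thesis
    unfolding geom_realization_def by (simp only: topology_inverse')
qed

definition rips_realization :: "real \<Rightarrow> real \<Rightarrow> (real^'n) set \<Rightarrow> (real^'n \<Rightarrow> real) topology" where
  "rips_realization \<epsilon> \<beta> S = geom_realization (vietoris_rips S (path_metric \<epsilon> S) \<beta>)"

end

theory Submission
  imports Defs
begin

text \<open>Choose nearby points \<open>f v \<in> X\<close> for \<open>v \<in> S\<close> and \<open>g x \<in> S\<close> for \<open>x \<in> X\<close>. The distortion bound makes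
  the image under \<open>f\<close> of a simplex of the Rips complex a set of diameter less than
  \<open>D = (1 + 2 \<xi>) \<beta> < \<Delta>(X)\<close>, and by a form of Jung's theorem such a set lies in a ball of radius
  \<open>3/4 D\<close>. In the opposite direction, points of \<open>X\<close> at distance at most \<open>(1 - \<xi>)\<^sup>2 \<beta>\<close>, which exceeds
  \<open>3/4 D\<close>, have images under \<open>g\<close> that span an edge.

  Send a point of the Rips complex with barycentric coordinates \<open>t\<close> to the minimizer of
  \<open>x \<mapsto> max\<^sub>v t\<^sub>v d(x, f v)\<close>. It is unique since balls are strictly convex, hence it depends continuously
  on \<open>t\<close> because \<open>X\<close> is compact, and it is within \<open>3/4 D\<close> of \<open>f v\<close> whenever the coordinate \<open>t\<^sub>v\<close> is
  maximal. Send \<open>X\<close> to the complex by a partition of unity on a fine net, with \<open>g\<close> applied to the points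
  of the net. One composition is homotopic to the identity of \<open>X\<close> along short geodesics. For the other
  one, cut the coordinates \<open>t\<close> at a level that rises from 0 to 1, and move the mass below the level to
  the image of the minimizer for the truncated coordinates; since the vertices above the level have
  maximal truncated coordinate, everything stays in a simplex.\<close>

section \<open>Paths and geodesics\<close>

text \<open>A point that minimizes a weighted maximum of distances is controlled only at the
  vertices of maximal weight; a vertex of small weight may be far from it. So the straight line from
  \<open>t\<close> to the image of its center can leave the complex. Capping the weights at a common
  level makes all vertices that still carry mass of their own maximal.

  The factor 3/4 exceeds \<open>1 / sqrt 2\<close>, the limit of the constants in Jung's theorem as
  the dimension grows. Neither the number of points nor a dimension of \<open>X\<close> is bounded,
  so this limit is the value to beat; the surplus pays for positive curvature and for strictness.

  \<open>f\<close> and \<open>g\<close> are arbitrary choices without any continuity: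
  \<open>f\<close> is applied to vertices only, \<open>g\<close> to a finite net only. The complex
  may have uncountably many vertices and need not be locally finite, so its weak topology is finer
  than coordinatewise convergence. Maps into it are controlled through finite vertex sets, and
  homotopies on it through the local compactness of the interval.\<close>

lemma path_length_ge_dist:
  assumes "a \<le> b"
  shows "ennreal (d (g a) (g b)) \<le> path_length d g a b"
  unfolding path_length_def
  by (rule SUP_upper2[of "(1, \<lambda>i. if i = 0 then a else b)"]) (use assms in auto)

text \<open>Two inner points are enough to see that distances add up along a path whose length is
  the distance of its ends.\<close>

lemma path_length_ge_three:
  assumes "a \<le> s" "s \<le> t" "t \<le> b"
  shows "ennreal (d (g a) (g s) + d (g s) (g t) + d (g t) (g b)) \<le> path_length d g a b"
proof -
  define p :: "nat \<Rightarrow> real" where "p i = (if i = 0 then a else if i = 1 then s else if i = 2 then t else b)" for i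
  have "(3, p) \<in> {(n, t). t 0 = a \<and> t n = b \<and> (\<forall>i<n. t i \<le> t (Suc i))}"
    using assms by (auto simp: p_def less_Suc_eq numeral_3_eq_3)
  then have "ennreal (\<Sum>i<3. d (g (p i)) (g (p (Suc i)))) \<le> path_length d g a b"
    unfolding path_length_def by (intro SUP_upper2[of "(3, p)"]) auto
  moreover have "(\<Sum>i<3. d (g (p i)) (g (p (Suc i)))) = d (g a) (g s) + d (g s) (g t) + d (g t) (g b)"
    by (simp add: numeral_3_eq_3 p_def)
  ultimately show ?thesis by simp
qed

lemma path_length_le_lipschitz:
  assumes "\<And>s t. a \<le> s \<Longrightarrow> s \<le> t \<Longrightarrow> t \<le> b \<Longrightarrow> d (g s) (g t) \<le> t - s"
  shows "path_length d g a b \<le> ennreal (b - a)"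
  unfolding path_length_def
proof (rule SUP_least, clarify)
  fix n and t :: "nat \<Rightarrow> real"
  assume t: "\<forall>i<n. t i \<le> t (Suc i)" and ends: "a = t 0" "b = t n"
  have mono: "t i \<le> t j" if "i \<le> j" "j \<le> n" for i j
    using that(1,2)
  proof (induction j rule: dec_induct)
    case (step m)
    then show ?case using t by (metis Suc_le_eq less_imp_le order_trans)
  qed simp
  have "(\<Sum>i<n. d (g (t i)) (g (t (Suc i)))) \<le> (\<Sum>i<n. t (Suc i) - t i)"
    by (rule sum_mono, rule assms) (use mono ends in auto)
  also have "\<dots> = b - a"
    by (simp add: sum_lessThan_telescope ends)
  finally show "ennreal (\<Sum>i<n. d (g (t i)) (g (t (Suc i)))) \<le> ennreal (t n - t 0)"
    using ends by (simp add: ennreal_leI)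
qed

lemma induced_length_ge_dist: "ennreal (d x y) \<le> induced_length M d x y"
  unfolding induced_length_def
  by (rule INF_greatest) (auto simp: path_between_def intro: path_length_ge_dist)

context Metric_space
begin

lemma continuous_map_dist:
  assumes "continuous_map T mtopology f" "continuous_map T mtopology g"
  shows "continuous_map T euclideanreal (\<lambda>u. d (f u) (g u))"
  using continuous_map_mdist[of T Self f g] assms by (simp add: Self_def)

lemma lipschitz_path_between:
  assumes "0 \<le> L" and M: "\<And>t. 0 \<le> t \<Longrightarrow> t \<le> L \<Longrightarrow> g t \<in> M"
    and lip: "\<And>s t. 0 \<le> s \<Longrightarrow> s \<le> t \<Longrightarrow> t \<le> L \<Longrightarrow> d (g s) (g t) \<le> t - s"
  shows "path_between M d (g 0) (g L) g 0 L"
proof -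
  have lip': "d (g s) (g t) \<le> \<bar>t - s\<bar>" if "s \<in> {0..L}" "t \<in> {0..L}" for s t
    using lip[of s t] lip[of t s] that commute[of "g s" "g t"] by (cases "s \<le> t") auto
  have "continuous_map (top_of_set {0..L}) mtopology g"
    unfolding continuous_map_to_metric
  proof (intro ballI allI impI)
    fix s \<epsilon> :: real assume s: "s \<in> topspace (top_of_set {0..L})" and "\<epsilon> > 0"
    show "\<exists>U. openin (top_of_set {0..L}) U \<and> s \<in> U \<and> (\<forall>y\<in>U. g y \<in> mball (g s) \<epsilon>)"
    proof (intro exI conjI ballI)
      show "openin (top_of_set {0..L}) ({0..L} \<inter> ball s \<epsilon>)"
        by (simp add: openin_open_Int)
      show "s \<in> {0..L} \<inter> ball s \<epsilon>" using s \<open>\<epsilon> > 0\<close> by simp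
      fix y assume "y \<in> {0..L} \<inter> ball s \<epsilon>"
      then show "g y \<in> mball (g s) \<epsilon>"
        using lip'[of s y] s M by (auto simp: dist_real_def)
    qed
  qed
  then show ?thesis using assms by (simp add: path_between_def)
qed

lemma induced_length_le_lipschitz:
  assumes "0 \<le> L" and "\<And>t. 0 \<le> t \<Longrightarrow> t \<le> L \<Longrightarrow> g t \<in> M"
    and lip: "\<And>s t. 0 \<le> s \<Longrightarrow> s \<le> t \<Longrightarrow> t \<le> L \<Longrightarrow> d (g s) (g t) \<le> t - s"
  shows "induced_length M d (g 0) (g L) \<le> ennreal L"
proof -
  have "induced_length M d (g 0) (g L) \<le> path_length d g 0 L"
    unfolding induced_length_def
    by (rule INF_lower2[of "(g, 0, L)"]) (use lipschitz_path_between[OF assms] in auto)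
  also have "\<dots> \<le> ennreal (L - 0)"
    by (rule path_length_le_lipschitz) (use lip in auto)
  finally show ?thesis by simp
qed

lemma shortest_path_isometric:
  assumes "0 \<le> L" and M: "\<And>t. 0 \<le> t \<Longrightarrow> t \<le> L \<Longrightarrow> g t \<in> M"
    and iso: "\<And>s t. 0 \<le> s \<Longrightarrow> s \<le> t \<Longrightarrow> t \<le> L \<Longrightarrow> d (g s) (g t) = t - s"
  shows "shortest_path M d (g 0) (g L) g 0 L"
proof -
  have "path_length d g 0 L \<le> ennreal (L - 0)"
    by (rule path_length_le_lipschitz) (use iso in auto)
  moreover have "d (g 0) (g L) = L" using iso[of 0 L] assms(1) by simp
  moreover have "ennreal (d (g 0) (g L)) \<le> induced_length M d (g 0) (g L)"
    by (rule induced_length_ge_dist)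
  moreover have "path_between M d (g 0) (g L) g 0 L"
    using assms by (intro lipschitz_path_between) auto
  moreover from this have "induced_length M d (g 0) (g L) \<le> path_length d g 0 L"
    unfolding induced_length_def by (intro INF_lower2[of "(g, 0, L)"]) auto
  ultimately show ?thesis by (auto simp: shortest_path_def)
qed

end

section \<open>Geodesics in complete length spaces\<close>

locale geodesic_space = Metric_space M d for M :: "'a set" and d +
  assumes length_space: "x \<in> M \<Longrightarrow> y \<in> M \<Longrightarrow> ennreal (d x y) = induced_length M d x y"
    and shortest_path_exists: "x \<in> M \<Longrightarrow> y \<in> M \<Longrightarrow> \<exists>g a b. shortest_path M d x y g a b"
begin

text \<open>The length equals \<open>d x y\<close>, so the partition through \<open>s\<close> and
  \<open>t\<close> forces equality in the triangle inequalities. Hence \<open>d x\<close> measures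
  arc length along the path, whatever its parametrization.\<close>

lemma shortest_path_dist:
  assumes sp: "shortest_path M d x y g a b" and xy: "x \<in> M" "y \<in> M"
    and st: "a \<le> s" "s \<le> t" "t \<le> b"
  shows "g s \<in> M" "g t \<in> M" "d (g s) (g t) = d x (g t) - d x (g s)" "d x (g s) + d (g s) y = d x y"
proof -
  have cont: "continuous_map (top_of_set {a..b}) mtopology g" and ends: "g a = x" "g b = y"
    and len: "path_length d g a b = ennreal (d x y)"
    using sp xy length_space by (auto simp: shortest_path_def path_between_def)
  show gs: "g s \<in> M" and gt: "g t \<in> M"
    using continuous_map_image_subset_topspace[OF cont] st by (auto simp: image_subset_iff)
  have 1: "d x (g s) + d (g s) (g t) + d (g t) y \<le> d x y"
    using path_length_ge_three[of a s t b d g] st len ends by (simp add: ennreal_le_iff del: ennreal_plus)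
  have 2: "d x (g t) + d (g t) y \<le> d x y" "d x (g s) + d (g s) y \<le> d x y"
    using path_length_ge_three[of a t t b d g] path_length_ge_three[of a s s b d g] st len ends gs gt
    by (simp_all add: ennreal_le_iff del: ennreal_plus)
  show "d x (g s) + d (g s) y = d x y"
    using 2 triangle[of x "g s" y] xy gs by simp
  have "d x y \<le> d x (g t) + d (g t) y" "d x (g t) \<le> d x (g s) + d (g s) (g t)"
    using triangle xy gs gt by auto
  with 1 2 show "d (g s) (g t) = d x (g t) - d x (g s)" by linarith
qed

text \<open>Arc length parametrization by the intermediate value theorem: every distance
  \<open>u\<close> from \<open>x\<close> is attained at some parameter. The path may rest there, but
  each choice of the parameter gives the same point.\<close>

lemma geodesic:
  assumes "x \<in> M" "y \<in> M"
  obtains g where "g 0 = x" "g (d x y) = y"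
    "\<And>t. 0 \<le> t \<Longrightarrow> t \<le> d x y \<Longrightarrow> g t \<in> M"
    "\<And>s t. 0 \<le> s \<Longrightarrow> s \<le> t \<Longrightarrow> t \<le> d x y \<Longrightarrow> d (g s) (g t) = t - s"
proof -
  obtain h a b where sp: "shortest_path M d x y h a b"
    using shortest_path_exists assms by blast
  note D = shortest_path_dist[OF sp assms]
  have ab: "a \<le> b" and ends: "h a = x" "h b = y"
    and cont: "continuous_map (top_of_set {a..b}) mtopology h"
    using sp by (auto simp: shortest_path_def path_between_def)
  have "continuous_map (top_of_set {a..b}) euclideanreal (\<lambda>s. d x (h s))"
    using assms cont by (intro continuous_map_dist) auto
  then have c: "continuous_on {a..b} (\<lambda>s. d x (h s))" by simp
  have "\<exists>s. a \<le> s \<and> s \<le> b \<and> d x (h s) = u" if "0 \<le> u" "u \<le> d x y" for u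
    using IVT'[of "\<lambda>s. d x (h s)" a u b] c ab ends that assms by auto
  then obtain \<sigma> where \<sigma>: "\<And>u. 0 \<le> u \<Longrightarrow> u \<le> d x y \<Longrightarrow> a \<le> \<sigma> u \<and> \<sigma> u \<le> b \<and> d x (h (\<sigma> u)) = u"
    by metis
  have iso: "d (h (\<sigma> s)) (h (\<sigma> t)) = t - s" if "0 \<le> s" "s \<le> t" "t \<le> d x y" for s t
  proof (cases "\<sigma> s \<le> \<sigma> t")
    case True
    then show ?thesis using D(3)[of "\<sigma> s" "\<sigma> t"] \<sigma>[of s] \<sigma>[of t] that by simp
  next
    case False
    \<comment> \<open>Parameters in the wrong order occur only for \<open>s = t\<close>, since the
      distance \<open>s - t\<close> cannot be negative.\<close>
    then have "d (h (\<sigma> t)) (h (\<sigma> s)) = s - t"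
      using D(3)[of "\<sigma> t" "\<sigma> s"] \<sigma>[of s] \<sigma>[of t] that by simp
    then show ?thesis using that nonneg[of "h (\<sigma> t)" "h (\<sigma> s)"] commute by simp
  qed
  have inM: "h (\<sigma> t) \<in> M" if "0 \<le> t" "t \<le> d x y" for t
    using D(1)[of "\<sigma> t" "\<sigma> t"] \<sigma>[of t] that by simp
  have "h (\<sigma> 0) = x" using \<sigma>[of 0] inM[of 0] assms by simp
  moreover have "h (\<sigma> (d x y)) = y"
    using \<sigma>[of "d x y"] D(4)[of "\<sigma> (d x y)" "\<sigma> (d x y)"] inM[of "d x y"] assms by simp
  ultimately show thesis using that[of "h \<circ> \<sigma>"] iso inM by simp
qed

text \<open>Geodesics from \<open>x\<close> to \<open>z\<close> and from \<open>z\<close> to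
  \<open>y\<close> concatenate to a geodesic, because a shortcut past \<open>z\<close> would
  contradict \<open>d x z + d z y = d x y\<close>. This turns metric betweenness into lying on a
  shortest path.\<close>

lemma geodesic_through:
  assumes xy: "x \<in> M" "y \<in> M" and z: "z \<in> M" "d x z + d z y = d x y"
  obtains g where "shortest_path M d x y g 0 (d x y)" "g (d x z) = z"
proof -
  obtain g where g: "g 0 = x" "g (d x z) = z" "\<And>t. 0 \<le> t \<Longrightarrow> t \<le> d x z \<Longrightarrow> g t \<in> M"
    "\<And>s t. 0 \<le> s \<Longrightarrow> s \<le> t \<Longrightarrow> t \<le> d x z \<Longrightarrow> d (g s) (g t) = t - s"
    using geodesic[OF xy(1) z(1)] by metis
  obtain h where h: "h 0 = z" "h (d z y) = y" "\<And>t. 0 \<le> t \<Longrightarrow> t \<le> d z y \<Longrightarrow> h t \<in> M"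
    "\<And>s t. 0 \<le> s \<Longrightarrow> s \<le> t \<Longrightarrow> t \<le> d z y \<Longrightarrow> d (h s) (h t) = t - s"
    using geodesic[OF z(1) xy(2)] by metis
  define j where "j t = (if t \<le> d x z then g t else h (t - d x z))" for t
  have inM: "j t \<in> M" if "0 \<le> t" "t \<le> d x y" for t
    using that g(3)[of t] h(3)[of "t - d x z"] z by (auto simp: j_def)
  have j0: "j 0 = x" and jz: "j (d x z) = z" using g by (auto simp: j_def)
  have jy: "j (d x y) = y"
  proof (cases "d z y = 0")
    case True then show ?thesis using z xy g by (auto simp: j_def)
  next
    case False then have "d z y > 0" using nonneg[of z y] by linarith
    moreover have "d x y - d x z = d z y" using z by simp
    moreover from this have "h (d x y - d x z) = y" using h(2) by simp
    ultimately show ?thesis using z by (simp add: j_def)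
  qed
  have iso: "d (j s) (j t) = t - s" if "0 \<le> s" "s \<le> t" "t \<le> d x y" for s t
  proof -
    consider "t \<le> d x z" | "d x z < s" | "s \<le> d x z" "d x z < t" using that by linarith
    then show ?thesis
    proof cases
      case 1 then show ?thesis using that g by (simp add: j_def)
    next
      case 2 then show ?thesis using that h(4)[of "s - d x z" "t - d x z"] z by (simp add: j_def)
    next
      case 3
      have M: "j s \<in> M" "j t \<in> M" using inM that 3 by auto
      have a: "d x (j s) = s" "d (j s) z = d x z - s"
        using g(4)[of 0 s] g(4)[of s "d x z"] that 3 g(1,2) by (auto simp: j_def)
      have b: "d z (j t) = t - d x z" "d (j t) y = d x y - t"
        using h(4)[of 0 "t - d x z"] h(4)[of "t - d x z" "d z y"] that 3 h(1,2) z by (auto simp: j_def)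
      have "d (j s) (j t) \<le> d (j s) z + d z (j t)" using triangle M z by blast
      moreover have "d x y \<le> d x (j s) + d (j s) y" "d (j s) y \<le> d (j s) (j t) + d (j t) y"
        using triangle M xy by blast+
      ultimately show ?thesis using a b by linarith
    qed
  qed
  have "shortest_path M d (j 0) (j (d x y)) j 0 (d x y)"
    by (rule shortest_path_isometric) (use inM iso in auto)
  then show thesis using that[of j] j0 jz jy by simp
qed

text \<open>Uniqueness of curves up to reparametrization becomes uniqueness of points: every point
  between \<open>x\<close> and \<open>y\<close> lies on some shortest path, hence on the fixed path
  \<open>g\<close>, where the distance from \<open>x\<close> determines it.\<close>

lemma metric_convex_between_unique:
  assumes A: "metric_convex M d A" and xy: "x \<in> A" "y \<in> A"
    and z: "z \<in> M" "d x z + d z y = d x y" and z': "z' \<in> M" "d x z' + d z' y = d x y"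
    and eq: "d x z = d x z'"
  shows "z = z'" and "z \<in> A"
proof -
  have M: "x \<in> M" "y \<in> M" using A xy by (auto simp: metric_convex_def)
  obtain g a b where g: "shortest_path M d x y g a b" "g ` {a..b} \<subseteq> A"
    and u: "\<And>h a' b'. shortest_path M d x y h a' b' \<Longrightarrow> same_curve g a b h a' b'"
    using A xy unfolding metric_convex_def by meson
  have on_g: "\<exists>s. a \<le> s \<and> s \<le> b \<and> w = g s" if w: "w \<in> M" "d x w + d w y = d x y" for w
  proof -
    obtain h where h: "shortest_path M d x y h 0 (d x y)" "h (d x w) = w"
      using geodesic_through[OF M w] .
    from u[OF h(1)] obtain \<phi> \<psi> where c: "mono_on {0..1} \<phi>" "\<phi> 0 = a" "\<phi> 1 = b"
      "continuous_on {0..1} \<psi>" "\<psi> 0 = 0" "\<psi> 1 = d x y"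
      and e: "\<forall>t\<in>{0..1::real}. g (\<phi> t) = h (\<psi> t)"
      unfolding same_curve_def by blast
    obtain t where t: "0 \<le> t" "t \<le> 1" "\<psi> t = d x w"
      using IVT'[of \<psi> 0 "d x w" 1] c w nonneg[of x w] nonneg[of w y] by auto
    then have "g (\<phi> t) = w" using e h(2) by (metis atLeastAtMost_iff)
    moreover have "a \<le> \<phi> t" "\<phi> t \<le> b"
      using mono_onD[OF c(1), of 0 t] mono_onD[OF c(1), of t 1] c t by auto
    ultimately show ?thesis by metis
  qed
  obtain s s' where s: "a \<le> s" "s \<le> b" "z = g s" and s': "a \<le> s'" "s' \<le> b" "z' = g s'"
    using on_g z z' by meson
  note D = shortest_path_dist(3)[OF g(1) M]
  show "z = z'"
  proof (cases "s \<le> s'")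
    case True then have "d z z' = 0" using D[of s s'] s s' eq by simp
    then show ?thesis using z z' by simp
  next
    case False then have "d z' z = 0" using D[of s' s] s s' eq by simp
    then show ?thesis using z z' by simp
  qed
  show "z \<in> A" using s g(2) by auto
qed

end

lemma geodesic_space_complete_length_space:
  assumes "complete_length_space M d"
  shows "geodesic_space M d"
  using assms
  by (auto simp: complete_length_space_def length_space_def geodesic_space_def geodesic_space_axioms_def)

section \<open>Comparison triangles in the model surfaces\<close>

text \<open>In each model, the comparison triangle is placed with one side on a standard geodesic \<open>e\<close>, so that
  the distance from the third vertex to \<open>e t\<close> is given by the law of cosines.\<close>

lemma arccos_inner_triangle:
  fixes u v w :: "'a::real_inner"
  assumes [simp]: "norm u = 1" "norm v = 1" "norm w = 1"
  shows "arccos (u \<bullet> w) \<le> arccos (u \<bullet> v) + arccos (v \<bullet> w)"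
proof -
  define a b where "a = u \<bullet> v" and "b = v \<bullet> w"
  have a: "\<bar>a\<bar> \<le> 1" and b: "\<bar>b\<bar> \<le> 1" and c: "\<bar>u \<bullet> w\<bar> \<le> 1"
    using Cauchy_Schwarz_ineq2[of u v] Cauchy_Schwarz_ineq2[of v w] Cauchy_Schwarz_ineq2[of u w]
    by (auto simp: a_def b_def)
  have 1: "u \<bullet> u = 1" "v \<bullet> v = 1" "w \<bullet> w = 1" by (simp_all add: dot_square_norm)
  have "norm (u - a *\<^sub>R v) ^ 2 = 1 - a\<^sup>2"
    unfolding power2_norm_eq_inner
    by (simp add: inner_diff_left inner_diff_right 1 a_def inner_commute power2_eq_square)
  then have na: "norm (u - a *\<^sub>R v) = sqrt (1 - a\<^sup>2)" by (metis norm_ge_zero real_sqrt_unique)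
  have "norm (w - b *\<^sub>R v) ^ 2 = 1 - b\<^sup>2"
    unfolding power2_norm_eq_inner
    by (simp add: inner_diff_left inner_diff_right 1 b_def inner_commute power2_eq_square)
  then have nb: "norm (w - b *\<^sub>R v) = sqrt (1 - b\<^sup>2)" by (metis norm_ge_zero real_sqrt_unique)
  have "(u - a *\<^sub>R v) \<bullet> (w - b *\<^sub>R v) = u \<bullet> w - a * b"
    by (simp add: inner_diff_left inner_diff_right 1 a_def b_def inner_commute)
  then have *: "a * b - sqrt (1 - a\<^sup>2) * sqrt (1 - b\<^sup>2) \<le> u \<bullet> w"
    using Cauchy_Schwarz_ineq2[of "u - a *\<^sub>R v" "w - b *\<^sub>R v"] na nb by auto
  show ?thesis
  proof (cases "arccos a + arccos b \<ge> pi")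
    case True
    moreover have "arccos (u \<bullet> w) \<le> pi" using c by (intro arccos_ubound) auto
    ultimately show ?thesis by (simp add: a_def b_def)
  next
    case False
    have "cos (arccos a + arccos b) \<le> u \<bullet> w"
      using * a b by (simp add: cos_add sin_arccos_abs)
    then have "arccos (u \<bullet> w) \<le> arccos (cos (arccos a + arccos b))"
      using c by (intro arccos_le_arccos) auto
    also have "\<dots> = arccos a + arccos b"
      using False arccos_lbound[of a] arccos_lbound[of b] a b by (intro arccos_cos) auto
    finally show ?thesis by (simp add: a_def b_def)
  qed
qed

lemma model_dist_sphere:
  assumes "\<kappa> > 0" "u \<in> model_surface \<kappa>" "v \<in> model_surface \<kappa>"
  shows "model_dist \<kappa> u v = arccos ((sqrt \<kappa> *\<^sub>R u) \<bullet> (sqrt \<kappa> *\<^sub>R v)) / sqrt \<kappa>"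
    "norm (sqrt \<kappa> *\<^sub>R u) = 1"
  using assms by (auto simp: model_dist_def model_surface_def mult.assoc[symmetric])

lemma Metric_space_model_sphere:
  assumes \<kappa>: "\<kappa> > 0"
  shows "Metric_space (model_surface \<kappa>) (model_dist \<kappa>)"
proof
  note D = model_dist_sphere[OF \<kappa>]
  have ab: "\<bar>(sqrt \<kappa> *\<^sub>R u) \<bullet> (sqrt \<kappa> *\<^sub>R v)\<bar> \<le> 1" if "u \<in> model_surface \<kappa>" "v \<in> model_surface \<kappa>" for u v
    using Cauchy_Schwarz_ineq2[of "sqrt \<kappa> *\<^sub>R u" "sqrt \<kappa> *\<^sub>R v"] D(2)[OF that(1,1)] D(2)[OF that(2,2)]
    by (simp only: mult_1)
  show "0 \<le> model_dist \<kappa> x y" for x y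
  proof (cases "x \<in> model_surface \<kappa> \<and> y \<in> model_surface \<kappa>")
    case True
    then show ?thesis using D[of x y] ab[of x y] \<kappa> by (auto intro!: divide_nonneg_nonneg arccos_lbound)
  qed (auto simp: model_dist_def)
  show "model_dist \<kappa> x y = model_dist \<kappa> y x" for x y
    by (auto simp: model_dist_def inner_commute dist_commute lorentz_def mult.commute)
  show "(model_dist \<kappa> x y = 0) = (x = y)" if "x \<in> model_surface \<kappa>" "y \<in> model_surface \<kappa>" for x y
  proof -
    let ?u = "sqrt \<kappa> *\<^sub>R x" and ?v = "sqrt \<kappa> *\<^sub>R y"
    have n: "norm ?u = 1" "norm ?v = 1" using D(2) that by auto
    have "model_dist \<kappa> x y = 0 \<longleftrightarrow> arccos (?u \<bullet> ?v) = 0" using D(1)[OF that] \<kappa> by simp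
    also have "\<dots> \<longleftrightarrow> ?u \<bullet> ?v = 1"
      using ab[OF that] arccos_1 cos_arccos_abs cos_zero by metis
    also have "\<dots> \<longleftrightarrow> ?u = ?v"
      using n norm_cauchy_schwarz_eq[of ?u ?v] by (auto simp del: norm_scaleR)
    also have "\<dots> \<longleftrightarrow> x = y" using \<kappa> by simp
    finally show ?thesis .
  qed
  show "model_dist \<kappa> x z \<le> model_dist \<kappa> x y + model_dist \<kappa> y z"
    if "x \<in> model_surface \<kappa>" "y \<in> model_surface \<kappa>" "z \<in> model_surface \<kappa>" for x y z
    using arccos_inner_triangle[OF D(2)[OF that(1,1)] D(2)[OF that(2,2)] D(2)[OF that(3,3)]] \<kappa> that
    unfolding D(1)[OF that(1,3)] D(1)[OF that(1,2)] D(1)[OF that(2,3)]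
    by (simp only: add_divide_distrib[symmetric]) (intro divide_right_mono, auto)
qed

text \<open>The curvature bound speaks about all comparison triangles, so one explicit triangle
  suffices to exploit it. The last equation interpolates \<open>cos\<close> of the scaled distance
  along the side: that function is a combination of \<open>cos (k * t)\<close> and
  \<open>sin (k * t)\<close>, determined by its values at both ends.\<close>

lemma comparison_sphere:
  assumes \<kappa>: "\<kappa> > 0" and l: "0 < l" and nn: "0 \<le> b" "0 \<le> c" and tri: "l \<le> b + c" "b \<le> l + c" "c \<le> l + b"
    and per: "b + c + l < 2 * pi / sqrt \<kappa>" and u: "0 \<le> u" "u \<le> l"
  shows "\<exists>z1\<in>model_surface \<kappa>. \<exists>z2\<in>model_surface \<kappa>. \<exists>z3\<in>model_surface \<kappa>. \<exists>h.
    model_dist \<kappa> z1 z2 = b \<and> model_dist \<kappa> z2 z3 = c \<and> model_dist \<kappa> z3 z1 = l \<and>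
    shortest_path (model_surface \<kappa>) (model_dist \<kappa>) z1 z3 h 0 l \<and> model_dist \<kappa> z1 (h u) = u \<and>
    sin (sqrt \<kappa> * l) * cos (sqrt \<kappa> * model_dist \<kappa> (h u) z2)
      = sin (sqrt \<kappa> * (l - u)) * cos (sqrt \<kappa> * b) + sin (sqrt \<kappa> * u) * cos (sqrt \<kappa> * c)"
proof -
  define k where "k = sqrt \<kappa>"
  have k: "k > 0" and kk: "k * k = \<kappa>" using \<kappa> by (auto simp: k_def)
  have per': "k * b + k * c + k * l < 2 * pi"
    using per k by (simp add: k_def[symmetric] field_simps)
  have kt: "k * l \<le> k * b + k * c" "k * b \<le> k * l + k * c" "k * c \<le> k * l + k * b"
    using tri k by (simp_all add: distrib_left[symmetric])
  have kl: "0 < k * l" "k * l < pi" and kb: "0 \<le> k * b" "k * b < pi" and kc: "0 \<le> k * c" "k * c < pi"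
    using per' kt l k nn by auto
  have sl: "sin (k * l) > 0" using kl by (simp add: sin_gt_zero)
  have sb: "sin (k * b) \<ge> 0" using kb by (simp add: sin_ge_zero)
  \<comment> \<open>\<open>P\<close> is the second coordinate of the scaled vertex
    \<open>z2\<close>, forced by the distance \<open>c\<close> to the end of the side. The third
    coordinate exists once \<open>P\<close> is at most \<open>sin (k * b)\<close> in absolute
    value.\<close>
  define P where "P = (cos (k * c) - cos (k * l) * cos (k * b)) / sin (k * l)"
  have "cos (k * c) \<le> cos (k * l - k * b)"
  proof -
    have "cos (k * c) \<le> cos \<bar>k * l - k * b\<bar>" by (rule cos_monotone_0_pi_le) (use kc kt in auto)
    then show ?thesis by (simp add: abs_if cos_diff mult.commute split: if_splits)
  qed
  moreover have "cos (k * l + k * b) \<le> cos (k * c)"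
  proof (cases "k * l + k * b \<le> pi")
    case True then show ?thesis by (intro cos_monotone_0_pi_le) (use kc kt in auto)
  next
    case False
    \<comment> \<open>Reflection at pi brings the angle back to where \<open>cos\<close> decreases;
      there the perimeter bound gives the needed comparison with \<open>k * c\<close>.\<close>
    have "cos (2 * pi - (k * l + k * b)) \<le> cos (k * c)"
      by (rule cos_monotone_0_pi_le) (use kc per' False in auto)
    then show ?thesis by (simp add: cos_diff)
  qed
  ultimately have "\<bar>cos (k * c) - cos (k * l) * cos (k * b)\<bar> \<le> sin (k * l) * sin (k * b)"
    by (simp add: cos_add cos_diff abs_le_iff)
  then have "\<bar>P\<bar> \<le> sin (k * b)"
    using sl by (simp add: P_def abs_mult field_simps)
  then have "P\<^sup>2 \<le> (sin (k * b))\<^sup>2" using sb by (metis abs_le_square_iff abs_of_nonneg)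
  then have Q: "(sqrt ((sin (k * b))\<^sup>2 - P\<^sup>2))\<^sup>2 = (sin (k * b))\<^sup>2 - P\<^sup>2" by simp
  define e :: "real \<Rightarrow> real^3" where "e t = (1 / k) *\<^sub>R vector [cos (k * t), sin (k * t), 0]" for t
  define z2 :: "real^3" where "z2 = (1 / k) *\<^sub>R vector [cos (k * b), P, sqrt ((sin (k * b))\<^sup>2 - P\<^sup>2)]"
  have vn: "norm (vector [x, y, z] :: real^3) ^ 2 = x\<^sup>2 + y\<^sup>2 + z\<^sup>2" for x y z
    unfolding power2_norm_eq_inner by (simp add: inner_vec_def sum_3 vector_3 power2_eq_square)
  have "norm (vector [cos (k * t), sin (k * t), 0] :: real^3) ^ 2 = 1" for t
    by (simp add: vn)
  then have e: "e t \<in> model_surface \<kappa>" for t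
    using \<kappa> k by (simp add: model_surface_def e_def k_def[symmetric] power2_eq_1_iff)
       (metis norm_ge_zero not_one_le_zero neg_0_le_iff_le)
  have "norm (vector [cos (k * b), P, sqrt ((sin (k * b))\<^sup>2 - P\<^sup>2)] :: real^3) ^ 2 = 1"
    by (simp add: vn Q)
  then have z2: "z2 \<in> model_surface \<kappa>"
    using \<kappa> k by (simp add: model_surface_def z2_def k_def[symmetric] power2_eq_1_iff)
       (metis norm_ge_zero not_one_le_zero neg_0_le_iff_le)
  have ip: "\<kappa> * (e t \<bullet> z2) = cos (k * b) * cos (k * t) + P * sin (k * t)" for t
    using k by (simp add: kk[symmetric] e_def z2_def inner_vec_def sum_3 vector_3 algebra_simps)
  have ez: "model_dist \<kappa> (e t) z2 = arccos (cos (k * b) * cos (k * t) + P * sin (k * t)) / k" for t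
    using \<kappa> e[of t] z2 by (simp add: model_dist_def k_def ip[unfolded k_def])
  have ee: "model_dist \<kappa> (e s) (e t) = t - s" if "0 \<le> s" "s \<le> t" "t \<le> l" for s t
  proof -
    have "\<kappa> * (e s \<bullet> e t) = cos (k * t - k * s)"
      using k by (simp add: kk[symmetric] e_def inner_vec_def sum_3 vector_3 cos_diff algebra_simps)
    then have "model_dist \<kappa> (e s) (e t) = arccos (cos (k * t - k * s)) / k"
      using \<kappa> e[of s] e[of t] by (simp add: model_dist_def k_def)
    moreover have "0 \<le> k * t - k * s" "k * t - k * s \<le> pi"
      using that k kl mult_left_mono[of s t k] mult_left_mono[of t l k] mult_nonneg_nonneg[of k s] by linarith+
    ultimately have "model_dist \<kappa> (e s) (e t) = k * (t - s) / k" by (simp add: arccos_cos right_diff_distrib)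
    then show ?thesis using k by simp
  qed
  interpret Metric_space "model_surface \<kappa>" "model_dist \<kappa>" by (rule Metric_space_model_sphere[OF \<kappa>])
  have Pl: "P * sin (k * l) = cos (k * c) - cos (k * l) * cos (k * b)" using sl by (simp add: P_def)
  have arg: "\<bar>cos (k * b) * cos (k * t) + P * sin (k * t)\<bar> \<le> 1" for t
  proof -
    have "\<kappa> * (e t \<bullet> z2) = (sqrt \<kappa> *\<^sub>R e t) \<bullet> (sqrt \<kappa> *\<^sub>R z2)" using \<kappa> by simp
    moreover have "\<bar>(sqrt \<kappa> *\<^sub>R e t) \<bullet> (sqrt \<kappa> *\<^sub>R z2)\<bar> \<le> norm (sqrt \<kappa> *\<^sub>R e t) * norm (sqrt \<kappa> *\<^sub>R z2)"
      by (rule Cauchy_Schwarz_ineq2)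
    ultimately show ?thesis
      using model_dist_sphere(2)[OF \<kappa> e e] model_dist_sphere(2)[OF \<kappa> z2 z2] ip by (metis mult_1)
  qed
  have 1: "model_dist \<kappa> (e 0) z2 = b" using k kb by (simp add: ez arccos_cos)
  have "model_dist \<kappa> (e l) z2 = c" using k kc by (simp add: ez Pl arccos_cos)
  then have 2: "model_dist \<kappa> z2 (e l) = c" using commute by metis
  have 3: "model_dist \<kappa> (e l) (e 0) = l" using ee[of 0 l] l commute by simp
  have 4: "shortest_path (model_surface \<kappa>) (model_dist \<kappa>) (e 0) (e l) e 0 l"
    by (rule shortest_path_isometric) (use l e ee in auto)
  have 5: "model_dist \<kappa> (e 0) (e u) = u" using ee[of 0 u] u by simp
  have 6: "sin (k * l) * cos (k * model_dist \<kappa> (e u) z2)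
      = sin (k * (l - u)) * cos (k * b) + sin (k * u) * cos (k * c)"
  proof -
    have "cos (k * model_dist \<kappa> (e u) z2) = cos (k * b) * cos (k * u) + P * sin (k * u)"
      using k arg[of u] by (simp add: ez cos_arccos_abs)
    then have "sin (k * l) * cos (k * model_dist \<kappa> (e u) z2)
       = sin (k * l) * cos (k * b) * cos (k * u) + (P * sin (k * l)) * sin (k * u)"
      by (simp add: algebra_simps)
    then show ?thesis unfolding Pl by (simp add: right_diff_distrib sin_diff algebra_simps)
  qed
  show ?thesis
    unfolding k_def[symmetric] using e z2 1 2 3 4 5 6 by blast
qed

section \<open>The plane\<close>

text \<open>The last equation is Stewart's theorem. The number \<open>P\<close> in the proof is the
  foot of the altitude from the third vertex, measured along the side.\<close>

lemma comparison_plane: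
  assumes l: "0 < l" and nn: "0 \<le> b" "0 \<le> c" and tri: "l \<le> b + c" "b \<le> l + c" "c \<le> l + b"
    and u: "0 \<le> u" "u \<le> l"
  shows "\<exists>z1\<in>model_surface 0. \<exists>z2\<in>model_surface 0. \<exists>z3\<in>model_surface 0. \<exists>h.
    model_dist 0 z1 z2 = b \<and> model_dist 0 z2 z3 = c \<and> model_dist 0 z3 z1 = l \<and>
    shortest_path (model_surface 0) (model_dist 0) z1 z3 h 0 l \<and> model_dist 0 z1 (h u) = u \<and>
    l * (model_dist 0 (h u) z2)\<^sup>2 = (l - u) * b\<^sup>2 + u * c\<^sup>2 - u * (l - u) * l"
proof -
  define P where "P = (b\<^sup>2 + l\<^sup>2 - c\<^sup>2) / (2 * l)"
  have Pl: "2 * l * P = b\<^sup>2 + l\<^sup>2 - c\<^sup>2" using l by (simp add: P_def)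
  have "(l - b)\<^sup>2 \<le> c\<^sup>2" "c\<^sup>2 \<le> (l + b)\<^sup>2"
    using tri nn by (auto simp: abs_le_square_iff[symmetric])
  then have "\<bar>2 * l * P\<bar> \<le> 2 * l * b"
    unfolding Pl by (auto simp: abs_le_iff power2_eq_square algebra_simps)
  then have "\<bar>P\<bar> \<le> b" using l by (simp add: abs_mult)
  then have "P\<^sup>2 \<le> b\<^sup>2" using nn by (metis abs_le_square_iff abs_of_nonneg)
  then have Q: "(sqrt (b\<^sup>2 - P\<^sup>2))\<^sup>2 = b\<^sup>2 - P\<^sup>2" by simp
  define e :: "real \<Rightarrow> real^3" where "e t = vector [t, 0, 0]" for t
  define z2 :: "real^3" where "z2 = vector [P, sqrt (b\<^sup>2 - P\<^sup>2), 0]"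
  have in_model: "e t \<in> model_surface 0" "z2 \<in> model_surface 0" for t
    by (simp_all add: model_surface_def e_def z2_def)
  have MD: "model_dist 0 x y = dist x y" if "x \<in> model_surface 0" "y \<in> model_surface 0" for x y
    using that by (simp add: model_dist_def)
  have vd: "(dist x y)\<^sup>2 = (x$1 - y$1)\<^sup>2 + (x$2 - y$2)\<^sup>2 + (x$3 - y$3)\<^sup>2" for x y :: "real^3"
    unfolding dist_norm power2_norm_eq_inner by (simp add: inner_vec_def sum_3 power2_eq_square)
  have ez: "(model_dist 0 (e t) z2)\<^sup>2 = t\<^sup>2 - 2 * t * P + b\<^sup>2" for t
    unfolding MD[OF in_model] vd using Q by (simp add: e_def z2_def power2_diff)
  have ee: "model_dist 0 (e s) (e t) = t - s" if "s \<le> t" for s t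
  proof -
    have "(dist (e s) (e t))\<^sup>2 = (t - s)\<^sup>2" unfolding vd by (simp add: e_def power2_commute)
    then show ?thesis using that by (simp add: MD in_model power2_eq_iff_nonneg)
  qed
  interpret Metric_space "model_surface 0" "model_dist 0"
    by standard (auto simp: MD dist_commute dist_triangle, auto simp: model_dist_def dist_commute)
  have "(model_dist 0 (e 0) z2)\<^sup>2 = b\<^sup>2" by (simp add: ez)
  then have 1: "model_dist 0 (e 0) z2 = b" using nn by (simp add: power2_eq_iff_nonneg)
  have "(model_dist 0 (e l) z2)\<^sup>2 = c\<^sup>2" using Pl by (simp add: ez)
  then have 2: "model_dist 0 z2 (e l) = c" using nn commute by (simp add: power2_eq_iff_nonneg)
  have 3: "model_dist 0 (e l) (e 0) = l" using ee[of 0 l] l commute by simp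
  have 4: "shortest_path (model_surface 0) (model_dist 0) (e 0) (e l) e 0 l"
    by (rule shortest_path_isometric) (use l in_model ee in auto)
  have 5: "model_dist 0 (e 0) (e u) = u" using ee[of 0 u] u by simp
  have "l * (model_dist 0 (e u) z2)\<^sup>2 = l * u\<^sup>2 - u * (2 * l * P) + l * b\<^sup>2"
    unfolding ez by (simp add: algebra_simps)
  then have 6: "l * (model_dist 0 (e u) z2)\<^sup>2 = (l - u) * b\<^sup>2 + u * c\<^sup>2 - u * (l - u) * l"
    unfolding Pl by (simp add: power2_eq_square algebra_simps)
  show ?thesis using in_model 1 2 3 4 5 6 by blast
qed


section \<open>The hyperboloid\<close>

text \<open>The reversed Cauchy-Schwarz inequality for timelike unit vectors. It is the ordinary one
  for the vectors \<open>(1, v$1, v$2)\<close> and \<open>(1, w$1, w$2)\<close>, whose norms are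
  \<open>v$3\<close> and \<open>w$3\<close>.\<close>

lemma lorentz_hyperboloid:
  assumes v: "lorentz v v = -1" "v $ 3 > 0" and w: "lorentz w w = -1" "w $ 3 > 0"
  shows "lorentz v w \<le> -1"
proof -
  let ?a = "(v$1)\<^sup>2 + (v$2)\<^sup>2" and ?b = "(w$1)\<^sup>2 + (w$2)\<^sup>2"
  have v3: "v$3 = sqrt (1 + ?a)" and w3: "w$3 = sqrt (1 + ?b)"
    using v w by (auto intro!: real_sqrt_unique[symmetric] simp: lorentz_def power2_eq_square)
  have "(1 + (v$1 * w$1 + v$2 * w$2))\<^sup>2 \<le> (1 + ?a) * (1 + ?b)"
    using zero_le_power2[of "v$1 - w$1"] zero_le_power2[of "v$2 - w$2"]
      zero_le_power2[of "v$1 * w$2 - v$2 * w$1"]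
    by (simp add: power2_eq_square algebra_simps)
  then have "1 + (v$1 * w$1 + v$2 * w$2) \<le> sqrt ((1 + ?a) * (1 + ?b))"
    by (rule real_le_rsqrt)
  also have "\<dots> = v$3 * w$3" by (simp add: v3 w3 real_sqrt_mult)
  finally show ?thesis by (simp add: lorentz_def)
qed

text \<open>Orthogonality expresses \<open>x$3 * v$3\<close> as a planar inner product, and the
  planar part of \<open>v\<close> is shorter than \<open>v$3\<close>. So the complement of a
  timelike vector is spacelike, and Cauchy-Schwarz is available there.\<close>

lemma lorentz_orthogonal_nonneg:
  assumes v: "lorentz v v = -1" and x: "lorentz x v = 0"
  shows "lorentz x x \<ge> 0"
proof -
  have "(x$3 * v$3)\<^sup>2 = (x$1 * v$1 + x$2 * v$2)\<^sup>2" using x by (simp add: lorentz_def)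
  also have "\<dots> \<le> ((x$1)\<^sup>2 + (x$2)\<^sup>2) * ((v$1)\<^sup>2 + (v$2)\<^sup>2)"
    using zero_le_power2[of "x$1 * v$2 - x$2 * v$1"] by (simp add: power2_eq_square algebra_simps)
  also have "\<dots> \<le> ((x$1)\<^sup>2 + (x$2)\<^sup>2) * (v$3)\<^sup>2"
    using v by (intro mult_left_mono) (auto simp: lorentz_def power2_eq_square)
  finally have "(x$3)\<^sup>2 * (v$3)\<^sup>2 \<le> ((x$1)\<^sup>2 + (x$2)\<^sup>2) * (v$3)\<^sup>2" by (simp add: power_mult_distrib)
  moreover have "(v$3)\<^sup>2 > 0"
  proof -
    have "(v$3)\<^sup>2 = 1 + ((v$1)\<^sup>2 + (v$2)\<^sup>2)" using v by (simp add: lorentz_def power2_eq_square)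
    then show ?thesis by (simp only:) (simp add: add_pos_nonneg)
  qed
  ultimately have "(x$3)\<^sup>2 \<le> (x$1)\<^sup>2 + (x$2)\<^sup>2" by (rule mult_right_le_imp_le)
  then show ?thesis by (simp add: lorentz_def power2_eq_square)
qed

lemma lorentz_orthogonal_cauchy_schwarz:
  assumes v: "lorentz v v = -1" and x: "lorentz x v = 0" and y: "lorentz y v = 0"
  shows "(lorentz x y)\<^sup>2 \<le> lorentz x x * lorentz y y"
proof -
  let ?p = "lorentz x x" and ?q = "lorentz x y" and ?r = "lorentz y y"
  have lin: "lorentz (s *\<^sub>R x + t *\<^sub>R y) (s *\<^sub>R x + t *\<^sub>R y) = s\<^sup>2 * ?p + 2 * s * t * ?q + t\<^sup>2 * ?r" for s t
    by (simp add: lorentz_def power2_eq_square algebra_simps)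
  have nn: "0 \<le> s\<^sup>2 * ?p + 2 * s * t * ?q + t\<^sup>2 * ?r" for s t
    unfolding lin[symmetric]
  proof (rule lorentz_orthogonal_nonneg[OF v])
    have "lorentz (s *\<^sub>R x + t *\<^sub>R y) v = s * lorentz x v + t * lorentz y v"
      by (simp add: lorentz_def algebra_simps)
    then show "lorentz (s *\<^sub>R x + t *\<^sub>R y) v = 0" using x y by simp
  qed
  show ?thesis
  proof (cases "?r = 0")
    case True
    have "?q = 0"
    proof (rule ccontr)
      assume "?q \<noteq> 0"
      \<comment> \<open>Only semidefiniteness is at hand, so \<open>?r = 0\<close> is possible. The
        quadratic is then linear in \<open>t\<close>, and this \<open>t\<close> gives it the value
        -1.\<close>
      then have "2 * (-(?p + 1) / (2 * ?q)) * ?q = -(?p + 1)" by simp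
      then show False using nn[of 1 "-(?p + 1) / (2 * ?q)"] unfolding True by simp
    qed
    then show ?thesis using True by simp
  next
    case False
    then have r: "?r > 0" using lorentz_orthogonal_nonneg[OF v y] by simp
    have "0 \<le> ?r\<^sup>2 * ?p - 2 * ?r * ?q * ?q + ?q\<^sup>2 * ?r" using nn[of ?r "- ?q"] by simp
    also have "\<dots> = ?r * (?r * ?p - ?q\<^sup>2)" by (simp add: power2_eq_square algebra_simps)
    finally show ?thesis using r by (simp add: zero_le_mult_iff mult.commute)
  qed
qed

text \<open>As on the sphere, the parts of \<open>u\<close> and \<open>w\<close> orthogonal to
  \<open>v\<close> are compared. They are spacelike of lengths \<open>sinh (arcosh A)\<close> and
  \<open>sinh (arcosh B)\<close>, so the addition theorem of \<open>cosh\<close> appears.\<close>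

lemma arcosh_lorentz_triangle:
  assumes u: "lorentz u u = -1" "u $ 3 > 0" and v: "lorentz v v = -1" "v $ 3 > 0"
    and w: "lorentz w w = -1" "w $ 3 > 0"
  shows "arcosh (- lorentz u w) \<le> arcosh (- lorentz u v) + arcosh (- lorentz v w)"
proof -
  define A B where "A = - lorentz u v" and "B = - lorentz v w"
  have A: "A \<ge> 1" and B: "B \<ge> 1" and C: "- lorentz u w \<ge> 1"
    using lorentz_hyperboloid[OF u v] lorentz_hyperboloid[OF v w] lorentz_hyperboloid[OF u w]
    by (auto simp: A_def B_def)
  let ?u = "u - A *\<^sub>R v" and ?w = "w - B *\<^sub>R v"
  have lin: "lorentz (x - a *\<^sub>R v) (y - b *\<^sub>R v) = lorentz x y - b * lorentz x v - a * lorentz v y + a * b * lorentz v v"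
    for x y a b by (simp add: lorentz_def algebra_simps)
  have sym: "lorentz x y = lorentz y x" for x y by (simp add: lorentz_def mult.commute)
  have lin1: "lorentz (x - a *\<^sub>R v) v = lorentz x v - a * lorentz v v" for x a
    by (simp add: lorentz_def algebra_simps)
  have o: "lorentz ?u v = 0" "lorentz ?w v = 0"
    unfolding lin1 using v sym[of w v] by (auto simp: A_def B_def)
  have uu: "lorentz ?u ?u = A\<^sup>2 - 1" and ww: "lorentz ?w ?w = B\<^sup>2 - 1" and uw: "lorentz ?u ?w = lorentz u w + A * B"
    unfolding lin using u v w sym[of v u] sym[of w v] A_def B_def by (auto simp: power2_eq_square algebra_simps)
  have "\<bar>lorentz u w + A * B\<bar> \<le> sqrt ((A\<^sup>2 - 1) * (B\<^sup>2 - 1))"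
    using lorentz_orthogonal_cauchy_schwarz[OF v(1) o] unfolding uu ww uw
    by (intro real_le_rsqrt) simp
  then have "- lorentz u w \<le> A * B + sqrt (A\<^sup>2 - 1) * sqrt (B\<^sup>2 - 1)"
    by (simp add: real_sqrt_mult abs_le_iff)
  also have "\<dots> = cosh (arcosh A + arcosh B)"
    using A B by (simp add: cosh_add sinh_arcosh_real)
  finally have "cosh (arcosh (- lorentz u w)) \<le> cosh (arcosh A + arcosh B)" using C by simp
  then have "arcosh (- lorentz u w) \<le> arcosh A + arcosh B"
    using A B C cosh_real_nonneg_le_iff[of "arcosh (- lorentz u w)" "arcosh A + arcosh B"] by simp
  then show ?thesis by (simp add: A_def B_def)
qed

lemma model_dist_hyperboloid:
  assumes \<kappa>: "\<kappa> < 0" and u: "u \<in> model_surface \<kappa>" and v: "v \<in> model_surface \<kappa>"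
  shows "model_dist \<kappa> u v = arcosh (- lorentz (sqrt (- \<kappa>) *\<^sub>R u) (sqrt (- \<kappa>) *\<^sub>R v)) / sqrt (- \<kappa>)"
    "lorentz (sqrt (- \<kappa>) *\<^sub>R u) (sqrt (- \<kappa>) *\<^sub>R u) = -1" "(sqrt (- \<kappa>) *\<^sub>R u) $ 3 > 0"
proof -
  have s: "lorentz (sqrt (- \<kappa>) *\<^sub>R x) (sqrt (- \<kappa>) *\<^sub>R y) = - \<kappa> * lorentz x y" for x y
  proof -
    have "lorentz (sqrt (- \<kappa>) *\<^sub>R x) (sqrt (- \<kappa>) *\<^sub>R y) = (sqrt (- \<kappa>) * sqrt (- \<kappa>)) * lorentz x y"
      by (simp add: lorentz_def algebra_simps del: real_sqrt_mult_self)
    then show ?thesis using \<kappa> by simp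
  qed
  show "model_dist \<kappa> u v = arcosh (- lorentz (sqrt (- \<kappa>) *\<^sub>R u) (sqrt (- \<kappa>) *\<^sub>R v)) / sqrt (- \<kappa>)"
    unfolding s using assms by (simp add: model_dist_def)
  show "lorentz (sqrt (- \<kappa>) *\<^sub>R u) (sqrt (- \<kappa>) *\<^sub>R u) = -1" "(sqrt (- \<kappa>) *\<^sub>R u) $ 3 > 0"
    unfolding s using \<kappa> u by (auto simp: model_surface_def)
qed

lemma Metric_space_model_hyperboloid:
  assumes \<kappa>: "\<kappa> < 0"
  shows "Metric_space (model_surface \<kappa>) (model_dist \<kappa>)"
proof
  note D = model_dist_hyperboloid[OF \<kappa>]
  let ?s = "\<lambda>x::real^3. sqrt (- \<kappa>) *\<^sub>R x"
  have ab: "- lorentz (?s u) (?s v) \<ge> 1" if "u \<in> model_surface \<kappa>" "v \<in> model_surface \<kappa>" for u v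
    using lorentz_hyperboloid[OF D(2,3)[OF that(1,1)] D(2,3)[OF that(2,2)]] by simp
  show "0 \<le> model_dist \<kappa> x y" for x y
  proof (cases "x \<in> model_surface \<kappa> \<and> y \<in> model_surface \<kappa>")
    case True
    then show ?thesis using D(1)[of x y] ab[of x y] \<kappa> by (simp add: divide_nonneg_nonneg)
  qed (auto simp: model_dist_def)
  show "model_dist \<kappa> x y = model_dist \<kappa> y x" for x y
    by (auto simp: model_dist_def inner_commute dist_commute lorentz_def mult.commute)
  show "(model_dist \<kappa> x y = 0) = (x = y)" if xy: "x \<in> model_surface \<kappa>" "y \<in> model_surface \<kappa>" for x y
  proof -
    have "model_dist \<kappa> x y = 0 \<longleftrightarrow> - lorentz (?s x) (?s y) = 1"
      using D(1)[OF that] \<kappa> ab[OF that] by simp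
    also have "\<dots> \<longleftrightarrow> ?s x = ?s y"
    proof
      assume one: "- lorentz (?s x) (?s y) = 1"
      define p q where "p = ?s x" and "q = ?s y"
      have p: "lorentz p p = -1" "p $ 3 > 0" and q: "lorentz q q = -1" "q $ 3 > 0"
        using D(2,3) xy by (auto simp: p_def q_def)
      have pq: "lorentz p q = -1" using one by (simp add: p_def q_def)
      \<comment> \<open>In the case of equality, \<open>p - q\<close> is a null vector orthogonal to
        the timelike \<open>q\<close>, and such a vector vanishes.\<close>
      have o: "lorentz (p - q) q = 0" using pq q by (simp add: lorentz_def algebra_simps)
      have z: "lorentz (p - q) (p - q) = 0" using pq p q by (simp add: lorentz_def algebra_simps)
      let ?m = "p - q"
      have "(?m$3 * q$3)\<^sup>2 = (?m$1 * q$1 + ?m$2 * q$2)\<^sup>2" using o by (simp add: lorentz_def)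
      also have "\<dots> \<le> ((?m$1)\<^sup>2 + (?m$2)\<^sup>2) * ((q$1)\<^sup>2 + (q$2)\<^sup>2)"
        using zero_le_power2[of "?m$1 * q$2 - ?m$2 * q$1"] by (simp add: power2_eq_square algebra_simps)
      also have "(?m$1)\<^sup>2 + (?m$2)\<^sup>2 = (?m$3)\<^sup>2"
        using z by (simp add: lorentz_def power2_eq_square)
      also have "(q$1)\<^sup>2 + (q$2)\<^sup>2 = (q$3)\<^sup>2 - 1"
        using q by (simp add: lorentz_def power2_eq_square)
      finally have "(?m$3)\<^sup>2 * (q$3)\<^sup>2 \<le> (?m$3)\<^sup>2 * ((q$3)\<^sup>2 - 1)" by (simp only: power_mult_distrib)
      then have "(?m$3)\<^sup>2 \<le> 0" by (simp only: right_diff_distrib)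
      then have m3: "?m$3 = 0" by simp
      then have "(?m$1)\<^sup>2 + (?m$2)\<^sup>2 = 0" using z by (simp add: lorentz_def power2_eq_square)
      then have "?m$1 = 0" "?m$2 = 0" by (simp_all add: sum_power2_eq_zero_iff)
      then have "p = q" using m3 by (simp add: vec_eq_iff forall_3)
      then show "?s x = ?s y" by (simp add: p_def q_def)
    next
      assume "?s x = ?s y"
      then have "x = y" using \<kappa> by simp
      then show "- lorentz (?s x) (?s y) = 1" by (simp only: D(2)[OF xy(2,2)] minus_minus)
    qed
    also have "\<dots> \<longleftrightarrow> x = y" using \<kappa> by simp
    finally show ?thesis .
  qed
  show "model_dist \<kappa> x z \<le> model_dist \<kappa> x y + model_dist \<kappa> y z"
    if "x \<in> model_surface \<kappa>" "y \<in> model_surface \<kappa>" "z \<in> model_surface \<kappa>" for x y z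
    using arcosh_lorentz_triangle[OF D(2,3)[OF that(1,1)] D(2,3)[OF that(2,2)] D(2,3)[OF that(3,3)]] \<kappa>
    unfolding D(1)[OF that(1,3)] D(1)[OF that(1,2)] D(1)[OF that(2,3)]
    by (simp only: add_divide_distrib[symmetric]) (intro divide_right_mono, auto)
qed

text \<open>One side is placed on the curve \<open>(sinh, 0, cosh)\<close>, along which
  \<open>cosh\<close> of the scaled distance to the third vertex is a combination of
  \<open>cosh\<close> and \<open>sinh\<close>. The hyperbolic law of cosines at the far end fixes
  \<open>P\<close>.\<close>

lemma comparison_hyperboloid:
  assumes \<kappa>: "\<kappa> < 0" and l: "0 < l" and nn: "0 \<le> b" "0 \<le> c" and tri: "l \<le> b + c" "b \<le> l + c" "c \<le> l + b"
    and u: "0 \<le> u" "u \<le> l"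
  shows "\<exists>z1\<in>model_surface \<kappa>. \<exists>z2\<in>model_surface \<kappa>. \<exists>z3\<in>model_surface \<kappa>. \<exists>h.
    model_dist \<kappa> z1 z2 = b \<and> model_dist \<kappa> z2 z3 = c \<and> model_dist \<kappa> z3 z1 = l \<and>
    shortest_path (model_surface \<kappa>) (model_dist \<kappa>) z1 z3 h 0 l \<and> model_dist \<kappa> z1 (h u) = u \<and>
    sinh (sqrt (- \<kappa>) * l) * cosh (sqrt (- \<kappa>) * model_dist \<kappa> (h u) z2)
      = sinh (sqrt (- \<kappa>) * (l - u)) * cosh (sqrt (- \<kappa>) * b) + sinh (sqrt (- \<kappa>) * u) * cosh (sqrt (- \<kappa>) * c)"
proof -
  define k where "k = sqrt (- \<kappa>)"
  have k: "k > 0" and kk: "- (k * k) = \<kappa>" using \<kappa> by (auto simp: k_def)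
  have kt: "k * l \<le> k * b + k * c" "k * b \<le> k * l + k * c" "k * c \<le> k * l + k * b"
    using tri k by (simp_all add: distrib_left[symmetric])
  have kl: "0 < k * l" and kb: "0 \<le> k * b" and kc: "0 \<le> k * c"
    using l k nn by auto
  have sl: "sinh (k * l) > 0" using kl by simp
  have sb: "sinh (k * b) \<ge> 0" using kb by simp
  define P where "P = (cosh (k * b) * cosh (k * l) - cosh (k * c)) / sinh (k * l)"
  have "cosh (k * l - k * b) \<le> cosh (k * c)"
  proof -
    have "cosh \<bar>k * l - k * b\<bar> \<le> cosh (k * c)"
      by (subst cosh_real_nonneg_le_iff) (use kc kt in auto)
    then show ?thesis by simp
  qed
  moreover have "cosh (k * c) \<le> cosh (k * l + k * b)"
    by (subst cosh_real_nonneg_le_iff) (use kc kb kl kt in auto)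
  ultimately have "\<bar>cosh (k * b) * cosh (k * l) - cosh (k * c)\<bar> \<le> sinh (k * l) * sinh (k * b)"
    by (simp add: cosh_add cosh_diff abs_le_iff mult.commute)
  then have "\<bar>P\<bar> \<le> sinh (k * b)"
    using sl by (simp add: P_def abs_mult field_simps)
  then have "P\<^sup>2 \<le> (sinh (k * b))\<^sup>2" using sb by (metis abs_le_square_iff abs_of_nonneg)
  then have Q: "(sqrt ((sinh (k * b))\<^sup>2 - P\<^sup>2)) * (sqrt ((sinh (k * b))\<^sup>2 - P\<^sup>2)) = (sinh (k * b))\<^sup>2 - P\<^sup>2" by simp
  define e :: "real \<Rightarrow> real^3" where "e t = (1 / k) *\<^sub>R vector [sinh (k * t), 0, cosh (k * t)]" for t
  define z2 :: "real^3" where "z2 = (1 / k) *\<^sub>R vector [P, sqrt ((sinh (k * b))\<^sup>2 - P\<^sup>2), cosh (k * b)]"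
  have sc: "\<kappa> * lorentz ((1 / k) *\<^sub>R x) ((1 / k) *\<^sub>R y) = - lorentz x y" for x y
    using k by (simp add: kk[symmetric] lorentz_def algebra_simps)
  have in_modelI: "(1 / k) *\<^sub>R x \<in> model_surface \<kappa>" if "lorentz x x = -1" "x $ 3 > 0" for x
    using sc[of x x] that k \<kappa> by (simp add: model_surface_def field_simps)
  have e: "e t \<in> model_surface \<kappa>" for t
    unfolding e_def using cosh_square_eq[of "k * t"]
    by (intro in_modelI) (auto simp: lorentz_def power2_eq_square)
  have z2: "z2 \<in> model_surface \<kappa>"
    unfolding z2_def using cosh_square_eq[of "k * b"] Q
    by (intro in_modelI) (auto simp: lorentz_def power2_eq_square)
  have ip: "\<kappa> * lorentz (e t) z2 = cosh (k * b) * cosh (k * t) - P * sinh (k * t)" for t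
    unfolding e_def z2_def sc by (simp add: lorentz_def mult.commute)
  have ez: "model_dist \<kappa> (e t) z2 = arcosh (cosh (k * b) * cosh (k * t) - P * sinh (k * t)) / k" for t
    using \<kappa> e[of t] z2 by (simp add: model_dist_def k_def ip[unfolded k_def])
  have ee: "model_dist \<kappa> (e s) (e t) = t - s" if "0 \<le> s" "s \<le> t" "t \<le> l" for s t
  proof -
    have "\<kappa> * lorentz (e s) (e t) = cosh (k * t - k * s)"
      unfolding e_def sc by (simp add: lorentz_def cosh_diff mult.commute)
    then have "model_dist \<kappa> (e s) (e t) = arcosh (cosh (k * t - k * s)) / k"
      using \<kappa> e[of s] e[of t] by (simp add: model_dist_def k_def)
    moreover have "0 \<le> k * t - k * s" using that k by simp
    ultimately have "model_dist \<kappa> (e s) (e t) = k * (t - s) / k" by (simp add: arcosh_cosh_real right_diff_distrib)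
    then show ?thesis using k by simp
  qed
  interpret Metric_space "model_surface \<kappa>" "model_dist \<kappa>" by (rule Metric_space_model_hyperboloid[OF \<kappa>])
  have Pl: "P * sinh (k * l) = cosh (k * b) * cosh (k * l) - cosh (k * c)" using sl unfolding P_def by (metis less_irrefl nonzero_eq_divide_eq)
  have arg: "1 \<le> cosh (k * b) * cosh (k * t) - P * sinh (k * t)" for t
  proof -
    have k1: "sqrt (- \<kappa>) *\<^sub>R ((1 / k) *\<^sub>R x) = x" for x :: "real^3" using k by (simp add: k_def)
    have "lorentz (sqrt (- \<kappa>) *\<^sub>R e t) (sqrt (- \<kappa>) *\<^sub>R z2) \<le> -1"
      using model_dist_hyperboloid(2,3)[OF \<kappa> e e] model_dist_hyperboloid(2,3)[OF \<kappa> z2 z2]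
      by (intro lorentz_hyperboloid)
    moreover have "lorentz (sqrt (- \<kappa>) *\<^sub>R e t) (sqrt (- \<kappa>) *\<^sub>R z2) = - (\<kappa> * lorentz (e t) z2)"
      unfolding e_def z2_def sc k1 by simp
    ultimately show ?thesis using ip by simp
  qed
  have 1: "model_dist \<kappa> (e 0) z2 = b" using k kb by (simp add: ez arcosh_cosh_real)
  have "model_dist \<kappa> (e l) z2 = c" using k kc by (simp add: ez Pl arcosh_cosh_real)
  then have 2: "model_dist \<kappa> z2 (e l) = c" using commute by metis
  have 3: "model_dist \<kappa> (e l) (e 0) = l" using ee[of 0 l] l commute by simp
  have 4: "shortest_path (model_surface \<kappa>) (model_dist \<kappa>) (e 0) (e l) e 0 l"
    by (rule shortest_path_isometric) (use l e ee in auto)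
  have 5: "model_dist \<kappa> (e 0) (e u) = u" using ee[of 0 u] u by simp
  have 6: "sinh (k * l) * cosh (k * model_dist \<kappa> (e u) z2)
      = sinh (k * (l - u)) * cosh (k * b) + sinh (k * u) * cosh (k * c)"
  proof -
    have ce: "cosh (k * model_dist \<kappa> (e u) z2) = cosh (k * b) * cosh (k * u) - P * sinh (k * u)"
      using k arg[of u] by (simp add: ez)
    have "sinh (k * l) * cosh (k * model_dist \<kappa> (e u) z2)
       = sinh (k * l) * cosh (k * b) * cosh (k * u) - (P * sinh (k * l)) * sinh (k * u)"
      unfolding ce by (simp add: algebra_simps)
    then show ?thesis unfolding Pl by (simp add: right_diff_distrib sinh_diff algebra_simps)
  qed
  show ?thesis
    unfolding k_def[symmetric] using e z2 1 2 3 4 5 6 by blast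
qed

section \<open>Consequences of the curvature bound\<close>

text \<open>If every point of \<open>H\<close> violated the bound, \<open>step\<close> could be
  iterated forever. Then \<open>e x q - b\<close> would be at most \<open>(1 - a)^n\<close> times
  its initial value, for all of the finitely many \<open>q\<close> at once, and would fall below
  \<open>T - b\<close>.\<close>

lemma contraction_reaches:
  fixes e :: "'a \<Rightarrow> 'b \<Rightarrow> real"
  assumes F: "finite F" and "x0 \<in> H" and a: "0 < a" "a < 1" and bT: "b < T"
    and step: "\<And>x p. x \<in> H \<Longrightarrow> p \<in> F \<Longrightarrow> e x p > T \<Longrightarrow> \<exists>y\<in>H. \<forall>q\<in>F. e y q \<le> (1 - a) * e x q + a * b"
  shows "\<exists>x\<in>H. \<forall>q\<in>F. e x q \<le> T"
proof (rule ccontr)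
  assume neg: "\<not> ?thesis"
  have "\<forall>x. \<exists>y. x \<in> H \<longrightarrow> y \<in> H \<and> (\<forall>q\<in>F. e y q \<le> (1 - a) * e x q + a * b)"
    using neg step by (meson not_le)
  then obtain nxt where nx: "\<And>x. x \<in> H \<Longrightarrow> nxt x \<in> H \<and> (\<forall>q\<in>F. e (nxt x) q \<le> (1 - a) * e x q + a * b)"
    by metis
  define X where "X n = (nxt ^^ n) x0" for n
  have XH: "X n \<in> H" for n
    by (induction n) (auto simp: X_def \<open>x0 \<in> H\<close> nx)
  have dec: "e (X n) q - b \<le> (1 - a) ^ n * (e x0 q - b)" if "q \<in> F" for n q
  proof (induction n)
    case (Suc n)
    have "e (X (Suc n)) q - b \<le> (1 - a) * (e (X n) q - b)"
      using nx[OF XH[of n]] that by (simp add: X_def algebra_simps)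
    also have "\<dots> \<le> (1 - a) * ((1 - a) ^ n * (e x0 q - b))"
      using Suc a by (intro mult_left_mono) auto
    finally show ?case by (simp add: mult.assoc)
  qed (simp add: X_def)
  define B where "B = (\<Sum>q\<in>F. \<bar>e x0 q - b\<bar>)"
  have "(\<lambda>n. (1 - a) ^ n * B) \<longlonglongrightarrow> 0 * B"
    using a by (intro tendsto_mult LIMSEQ_realpow_zero) auto
  then have "\<forall>\<^sub>F n in sequentially. (1 - a) ^ n * B < T - b"
    using bT by (intro order_tendstoD) auto
  then obtain n where n: "(1 - a) ^ n * B < T - b"
    by (auto simp: eventually_sequentially)
  have "e (X n) q \<le> T" if "q \<in> F" for q
  proof -
    have "e x0 q - b \<le> B" unfolding B_def
      using member_le_sum[of q F "\<lambda>q. \<bar>e x0 q - b\<bar>"] F that by simp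
    then have "(1 - a) ^ n * (e x0 q - b) \<le> (1 - a) ^ n * B"
      using a by (intro mult_left_mono) auto
    then show ?thesis using dec[OF that, of n] n by linarith
  qed
  then show False using neg XH by blast
qed

text \<open>In terms of \<open>c = cos (t / 2)\<close> the difference is
  \<open>(1 - c) * (4 * c^2 - 3) / 2\<close>, positive as \<open>t / 2 < pi / 6\<close>. By the
  spherical Pythagorean theorem it says that a right triangle with both legs \<open>3/4 * t\<close>
  has a hypotenuse longer than \<open>t\<close>.\<close>

lemma cos_gt_cos_three_quarters:
  assumes "0 < t" "t < pi / 4"
  shows "(cos (3 / 4 * t))\<^sup>2 < cos t"
proof -
  define c where "c = cos (t / 2)"
  have "cos (pi / 6) < c" "c < cos 0"
    unfolding c_def using assms by (intro cos_monotone_0_pi; simp)+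
  then have c: "sqrt 3 / 2 < c" "c < 1" by (simp_all add: cos_30)
  then have "(sqrt 3 / 2)\<^sup>2 < c\<^sup>2" by (intro power_strict_mono) auto
  then have "0 < (1 - c) * (4 * c\<^sup>2 - 3)" using c by (simp add: power2_eq_square)
  moreover have "2 * (cos (3 / 4 * t))\<^sup>2 = 1 + cos (3 * (t / 2))"
    using cos_double_cos[of "3 / 4 * t"] by simp
  moreover have "cos t = 2 * c\<^sup>2 - 1" using cos_double_cos[of "t / 2"] by (simp add: c_def)
  ultimately show ?thesis
    unfolding cos_treble_cos c_def[symmetric]
    by (simp add: power2_eq_square power3_eq_cube algebra_simps)
qed

text \<open>The same statement on right triangles in the hyperbolic plane; here the difference is
  \<open>(c - 1) * (4 * c^2 - 3) / 2\<close> with \<open>c = cosh (t / 2) > 1\<close>.\<close>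

lemma cosh_less_cosh_three_quarters:
  assumes "0 < t"
  shows "cosh t < (cosh (3 / 4 * t :: real))\<^sup>2"
proof -
  define c where "c = cosh (t / 2)"
  have c: "c > 1" unfolding c_def using assms cosh_real_nonneg_less_iff[of 0 "t / 2"] by simp
  then have "1 < c\<^sup>2" by (simp add: one_less_power)
  then have "0 < 4 * c\<^sup>2 - 3" by linarith
  then have "0 < (c - 1) * (4 * c\<^sup>2 - 3)" using c by (intro mult_pos_pos) auto
  moreover have dbl: "cosh (2 * x) = 2 * (cosh x)\<^sup>2 - 1" for x :: real
    using cosh_add[of x x] cosh_square_eq[of x] by (simp add: power2_eq_square)
  moreover have "2 * (cosh (3 / 4 * t))\<^sup>2 = 1 + cosh (2 * (t / 2) + t / 2)"
    using dbl[of "3 / 4 * t"] by (simp add: algebra_simps)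
  moreover have "cosh (2 * (t / 2) + t / 2) = 4 * c ^ 3 - 3 * c"
    unfolding cosh_add dbl[of "t / 2"] sinh_double c_def[symmetric]
    using cosh_square_eq[of "t / 2"]
    by (simp add: c_def power2_eq_square power3_eq_cube algebra_simps)
  moreover have "cosh t = 2 * c\<^sup>2 - 1" using dbl[of "t / 2"] by (simp add: c_def)
  ultimately show ?thesis
    by (simp add: power2_eq_square power3_eq_cube algebra_simps)
qed

section \<open>Triangle comparison as explicit inequalities\<close>

context geodesic_space
begin

text \<open>The explicit comparison triangles are inserted into the definition of curvature. What
  remains is a closed inequality between distances, in a form linear in a monotone function of the
  distance to \<open>x2\<close>.\<close>

lemma curvature_comparison:
  assumes curv: "curvature_le \<kappa> M d" and ball: "p \<in> M" "0 < s" "metric_convex M d (mball p s)"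
    and x: "x1 \<in> mball p s" "x2 \<in> mball p s" "x3 \<in> mball p s" "x1 \<noteq> x3"
    and y: "y \<in> M" "d x1 y + d y x3 = d x1 x3"
    and per: "\<kappa> > 0 \<longrightarrow> d x1 x2 + d x2 x3 + d x3 x1 < 2 * pi / sqrt \<kappa>"
  shows "\<kappa> > 0 \<Longrightarrow> sin (sqrt \<kappa> * d y x3) * cos (sqrt \<kappa> * d x1 x2) + sin (sqrt \<kappa> * d x1 y) * cos (sqrt \<kappa> * d x2 x3)
            \<le> sin (sqrt \<kappa> * d x1 x3) * cos (sqrt \<kappa> * d y x2)" (is "_ \<Longrightarrow> ?pos")
    and "\<kappa> = 0 \<Longrightarrow> d x1 x3 * (d y x2)\<^sup>2
            \<le> d y x3 * (d x1 x2)\<^sup>2 + d x1 y * (d x2 x3)\<^sup>2 - d x1 y * d y x3 * d x1 x3" (is "_ \<Longrightarrow> ?zero")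
    and "\<kappa> < 0 \<Longrightarrow> sinh (sqrt (- \<kappa>) * d x1 x3) * cosh (sqrt (- \<kappa>) * d y x2)
            \<le> sinh (sqrt (- \<kappa>) * d y x3) * cosh (sqrt (- \<kappa>) * d x1 x2)
              + sinh (sqrt (- \<kappa>) * d x1 y) * cosh (sqrt (- \<kappa>) * d x2 x3)" (is "_ \<Longrightarrow> ?neg")
proof -
  have M: "x1 \<in> M" "x2 \<in> M" "x3 \<in> M" using x by auto
  define l b c u where "l = d x1 x3" and "b = d x1 x2" and "c = d x2 x3" and "u = d x1 y"
  have l: "0 < l" using M x by (simp add: l_def)
  have nn: "0 \<le> b" "0 \<le> c" by (auto simp: b_def c_def)
  have tri: "l \<le> b + c" "b \<le> l + c" "c \<le> l + b"
    using triangle[of x1 x2 x3] triangle[of x1 x3 x2] triangle[of x2 x1 x3] M commute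
    by (auto simp: l_def b_def c_def)
  have lu: "l - u = d y x3" using y by (simp add: l_def u_def)
  have u: "0 \<le> u" "u \<le> l" using y(2) nonneg[of y x3] nonneg[of x1 y] unfolding u_def l_def by linarith+
  obtain g where g: "shortest_path M d x1 x3 g 0 l" "g u = y"
    using geodesic_through[OF M(1,3) y] by (auto simp: l_def u_def)
  then have gy: "y \<in> g ` {0..l}" using u by auto
  have main: "d y x2 \<le> model_dist \<kappa> (h u) z2"
    if z: "z1 \<in> model_surface \<kappa>" "z2 \<in> model_surface \<kappa>" "z3 \<in> model_surface \<kappa>"
      "model_dist \<kappa> z1 z2 = b" "model_dist \<kappa> z2 z3 = c" "model_dist \<kappa> z3 z1 = l"
      "shortest_path (model_surface \<kappa>) (model_dist \<kappa>) z1 z3 h 0 l" "model_dist \<kappa> z1 (h u) = u"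
    for z1 z2 z3 h
  proof -
    have "h u \<in> h ` {0..l}" using u by auto
    moreover have "d x3 x1 = l" by (simp add: l_def commute)
    ultimately show ?thesis
      using curv[unfolded curvature_le_def, rule_format, OF ball x(1,2,3), of g 0 l y z1 z2 z3 h 0 l "h u"]
        per g gy z by (simp add: b_def c_def u_def)
  qed
  show ?pos if \<kappa>: "\<kappa> > 0"
  proof -
    have per': "b + c + l < 2 * pi / sqrt \<kappa>" using per \<kappa> commute[of x3 x1] by (simp add: b_def c_def l_def)
    obtain z1 z2 z3 h where z: "z1 \<in> model_surface \<kappa>" "z2 \<in> model_surface \<kappa>" "z3 \<in> model_surface \<kappa>"
      "model_dist \<kappa> z1 z2 = b" "model_dist \<kappa> z2 z3 = c" "model_dist \<kappa> z3 z1 = l"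
      "shortest_path (model_surface \<kappa>) (model_dist \<kappa>) z1 z3 h 0 l" "model_dist \<kappa> z1 (h u) = u"
      and eq: "sin (sqrt \<kappa> * l) * cos (sqrt \<kappa> * model_dist \<kappa> (h u) z2)
        = sin (sqrt \<kappa> * (l - u)) * cos (sqrt \<kappa> * b) + sin (sqrt \<kappa> * u) * cos (sqrt \<kappa> * c)"
      using comparison_sphere[OF \<kappa> l nn tri per' u] by blast
    \<comment> \<open>Off the surface \<open>model_dist\<close> is 0 by convention and the arccos
      formula fails; continuity of \<open>h\<close> into the surface excludes this.\<close>
    have hu: "h u \<in> model_surface \<kappa>"
    proof (rule ccontr)
      assume "h u \<notin> model_surface \<kappa>"
      moreover have "continuous_map (top_of_set {0..l}) (Metric_space.mtopology (model_surface \<kappa>) (model_dist \<kappa>)) h"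
        using z(7) by (simp add: shortest_path_def path_between_def)
      ultimately show False
        using continuous_map_image_subset_topspace u
          Metric_space.topspace_mtopology[OF Metric_space_model_sphere[OF \<kappa>]] by fastforce
    qed
    have "\<bar>(sqrt \<kappa> *\<^sub>R h u) \<bullet> (sqrt \<kappa> *\<^sub>R z2)\<bar> \<le> 1"
      using Cauchy_Schwarz_ineq2[of "sqrt \<kappa> *\<^sub>R h u" "sqrt \<kappa> *\<^sub>R z2"]
        model_dist_sphere(2)[OF \<kappa> hu hu] model_dist_sphere(2)[OF \<kappa> z(2,2)] by (simp only: mult_1)
    then have "sqrt \<kappa> * model_dist \<kappa> (h u) z2 \<le> pi"
      using model_dist_sphere(1)[OF \<kappa> hu z(2)] arccos_ubound \<kappa> by (simp add: abs_le_iff)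
    moreover have "sqrt \<kappa> * d y x2 \<le> sqrt \<kappa> * model_dist \<kappa> (h u) z2"
      using main[OF z] \<kappa> by (intro mult_left_mono) auto
    ultimately have "cos (sqrt \<kappa> * model_dist \<kappa> (h u) z2) \<le> cos (sqrt \<kappa> * d y x2)"
      using \<kappa> by (intro cos_monotone_0_pi_le) auto
    moreover have "sqrt \<kappa> * l < pi"
    proof -
      have "l + l < 2 * pi / sqrt \<kappa>" using per \<kappa> tri commute[of x3 x1] by (simp add: b_def c_def l_def)
      then show ?thesis using \<kappa> by (simp add: field_simps)
    qed
    then have "0 \<le> sin (sqrt \<kappa> * l)" using \<kappa> l by (intro sin_ge_zero) auto
    ultimately show ?thesis
      using eq mult_left_mono by (fastforce simp: lu[symmetric] l_def[symmetric] b_def[symmetric] c_def[symmetric] u_def[symmetric])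
  qed
  show ?zero if \<kappa>: "\<kappa> = 0"
  proof -
    obtain z1 z2 z3 h where z: "z1 \<in> model_surface \<kappa>" "z2 \<in> model_surface \<kappa>" "z3 \<in> model_surface \<kappa>"
      "model_dist \<kappa> z1 z2 = b" "model_dist \<kappa> z2 z3 = c" "model_dist \<kappa> z3 z1 = l"
      "shortest_path (model_surface \<kappa>) (model_dist \<kappa>) z1 z3 h 0 l" "model_dist \<kappa> z1 (h u) = u"
      and eq: "l * (model_dist \<kappa> (h u) z2)\<^sup>2 = (l - u) * b\<^sup>2 + u * c\<^sup>2 - u * (l - u) * l"
      using comparison_plane[OF l nn tri u] \<kappa> by blast
    have "(d y x2)\<^sup>2 \<le> (model_dist \<kappa> (h u) z2)\<^sup>2" using main[OF z] by (intro power_mono) auto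
    then have "l * (d y x2)\<^sup>2 \<le> l * (model_dist \<kappa> (h u) z2)\<^sup>2" using l by simp
    then show ?thesis unfolding eq
      by (simp add: lu[symmetric] l_def[symmetric] b_def[symmetric] c_def[symmetric] u_def[symmetric])
  qed
  show ?neg if \<kappa>: "\<kappa> < 0"
  proof -
    obtain z1 z2 z3 h where z: "z1 \<in> model_surface \<kappa>" "z2 \<in> model_surface \<kappa>" "z3 \<in> model_surface \<kappa>"
      "model_dist \<kappa> z1 z2 = b" "model_dist \<kappa> z2 z3 = c" "model_dist \<kappa> z3 z1 = l"
      "shortest_path (model_surface \<kappa>) (model_dist \<kappa>) z1 z3 h 0 l" "model_dist \<kappa> z1 (h u) = u"
      and eq: "sinh (sqrt (- \<kappa>) * l) * cosh (sqrt (- \<kappa>) * model_dist \<kappa> (h u) z2)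
        = sinh (sqrt (- \<kappa>) * (l - u)) * cosh (sqrt (- \<kappa>) * b) + sinh (sqrt (- \<kappa>) * u) * cosh (sqrt (- \<kappa>) * c)"
      using comparison_hyperboloid[OF \<kappa> l nn tri u] by blast
    have "sqrt (- \<kappa>) * d y x2 \<le> sqrt (- \<kappa>) * model_dist \<kappa> (h u) z2"
      using main[OF z] \<kappa> by (intro mult_left_mono) auto
    moreover have "0 \<le> sqrt (- \<kappa>) * d y x2" using \<kappa> by simp
    ultimately have "cosh (sqrt (- \<kappa>) * d y x2) \<le> cosh (sqrt (- \<kappa>) * model_dist \<kappa> (h u) z2)"
      by (subst cosh_real_nonneg_le_iff) auto
    then have "sinh (sqrt (- \<kappa>) * l) * cosh (sqrt (- \<kappa>) * d y x2)
        \<le> sinh (sqrt (- \<kappa>) * l) * cosh (sqrt (- \<kappa>) * model_dist \<kappa> (h u) z2)"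
      using \<kappa> l by (intro mult_left_mono) auto
    then show ?thesis unfolding eq
      by (simp add: lu[symmetric] l_def[symmetric] b_def[symmetric] c_def[symmetric] u_def[symmetric])
  qed
qed

lemma between_exists:
  assumes "x \<in> M" "y \<in> M" "0 \<le> u" "u \<le> d x y"
  obtains z where "z \<in> M" "d x z = u" "d z y = d x y - u"
proof -
  obtain g where g: "g 0 = x" "g (d x y) = y" "\<And>t. 0 \<le> t \<Longrightarrow> t \<le> d x y \<Longrightarrow> g t \<in> M"
    "\<And>s t. 0 \<le> s \<Longrightarrow> s \<le> t \<Longrightarrow> t \<le> d x y \<Longrightarrow> d (g s) (g t) = t - s"
    using geodesic[OF assms(1,2)] by metis
  show thesis
    using that[of "g u"] g(3)[of u] g(4)[of 0 u] g(4)[of u "d x y"] g(1,2) assms by simp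
qed

end

section \<open>Strict convexity of balls and Jung's theorem\<close>

text \<open>For positive \<open>\<kappa>\<close> the last bound keeps scaled distances inside a ball
  of radius \<open>r\<close> below \<open>pi / 2\<close>. There cosines are positive, and perimeters
  of triangles are short enough for comparison.\<close>

locale cat_space = geodesic_space M d for M :: "'a set" and d +
  fixes \<kappa> r :: real
  assumes curvature: "curvature_le \<kappa> M d"
    and r_pos: "0 < r"
    and convex_ball: "x \<in> M \<Longrightarrow> 0 < s \<Longrightarrow> s \<le> r \<Longrightarrow> metric_convex M d (mball x s)"
    and r_small: "\<kappa> > 0 \<Longrightarrow> sqrt \<kappa> * r < pi / 4"
begin

lemma ball_dist:
  assumes "x \<in> mball p r" "y \<in> mball p r"
  shows "d x y < 2 * r" and "\<kappa> > 0 \<Longrightarrow> sqrt \<kappa> * d x y < pi / 2"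
proof -
  have "d x y \<le> d p x + d p y" using triangle[of x p y] commute[of x p] assms by auto
  then show *: "d x y < 2 * r" using assms by auto
  assume \<kappa>: "\<kappa> > 0"
  then have "sqrt \<kappa> * d x y < sqrt \<kappa> * (2 * r)" using * by (intro mult_strict_left_mono) auto
  then show "sqrt \<kappa> * d x y < pi / 2" using r_small[OF \<kappa>] by simp
qed

lemma perimeter_small:
  assumes "x \<in> mball p r" "y \<in> mball p r" "z \<in> mball p r"
  shows "\<kappa> > 0 \<longrightarrow> d x y + d y z + d z x < 2 * pi / sqrt \<kappa>"
proof
  assume \<kappa>: "\<kappa> > 0"
  then have "sqrt \<kappa> * (d x y + d y z + d z x) < 2 * pi"
    using ball_dist(2)[OF assms(1,2) \<kappa>] ball_dist(2)[OF assms(2,3) \<kappa>] ball_dist(2)[OF assms(3,1) \<kappa>] pi_gt_zero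
    unfolding distrib_left by linarith
  then show "d x y + d y z + d z x < 2 * pi / sqrt \<kappa>" using \<kappa> by (simp add: field_simps)
qed

text \<open>A single midpoint serves all \<open>q\<close>, which is what uniqueness of a minimizer
  of a maximum requires. Strictness comes from the factor \<open>cos h < 1\<close>, from the square
  term of Stewart's theorem, or from \<open>cosh h > 1\<close>.\<close>

lemma midpoint_closer:
  assumes p: "p \<in> M" and x: "x \<in> mball p r" and y: "y \<in> mball p r" and "x \<noteq> y"
  obtains m where "m \<in> M" "\<And>q. q \<in> mball p r \<Longrightarrow> d m q < max (d x q) (d y q)"
proof -
  have M: "x \<in> M" "y \<in> M" using x y by auto
  then have l: "d x y > 0" using \<open>x \<noteq> y\<close> by simp
  obtain m where m: "m \<in> M" "d x m = d x y / 2" "d m y = d x y / 2"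
    using between_exists[OF M, of "d x y / 2"] l by auto
  have "d m q < max (d x q) (d y q)" if q: "q \<in> mball p r" for q
  proof -
    have qM: "q \<in> M" using q by auto
    have cb: "metric_convex M d (mball p r)" using convex_ball p r_pos by simp
    note C = curvature_comparison[OF curvature p r_pos cb x q y \<open>x \<noteq> y\<close> m(1) _ perimeter_small[OF x q y]]
    define b where "b = max (d x q) (d y q)"
    have b: "d x q \<le> b" "d q y \<le> b" using commute[of q y] by (auto simp: b_def)
    then have b0: "0 \<le> b" using nonneg[of x q] by linarith
    consider "\<kappa> > 0" | "\<kappa> = 0" | "\<kappa> < 0" by linarith
    then have "d m q < b"
    proof cases
      case 1
      define k where "k = sqrt \<kappa>"
      have k: "k > 0" using 1 by (simp add: k_def)
      define h where "h = k * (d x y / 2)"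
      have h: "0 < h" "h < pi / 4" using l k ball_dist(2)[OF x y 1] by (auto simp: h_def k_def)
      have "k * d x q < pi / 2" "k * d y q < pi / 2"
        using ball_dist(2)[OF x q 1] ball_dist(2)[OF y q 1] by (auto simp: k_def)
      then have kb: "k * b < pi / 2" by (auto simp: b_def max_def)
      have S: "sin h > 0" "cos h > 0" "cos h < 1"
        using h cos_monotone_0_pi[of 0 h] by (auto intro!: sin_gt_zero cos_gt_zero)
      have "k * d x y = 2 * h" by (simp add: h_def)
      then have "sin h * cos (k * d x q) + sin h * cos (k * d q y) \<le> 2 * sin h * cos h * cos (k * d m q)"
        using C(1)[OF _ 1] m by (simp add: k_def[symmetric] h_def[symmetric] sin_double)
      then have "sin h * (cos (k * d x q) + cos (k * d q y)) \<le> sin h * (2 * cos h * cos (k * d m q))"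
        by (simp add: algebra_simps)
      then have 2: "cos (k * d x q) + cos (k * d q y) \<le> 2 * cos h * cos (k * d m q)" using S by simp
      have "cos (k * b) \<le> cos (k * d x q)" "cos (k * b) \<le> cos (k * d q y)"
        using b kb k pi_gt_zero nonneg by (auto intro!: cos_monotone_0_pi_le less_imp_le[OF less_trans[OF kb]])
      with 2 have 3: "cos (k * b) \<le> cos h * cos (k * d m q)" by linarith
      \<comment> \<open>The factor \<open>cos h < 1\<close> makes the estimate strict only if
        \<open>cos (k * d m q)\<close> is positive, and \<open>k * b < pi / 2\<close> provides that
        sign.\<close>
      have pos: "cos (k * b) > 0" using kb b0 k by (intro cos_gt_zero_pi) (auto intro: less_le_trans[of _ 0])
      then have "cos (k * d m q) > 0" using 3 S by (metis less_le_trans zero_less_mult_pos)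
      then have "cos h * cos (k * d m q) < 1 * cos (k * d m q)" using S by (intro mult_strict_right_mono)
      then have 4: "cos (k * b) < cos (k * d m q)" using 3 by simp
      show ?thesis
      proof (rule ccontr)
        assume "\<not> d m q < b"
        then have bm: "k * b \<le> k * d m q" using k by simp
        \<comment> \<open>\<open>cos\<close> reverses order only up to pi, so
          \<open>k * d m q\<close> must first be bounded by pi.\<close>
        have "d m q \<le> d x m + d x q" using triangle[of m x q] m(1) M qM commute by simp
        then have "k * d m q \<le> k * (d x m + d x q)" using k by simp
        also have "\<dots> = h + k * d x q" by (simp add: h_def m(2) distrib_left)
        also have "\<dots> < pi" using h \<open>k * d x q < pi / 2\<close> by linarith
        finally have "cos (k * d m q) \<le> cos (k * b)" using bm b0 k by (intro cos_monotone_0_pi_le) auto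
        then show False using 4 by simp
      qed
    next
      case 2
      have "d x y * (d m q)\<^sup>2 \<le> d x y / 2 * (d x q)\<^sup>2 + d x y / 2 * (d q y)\<^sup>2 - d x y / 2 * (d x y / 2) * d x y"
        using C(2)[OF _ 2] m by simp
      also have "\<dots> \<le> d x y / 2 * b\<^sup>2 + d x y / 2 * b\<^sup>2 - d x y / 2 * (d x y / 2) * d x y"
        using b l by (intro add_mono diff_right_mono mult_left_mono power_mono) auto
      also have "\<dots> < d x y * b\<^sup>2" using l by simp
      finally have "(d m q)\<^sup>2 < b\<^sup>2" using l by simp
      then show ?thesis using b0 by (rule power_less_imp_less_base)
    next
      case 3
      define k where "k = sqrt (- \<kappa>)"
      have k: "k > 0" using 3 by (simp add: k_def)
      define h where "h = k * (d x y / 2)"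
      have h: "0 < h" using l k by (auto simp: h_def)
      have S: "sinh h > 0" "cosh h > 1" using h cosh_real_nonneg_less_iff[of 0 h] by auto
      have "k * d x y = 2 * h" by (simp add: h_def)
      then have "2 * sinh h * cosh h * cosh (k * d m q) \<le> sinh h * cosh (k * d x q) + sinh h * cosh (k * d q y)"
        using C(3)[OF _ 3] m by (simp add: k_def[symmetric] h_def[symmetric] sinh_double)
      then have "sinh h * (2 * cosh h * cosh (k * d m q)) \<le> sinh h * (cosh (k * d x q) + cosh (k * d q y))"
        by (simp add: algebra_simps)
      then have 2: "2 * cosh h * cosh (k * d m q) \<le> cosh (k * d x q) + cosh (k * d q y)" using S by simp
      have "cosh (k * d x q) \<le> cosh (k * b)" "cosh (k * d q y) \<le> cosh (k * b)"
        using b k b0 by (subst cosh_real_nonneg_le_iff; simp)+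
      with 2 have "cosh h * cosh (k * d m q) \<le> cosh (k * b)" by linarith
      moreover have "1 * cosh (k * d m q) < cosh h * cosh (k * d m q)"
        using S by (intro mult_strict_right_mono) auto
      ultimately have "cosh (k * d m q) < cosh (k * b)" by linarith
      then show ?thesis using k b0 by (subst (asm) cosh_real_nonneg_less_iff) auto
    qed
    then show ?thesis by (simp add: b_def)
  qed
  then show thesis using that m(1) by blast
qed

text \<open>A weak form of Jung's theorem. Moving a small step towards a point at distance more than
  \<open>3/4 D\<close> contracts the distances to all points of \<open>F\<close> towards a value below \<open>3/4 D\<close>, where the
  distances are measured through \<open>-cos\<close>, the square, or \<open>cosh\<close>, according to the sign of \<open>\<kappa>\<close>.\<close>

lemma jung:
  assumes F: "finite F" "F \<subseteq> M" "F \<noteq> {}" and D: "0 < D" "D \<le> r"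
    and diam: "\<And>p q. p \<in> F \<Longrightarrow> q \<in> F \<Longrightarrow> d p q < D"
  shows "\<exists>c\<in>M. \<forall>q\<in>F. d c q \<le> 3 / 4 * D"
proof -
  \<comment> \<open>Within \<open>M\<close>, \<open>H\<close> is the intersection of the balls of
    radius \<open>D\<close> around \<open>F\<close>. They are convex and contain \<open>F\<close>,
    so moving towards a point of \<open>F\<close> stays in \<open>H\<close>.\<close>
  define H where "H = {x\<in>M. \<forall>q\<in>F. d x q < D}"
  define \<rho> where "\<rho> = 3 / 4 * D"
  have \<rho>: "0 < \<rho>" "\<rho> < D" using D by (auto simp: \<rho>_def)
  obtain x0 where x0: "x0 \<in> F" using F by auto
  then have x0H: "x0 \<in> H" using F diam by (auto simp: H_def)
  have move: "\<exists>y\<in>H. d x y = u \<and> d y p = d x p - u" if "x \<in> H" "p \<in> F" "0 \<le> u" "u \<le> d x p" for x p u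
  proof -
    have M: "x \<in> M" "p \<in> M" using that F by (auto simp: H_def)
    obtain z where z: "z \<in> M" "d x z = u" "d z p = d x p - u"
      using between_exists[OF M \<open>0 \<le> u\<close> \<open>u \<le> d x p\<close>] .
    have "d z q < D" if q: "q \<in> F" for q
    proof -
      have qM: "q \<in> M" using q F by auto
      have "x \<in> mball q D" "p \<in> mball q D"
        using qM M \<open>x \<in> H\<close> \<open>p \<in> F\<close> q diam commute by (auto simp: H_def)
      then have "z \<in> mball q D"
        using metric_convex_between_unique(2)[OF convex_ball[OF qM D], of x p z z] z by simp
      then show ?thesis using commute by auto
    qed
    then show ?thesis using z by (auto simp: H_def)
  qed
  have cmp: "\<And>x p q y. x \<in> H \<Longrightarrow> p \<in> F \<Longrightarrow> q \<in> F \<Longrightarrow> y \<in> H \<Longrightarrow> d x y + d y p = d x p \<Longrightarrow> x \<noteq> p \<Longrightarrow>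
      x0 \<in> M \<and> metric_convex M d (mball x0 r) \<and> x \<in> mball x0 r \<and> q \<in> mball x0 r \<and> p \<in> mball x0 r \<and> y \<in> M
      \<and> (\<kappa> > 0 \<longrightarrow> d x q + d q p + d p x < 2 * pi / sqrt \<kappa>)"
  proof (intro conjI)
    fix x p q y assume *: "x \<in> H" "p \<in> F" "q \<in> F" "y \<in> H"
    show x0M: "x0 \<in> M" using x0 F by auto
    show "metric_convex M d (mball x0 r)" using convex_ball[OF x0M r_pos] by simp
    have "d x x0 < D" using * x0 by (simp add: H_def)
    then show xb: "x \<in> mball x0 r" using * x0M D commute[of x x0] by (simp add: H_def)
    show qb: "q \<in> mball x0 r" and pb: "p \<in> mball x0 r"
      using diam[of x0 q] diam[of x0 p] * x0 F(2) D by auto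
    show "\<kappa> > 0 \<longrightarrow> d x q + d q p + d p x < 2 * pi / sqrt \<kappa>" by (rule perimeter_small[OF xb qb pb])
    show "y \<in> M" using * by (simp add: H_def)
  qed
  note C = curvature_comparison[OF curvature _ r_pos]
  have "\<exists>c\<in>H. \<forall>q\<in>F. d c q \<le> \<rho>"
  proof -
    consider "\<kappa> > 0" | "\<kappa> = 0" | "\<kappa> < 0" by linarith
    then show ?thesis
    proof cases
      case 1
      define k where "k = sqrt \<kappa>"
      have k: "k > 0" using 1 by (simp add: k_def)
      have kD: "k * D < pi / 4" using r_small[OF 1] D k by (metis k_def le_less_trans mult_le_cancel_left_pos)
      have small: "0 \<le> k * d x q" "k * d x q < pi / 4" if "x \<in> H" "q \<in> F" for x q
      proof -
        have "k * d x q < k * D" using that k by (simp add: H_def)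
        then show "k * d x q < pi / 4" using kD by linarith
      qed (use k in simp)
      define \<delta> where "\<delta> = cos (k * D) - (cos (k * \<rho>))\<^sup>2"
      have \<delta>: "\<delta> > 0" using cos_gt_cos_three_quarters[of "k * D"] kD k D by (simp add: \<delta>_def \<rho>_def mult.left_commute)
      have k\<rho>: "0 < k * \<rho>" "k * \<rho> < pi / 4" 
      proof -
        have "k * \<rho> < k * D" using k \<rho> by simp
        then show "k * \<rho> < pi / 4" using kD by linarith
      qed (use k \<rho> in simp)
      have c\<rho>: "0 < cos (k * \<rho>)" using k\<rho> by (intro cos_gt_zero) auto
      define s where "s = min (1 / 4) (\<delta> / 2)"
      have s: "0 < s" "s \<le> 1 / 4" "s < \<delta>" using \<delta> by (auto simp: s_def)
      \<comment> \<open>\<open>1 - s * A\<close> bounds the coefficient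
        \<open>cos v - s * cos l\<close> below from below, and \<open>- cos (k * D) / A\<close> is
        the fixed value of the contraction. It undercuts the target when
        \<open>A * cos (k * \<rho>) < cos (k * D)\<close>, which holds for small
        \<open>s\<close>.\<close>
      define A where "A = s + cos (k * \<rho>)"
      have A: "0 < A" "A \<le> 5 / 4" using s c\<rho> cos_le_one[of "k * \<rho>"] unfolding A_def by linarith+
      have "\<exists>x\<in>H. \<forall>q\<in>F. - cos (k * d x q) \<le> - cos (k * \<rho>)"
      proof (rule contraction_reaches[OF F(1) x0H])
        show "0 < s * A" using s A by simp
        have "s * A \<le> 1 / 4 * (5 / 4)" using s A by (intro mult_mono) auto
        then show "s * A < 1" by simp
        have "cos (k * \<rho>) * A = (cos (k * \<rho>))\<^sup>2 + s * cos (k * \<rho>)" by (simp add: A_def power2_eq_square algebra_simps)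
        also have "\<dots> \<le> (cos (k * \<rho>))\<^sup>2 + s * 1" using s by (intro add_left_mono mult_left_mono) auto
        also have "\<dots> < cos (k * D)" using s by (simp add: \<delta>_def)
        finally show "- cos (k * D) / A < - cos (k * \<rho>)" using A by (simp add: field_simps)
      next
        fix x p assume x: "x \<in> H" "p \<in> F" and far: "- cos (k * \<rho>) < - cos (k * d x p)"
        define l where "l = k * d x p"
        have M: "x \<in> M" "p \<in> M" using x F by (auto simp: H_def)
        have xp: "x \<noteq> p"
        proof
          assume "x = p"
          then have "1 < cos (k * \<rho>)" using far M by simp
          then show False using cos_le_one[of "k * \<rho>"] by linarith
        qed
        have l: "0 < l" "l < pi / 4" using small[OF x] xp M k by (auto simp: l_def)
        have sl: "0 < sin l" using l by (intro sin_gt_zero) auto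
        \<comment> \<open>The step is prescribed by its sine, a fixed fraction of
          \<open>sin l\<close>. Then \<open>sin l\<close> cancels from the comparison, and the
          contraction factor can be chosen independent of \<open>x\<close> and
          \<open>p\<close>.\<close>
        define v where "v = arcsin (s * sin l)"
        have s1: "0 \<le> s * sin l" "s * sin l \<le> sin l" "s * sin l \<le> 1"
        proof -
          show "0 \<le> s * sin l" using s sl by simp
          show "s * sin l \<le> sin l" using s sl mult_right_mono[of s 1 "sin l"] by simp
          then show "s * sin l \<le> 1" using sin_le_one[of l] by linarith
        qed
        have sv: "sin v = s * sin l" using s1 by (simp add: v_def)
        have "arcsin (s * sin l) \<le> arcsin (sin l)" using s1 by (intro arcsin_le_arcsin) auto
        then have v: "0 \<le> v" "v \<le> l" using s1 l arcsin_le_arcsin[of 0 "s * sin l"] by (auto simp: v_def arcsin_sin)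
        obtain y where y: "y \<in> H" "d x y = v / k" "d y p = d x p - v / k"
          using move[OF x, of "v / k"] v k by (auto simp: l_def field_simps)
        have cv: "1 - s\<^sup>2 \<le> cos v"
        proof -
          have "0 \<le> cos v" using v l by (intro cos_ge_zero) auto
          then have "(cos v)\<^sup>2 \<le> cos v" using cos_le_one[of v] by (simp add: power2_eq_square mult_left_le)
          moreover have "(cos v)\<^sup>2 = 1 - s\<^sup>2 * (sin l)\<^sup>2"
            using sin_cos_squared_add[of v] sv by (simp add: power_mult_distrib)
          moreover have "s\<^sup>2 * (sin l)\<^sup>2 \<le> s\<^sup>2 * 1"
            by (intro mult_left_mono) (auto simp: abs_square_le_1)
          ultimately show ?thesis by linarith
        qed
        have "- cos (k * d y q) \<le> (1 - s * A) * - cos (k * d x q) + s * A * (- cos (k * D) / A)" if q: "q \<in> F" for q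
        proof -
          have eq: "d x y + d y p = d x p" using y by simp
          note Z = cmp[OF x q y(1) eq xp]
          have e: "k * d x y = v" "k * d y p = l - v" using y k by (auto simp: l_def right_diff_distrib)
          have "sin (l - v) * cos (k * d x q) + sin v * cos (k * d q p) \<le> sin l * cos (k * d y q)"
            using C(1)[of x0 x q p y] Z eq xp 1 e unfolding k_def[symmetric] l_def[symmetric] by simp
          moreover have "sin (l - v) = sin l * (cos v - s * cos l)"
            by (simp add: sin_diff sv algebra_simps)
          ultimately have "sin l * ((cos v - s * cos l) * cos (k * d x q) + s * cos (k * d q p)) \<le> sin l * cos (k * d y q)"
            by (simp add: sv algebra_simps)
          then have 1: "(cos v - s * cos l) * cos (k * d x q) + s * cos (k * d q p) \<le> cos (k * d y q)"
            using sl by simp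
          have "0 \<le> cos (k * d x q)" using small[OF x(1) q] by (intro cos_ge_zero) auto
          moreover have "1 - s\<^sup>2 - s * cos (k * \<rho>) \<le> cos v - s * cos l"
            using cv far s by (intro diff_mono mult_left_mono) (auto simp: l_def)
          ultimately have "(1 - s\<^sup>2 - s * cos (k * \<rho>)) * cos (k * d x q) \<le> (cos v - s * cos l) * cos (k * d x q)"
            by (intro mult_right_mono)
          moreover have "k * D \<le> pi" using kD pi_gt_zero by linarith
          then have "s * cos (k * D) \<le> s * cos (k * d q p)"
            using s diam[OF q x(2)] k nonneg
            by (intro mult_left_mono cos_monotone_0_pi_le) auto
          ultimately have "(1 - s\<^sup>2 - s * cos (k * \<rho>)) * cos (k * d x q) + s * cos (k * D) \<le> cos (k * d y q)"
            using 1 by linarith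
          moreover have "1 - s\<^sup>2 - s * cos (k * \<rho>) = 1 - s * A" by (simp add: A_def power2_eq_square algebra_simps)
          ultimately show ?thesis using A by simp
        qed
        then show "\<exists>y\<in>H. \<forall>q\<in>F. - cos (k * d y q) \<le> (1 - s * A) * - cos (k * d x q) + s * A * (- cos (k * D) / A)"
          using y(1) by blast
      qed
      then obtain c where c: "c \<in> H" "\<And>q. q \<in> F \<Longrightarrow> cos (k * \<rho>) \<le> cos (k * d c q)" by auto
      have "d c q \<le> \<rho>" if "q \<in> F" for q
        using c(2)[OF that] small[OF c(1) that] k\<rho> k cos_mono_le_eq[of "k * \<rho>" "k * d c q"] by simp
      then show ?thesis using c(1) by blast
    next
      case 2
      have "\<exists>x\<in>H. \<forall>q\<in>F. (d x q)\<^sup>2 \<le> \<rho>\<^sup>2"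
      proof (rule contraction_reaches[OF F(1) x0H])
        \<comment> \<open>Moving the fraction \<open>a\<close> of the way requires
          \<open>D^2 < (2 - a) * \<rho>^2\<close>. As \<open>2 * (3/4)^2 = 9/8\<close>, the value
          \<open>a = 1/10\<close> is small enough.\<close>
        show "(0::real) < 1 / 10" "(1 / 10 :: real) < 1" by auto
        show "D\<^sup>2 - (1 - 1 / 10) * \<rho>\<^sup>2 < \<rho>\<^sup>2" using D by (simp add: \<rho>_def power2_eq_square)
      next
        fix x p assume x: "x \<in> H" "p \<in> F" and far: "\<rho>\<^sup>2 < (d x p)\<^sup>2"
        define l where "l = d x p"
        have M: "x \<in> M" "p \<in> M" using x F by (auto simp: H_def)
        have xp: "x \<noteq> p" using far M by auto
        have l: "0 < l" using xp M by (auto simp: l_def)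
        obtain y where y: "y \<in> H" "d x y = l / 10" "d y p = l - l / 10"
          using move[OF x, of "l / 10"] l by (auto simp: l_def)
        have "(d y q)\<^sup>2 \<le> (1 - 1 / 10) * (d x q)\<^sup>2 + 1 / 10 * (D\<^sup>2 - (1 - 1 / 10) * \<rho>\<^sup>2)" if q: "q \<in> F" for q
        proof -
          have eq: "d x y + d y p = d x p" using y by (simp add: l_def)
          note Z = cmp[OF x q y(1) eq xp]
          have "l * (d y q)\<^sup>2 \<le> d y p * (d x q)\<^sup>2 + d x y * (d q p)\<^sup>2 - d x y * d y p * l"
            using C(2)[of x0 x q p y] Z eq xp 2 unfolding l_def[symmetric] by simp
          also have "\<dots> = l * ((1 - 1 / 10) * (d x q)\<^sup>2 + 1 / 10 * ((d q p)\<^sup>2 - (1 - 1 / 10) * l\<^sup>2))"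
            unfolding y by (simp add: power2_eq_square algebra_simps)
          finally have "(d y q)\<^sup>2 \<le> (1 - 1 / 10) * (d x q)\<^sup>2 + 1 / 10 * ((d q p)\<^sup>2 - (1 - 1 / 10) * l\<^sup>2)"
            using l by simp
          also have "\<dots> \<le> (1 - 1 / 10) * (d x q)\<^sup>2 + 1 / 10 * (D\<^sup>2 - (1 - 1 / 10) * \<rho>\<^sup>2)"
            using power2_less_imp_less[OF far] \<rho> diam[OF q x(2)]
            by (intro add_left_mono mult_left_mono diff_mono power_mono) (auto simp: l_def)
          finally show ?thesis .
        qed
        then show "\<exists>y\<in>H. \<forall>q\<in>F. (d y q)\<^sup>2 \<le> (1 - 1 / 10) * (d x q)\<^sup>2 + 1 / 10 * (D\<^sup>2 - (1 - 1 / 10) * \<rho>\<^sup>2)"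
          using y(1) by blast
      qed
      then show ?thesis using \<rho> by (meson less_imp_le power2_le_imp_le)
    next
      case 3
      define k where "k = sqrt (- \<kappa>)"
      have k: "k > 0" using 3 by (simp add: k_def)
      define T where "T = cosh (k * \<rho>)"
      have T: "T \<ge> 1" by (simp add: T_def cosh_real_ge_1)
      define \<delta> where "\<delta> = T\<^sup>2 - cosh (k * D)"
      have \<delta>: "\<delta> > 0" using cosh_less_cosh_three_quarters[of "k * D"] k D by (simp add: \<delta>_def T_def \<rho>_def mult.left_commute)
      \<comment> \<open>\<open>cosh v\<close> exceeds 1 by at most \<open>s^2 * B\<close>, because
        no geodesic in question is longer than \<open>D\<close>. This lowers \<open>T\<close> to
        \<open>A = T - s * B\<close>, and \<open>s\<close> is chosen such that \<open>T * A\<close>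
        still exceeds \<open>cosh (k * D)\<close>.\<close>
      define B where "B = (sinh (k * D))\<^sup>2 + 1"
      have B: "B \<ge> 1" by (simp add: B_def)
      define s where "s = min (1 / (2 * T)) (\<delta> / (2 * B * T))"
      have s: "0 < s" "s * T < 1" "s * B * T < \<delta>"
      proof -
        show "0 < s" using T B \<delta> by (simp add: s_def)
        have "s * T \<le> 1 / (2 * T) * T" using T by (intro mult_right_mono) (auto simp: s_def)
        then show "s * T < 1" using T by simp
        have "s * (B * T) \<le> \<delta> / (2 * B * T) * (B * T)" using T B by (intro mult_right_mono) (auto simp: s_def)
        also have "\<dots> = \<delta> / 2" using T B by simp
        finally show "s * B * T < \<delta>" using \<delta> by (simp add: mult.assoc)
      qed
      have "s * 1 \<le> s * T" using s T by (intro mult_left_mono) auto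
      then have s1: "s \<le> 1" using s by linarith
      define A where "A = T - s * B"
      have TA: "cosh (k * D) < T * A" using s by (simp add: \<delta>_def A_def power2_eq_square algebra_simps)
      then have A: "0 < A" using T by (smt (verit) cosh_real_ge_1 mult_nonneg_nonpos)
      have "\<exists>x\<in>H. \<forall>q\<in>F. cosh (k * d x q) \<le> T"
      proof (rule contraction_reaches[OF F(1) x0H])
        show "0 < s * A" using s A by simp
        have "s * A \<le> s * T" using s B by (intro mult_left_mono) (auto simp: A_def)
        then show "s * A < 1" using s(2) by linarith
        show "cosh (k * D) / A < T" using A TA by (simp add: field_simps)
      next
        fix x p assume x: "x \<in> H" "p \<in> F" and far: "T < cosh (k * d x p)"
        define l where "l = k * d x p"
        have M: "x \<in> M" "p \<in> M" using x F by (auto simp: H_def)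
        have xp: "x \<noteq> p" using far M T by auto
        have l: "0 < l" "l \<le> k * D" using xp M k x by (auto simp: l_def H_def)
        have sl: "0 < sinh l" using l by simp
        define v where "v = arsinh (s * sinh l)"
        have sv: "sinh v = s * sinh l" by (simp add: v_def)
        have "s * sinh l \<le> 1 * sinh l" using s1 sl by (intro mult_right_mono) auto
        then have "sinh v \<le> sinh l" "sinh 0 \<le> sinh v" using sv s sl by simp_all
        then have v: "0 \<le> v" "v \<le> l" by (simp_all only: sinh_real_le_iff)
        obtain y where y: "y \<in> H" "d x y = v / k" "d y p = d x p - v / k"
          using move[OF x, of "v / k"] v k by (auto simp: l_def field_simps)
        have cv: "cosh v \<le> 1 + s\<^sup>2 * B"
        proof -
          have "cosh v \<le> (cosh v)\<^sup>2" using cosh_real_ge_1[of v] by (simp add: power2_eq_square)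
          also have "\<dots> = 1 + s\<^sup>2 * (sinh l)\<^sup>2" by (simp add: cosh_square_eq sv power_mult_distrib)
          also have "\<dots> \<le> 1 + s\<^sup>2 * (sinh (k * D))\<^sup>2"
            using l sl by (intro add_left_mono mult_left_mono power_mono) auto
          also have "\<dots> \<le> 1 + s\<^sup>2 * B" by (intro add_left_mono mult_left_mono) (auto simp: B_def)
          finally show ?thesis .
        qed
        have "cosh (k * d y q) \<le> (1 - s * A) * cosh (k * d x q) + s * A * (cosh (k * D) / A)" if q: "q \<in> F" for q
        proof -
          have eq: "d x y + d y p = d x p" using y by simp
          note Z = cmp[OF x q y(1) eq xp]
          have e: "k * d x y = v" "k * d y p = l - v" using y k by (auto simp: l_def right_diff_distrib)
          have "sinh l * cosh (k * d y q) \<le> sinh (l - v) * cosh (k * d x q) + sinh v * cosh (k * d q p)"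
            using C(3)[of x0 x q p y] Z eq xp 3 e unfolding k_def[symmetric] l_def[symmetric] by simp
          moreover have "sinh (l - v) = sinh l * (cosh v - s * cosh l)"
            by (simp add: sinh_diff sv algebra_simps)
          ultimately have "sinh l * cosh (k * d y q) \<le> sinh l * ((cosh v - s * cosh l) * cosh (k * d x q) + s * cosh (k * d q p))"
            by (simp add: sv algebra_simps)
          then have 1: "cosh (k * d y q) \<le> (cosh v - s * cosh l) * cosh (k * d x q) + s * cosh (k * d q p)"
            using sl by simp
          have "cosh v - s * cosh l \<le> 1 + s\<^sup>2 * B - s * T"
            using cv far s by (intro diff_mono mult_left_mono) (auto simp: l_def)
          also have "\<dots> = 1 - s * A" by (simp add: A_def power2_eq_square algebra_simps)
          finally have 2: "(cosh v - s * cosh l) * cosh (k * d x q) \<le> (1 - s * A) * cosh (k * d x q)"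
            by (intro mult_right_mono) auto
          have "k * d q p \<le> k * D" using k diam[OF q x(2)] by simp
          then have "cosh (k * d q p) \<le> cosh (k * D)" using k D by (subst cosh_real_nonneg_le_iff) auto
          then have "s * cosh (k * d q p) \<le> s * cosh (k * D)" using s by simp
          with 1 2 have "cosh (k * d y q) \<le> (1 - s * A) * cosh (k * d x q) + s * cosh (k * D)" by linarith
          then show ?thesis using A by simp
        qed
        then show "\<exists>y\<in>H. \<forall>q\<in>F. cosh (k * d y q) \<le> (1 - s * A) * cosh (k * d x q) + s * A * (cosh (k * D) / A)"
          using y(1) by blast
      qed
      then obtain c where c: "c \<in> H" "\<And>q. q \<in> F \<Longrightarrow> cosh (k * d c q) \<le> cosh (k * \<rho>)" by (auto simp: T_def)
      have "d c q \<le> \<rho>" if "q \<in> F" for q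
        using c(2)[OF that] k \<rho> by (subst (asm) cosh_real_nonneg_le_iff) auto
      then show ?thesis using c(1) by blast
    qed
  qed
  then show ?thesis by (auto simp: H_def \<rho>_def)
qed

end

section \<open>Continuity\<close>

text \<open>The preimage of \<open>C\<close> is the projection of a closed part of the graph, and
  projecting along a compact factor is a closed map. Points picked by \<open>SOME\<close> thus
  depend continuously on the data once closed conditions characterize them uniquely.\<close>

lemma continuous_map_closed_graph:
  assumes Y: "compact_space Y" and f: "f \<in> topspace X \<rightarrow> topspace Y"
    and graph: "closedin (prod_topology X Y) {p \<in> topspace X \<times> topspace Y. snd p = f (fst p)}" (is "closedin _ ?G")
  shows "continuous_map X Y f"
  unfolding continuous_map_closedin
proof (intro conjI allI impI ballI)
  fix C assume C: "closedin Y C"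
  have "closedin (prod_topology X Y) (?G \<inter> topspace X \<times> C)"
    using graph C by (intro closedin_Int) (auto simp: closedin_prod_Times_iff)
  then have "closedin X (fst ` (?G \<inter> topspace X \<times> C))"
    using Abstract_Topological_Spaces.closed_map_fst[OF Y, of X] by (simp add: closed_map_def)
  moreover have "fst ` (?G \<inter> topspace X \<times> C) = {x \<in> topspace X. f x \<in> C}"
    using f closedin_subset[OF C] by (force simp: image_iff Pi_iff)
  ultimately show "closedin X {x \<in> topspace X. f x \<in> C}" by simp
qed (use f in auto)

lemma continuous_map_real_Max:
  assumes "finite I" "I \<noteq> {}" and "\<And>i. i \<in> I \<Longrightarrow> continuous_map T euclideanreal (F i)"
  shows "continuous_map T euclideanreal (\<lambda>u. Max ((\<lambda>i. F i u) ` I))"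
  using assms
proof (induction I rule: finite_ne_induct)
  case (insert i I)
  then have "continuous_map T euclideanreal (\<lambda>u. max (F i u) (Max ((\<lambda>i. F i u) ` I)))"
    by (intro continuous_map_real_max) auto
  then show ?case using insert.hyps by (simp add: Max_insert)
qed simp

section \<open>Maps out of and into a geometric realization\<close>

lemma topspace_geom_realization [simp]: "topspace (geom_realization K) = (\<Union>\<sigma>\<in>K. geom_simplex \<sigma>)"
proof (rule subset_antisym)
  show "topspace (geom_realization K) \<subseteq> (\<Union>\<sigma>\<in>K. geom_simplex \<sigma>)"
    using openin_geom_realization openin_topspace by metis
  have "openin (geom_realization K) (\<Union>\<sigma>\<in>K. geom_simplex \<sigma>)"
    unfolding openin_geom_realization
    by (auto simp: Int_absorb1 UN_upper)
  then show "(\<Union>\<sigma>\<in>K. geom_simplex \<sigma>) \<subseteq> topspace (geom_realization K)" by (rule openin_subset)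
qed

lemma continuous_map_from_geom_realization:
  assumes "\<And>\<sigma>. \<sigma> \<in> K \<Longrightarrow> continuous_map (top_of_set (geom_simplex \<sigma>)) Y h"
  shows "continuous_map (geom_realization K) Y h"
  unfolding continuous_map_def
proof (intro conjI allI impI)
  show "h \<in> topspace (geom_realization K) \<rightarrow> topspace Y"
    using assms by (fastforce simp: continuous_map_def)
  fix U assume U: "openin Y U"
  show "openin (geom_realization K) {x \<in> topspace (geom_realization K). h x \<in> U}"
    unfolding openin_geom_realization
  proof (intro conjI ballI)
    fix \<sigma> assume \<sigma>: "\<sigma> \<in> K"
    have "openin (top_of_set (geom_simplex \<sigma>)) {x \<in> geom_simplex \<sigma>. h x \<in> U}"
      using openin_continuous_map_preimage[OF assms[OF \<sigma>] U] by simp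
    moreover have "{x \<in> topspace (geom_realization K). h x \<in> U} \<inter> geom_simplex \<sigma> = {x \<in> geom_simplex \<sigma>. h x \<in> U}"
      using \<sigma> by auto
    ultimately show "openin (top_of_set (geom_simplex \<sigma>)) ({x \<in> topspace (geom_realization K). h x \<in> U} \<inter> geom_simplex \<sigma>)"
      by simp
  qed auto
qed

lemma quotient_map_geom_realization:
  "quotient_map (sum_topology (\<lambda>\<sigma>. top_of_set (geom_simplex \<sigma>)) K) (geom_realization K) snd"
  unfolding quotient_map_def
proof (intro conjI allI impI)
  show "snd ` topspace (sum_topology (\<lambda>\<sigma>. top_of_set (geom_simplex \<sigma>)) K) = topspace (geom_realization K)"
    by (force simp: image_iff)
  fix U assume U: "U \<subseteq> topspace (geom_realization K)"
  have "{x. x \<in> geom_simplex \<sigma> \<and> x \<in> U} = U \<inter> geom_simplex \<sigma>" for \<sigma> by auto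
  then show "openin (sum_topology (\<lambda>\<sigma>. top_of_set (geom_simplex \<sigma>)) K)
      {x \<in> topspace (sum_topology (\<lambda>\<sigma>. top_of_set (geom_simplex \<sigma>)) K). snd x \<in> U} = openin (geom_realization K) U"
    using U unfolding openin_geom_realization openin_sum_topology by (auto simp: o_def)
qed

text \<open>The weak topology is a quotient of the disjoint union of the simplices. The product of a
  quotient map with the locally compact interval is again a quotient map, so a homotopy may be
  checked simplex by simplex.\<close>

lemma continuous_map_prod_geom_realization:
  fixes h :: "real \<times> ('v \<Rightarrow> real) \<Rightarrow> 'b"
  assumes h: "\<And>\<sigma>. \<sigma> \<in> K \<Longrightarrow> continuous_map (top_of_set ({0..1} \<times> geom_simplex \<sigma>)) Y h"
  shows "continuous_map (prod_topology (top_of_set {0..1}) (geom_realization K)) Y h"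
proof -
  let ?Z = "top_of_set {0..1::real}" and ?Q = "sum_topology (\<lambda>\<sigma>. top_of_set (geom_simplex \<sigma>)) K"
  let ?q = "\<lambda>(t, y). (t, snd y) :: real \<times> ('v \<Rightarrow> real)"
  have "quotient_map (prod_topology ?Z ?Q) (prod_topology ?Z (geom_realization K)) ?q"
    by (rule quotient_map_prod_right[OF _ _ quotient_map_geom_realization])
      (auto intro!: compact_imp_locally_compact_space Hausdorff_space_subtopology simp: compact_space_subtopology)
  moreover have "continuous_map (prod_topology ?Z ?Q) Y (h \<circ> ?q)"
    unfolding continuous_map_def
  proof (intro conjI allI impI)
    show "h \<circ> ?q \<in> topspace (prod_topology ?Z ?Q) \<rightarrow> topspace Y"
      using h by (fastforce simp: continuous_map_def)
    fix U assume U: "openin Y U"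
    show "openin (prod_topology ?Z ?Q) {x \<in> topspace (prod_topology ?Z ?Q). (h \<circ> ?q) x \<in> U}"
      unfolding openin_prod_topology_alt
    proof (intro allI impI)
      fix t y assume "(t, y) \<in> {x \<in> topspace (prod_topology ?Z ?Q). (h \<circ> ?q) x \<in> U}"
      then obtain \<sigma> a where y: "y = (\<sigma>, a)" "\<sigma> \<in> K" and ta: "t \<in> {0..1}" "a \<in> geom_simplex \<sigma>" "h (t, a) \<in> U"
        by auto
      have "openin (prod_topology ?Z (top_of_set (geom_simplex \<sigma>))) {p \<in> {0..1} \<times> geom_simplex \<sigma>. h p \<in> U}"
        using openin_continuous_map_preimage[OF h[OF y(2)] U]
        by (simp add: prod_topology_subtopology_eu)
      then obtain V W where VW: "openin ?Z V" "openin (top_of_set (geom_simplex \<sigma>)) W" "t \<in> V" "a \<in> W"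
        "V \<times> W \<subseteq> {p \<in> {0..1} \<times> geom_simplex \<sigma>. h p \<in> U}"
        using ta unfolding openin_prod_topology_alt by (smt (verit) SigmaI mem_Collect_eq)
      have "openin ?Q ({\<sigma>} \<times> W)"
        unfolding openin_sum_topology
      proof (intro conjI ballI)
        show "{\<sigma>} \<times> W \<subseteq> Sigma K (topspace \<circ> (\<lambda>\<sigma>. top_of_set (geom_simplex \<sigma>)))"
          using y(2) openin_subset[OF VW(2)] by auto
        show "openin (top_of_set (geom_simplex \<tau>)) {x. (\<tau>, x) \<in> {\<sigma>} \<times> W}" for \<tau>
          using VW(2) by (cases "\<tau> = \<sigma>") auto
      qed
      then show "\<exists>V W. openin ?Z V \<and> openin ?Q W \<and> t \<in> V \<and> y \<in> W \<and>
          V \<times> W \<subseteq> {x \<in> topspace (prod_topology ?Z ?Q). (h \<circ> ?q) x \<in> U}"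
        using VW y by (intro exI[of _ V] exI[of _ "{\<sigma>} \<times> W"]) auto
    qed
  qed
  ultimately show ?thesis by (rule continuous_compose_quotient_map)
qed

lemma closed_geom_simplex:
  assumes "finite \<sigma>"
  shows "closed (geom_simplex \<sigma> :: ('v \<Rightarrow> real) set)"
proof -
  have c: "continuous_on UNIV (\<lambda>t :: 'v \<Rightarrow> real. t v)" for v by (rule continuous_on_product_coordinates)
  have "geom_simplex \<sigma> = (\<Inter>v. {t. 0 \<le> t v}) \<inter> (\<Inter>v\<in>-\<sigma>. {t. t v = 0}) \<inter> {t. sum t \<sigma> = 1}"
    by (auto simp: geom_simplex_def)
  moreover have "closed {t :: 'v \<Rightarrow> real. 0 \<le> t v}" "closed {t :: 'v \<Rightarrow> real. t v = 0}" for v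
    using c by (auto intro!: closed_Collect_le closed_Collect_eq)
  moreover have "closed {t :: 'v \<Rightarrow> real. sum t \<sigma> = 1}"
    using c by (intro closed_Collect_eq continuous_on_sum continuous_on_const) auto
  ultimately show ?thesis by (auto intro!: closed_Int closed_INT)
qed

text \<open>Coordinatewise continuity alone is too weak for an infinite complex. With all values
  supported in the finite set \<open>V\<close> only finitely many simplices occur, each closed in
  the product topology, and the preimage of a closed set is a finite union of closed sets.\<close>

lemma continuous_map_into_geom_realization:
  fixes h :: "'b \<Rightarrow> 'v \<Rightarrow> real"
  assumes V: "finite V"
    and cell: "\<And>u. u \<in> topspace T \<Longrightarrow> \<exists>\<tau>\<in>K. \<tau> \<subseteq> V \<and> h u \<in> geom_simplex \<tau>"
    and cont: "\<And>v. continuous_map T euclideanreal (\<lambda>u. h u v)"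
  shows "continuous_map T (geom_realization K) h"
  unfolding continuous_map_closedin
proof (intro conjI allI impI ballI)
  show "h \<in> topspace T \<rightarrow> topspace (geom_realization K)" using cell by fastforce
  fix C assume C: "closedin (geom_realization K) C"
  let ?L = "{\<tau>\<in>K. \<tau> \<subseteq> V}"
  have h: "continuous_map T euclidean h"
    using cont by (simp add: euclidean_product_topology[symmetric] continuous_map_componentwise_UNIV)
  have "closedin T {u \<in> topspace T. h u \<in> C \<inter> geom_simplex \<tau>}" if "\<tau> \<in> ?L" for \<tau>
  proof (rule closedin_continuous_map_preimage[OF h])
    have "openin (geom_realization K) (topspace (geom_realization K) - C)" using C by (simp add: closedin_def)
    then have "openin (top_of_set (geom_simplex \<tau>)) ((topspace (geom_realization K) - C) \<inter> geom_simplex \<tau>)"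
      using that by (simp add: openin_geom_realization)
    moreover have "(topspace (geom_realization K) - C) \<inter> geom_simplex \<tau> = geom_simplex \<tau> - C \<inter> geom_simplex \<tau>"
      using that by auto
    ultimately have "closedin (top_of_set (geom_simplex \<tau>)) (C \<inter> geom_simplex \<tau>)"
      by (simp add: closedin_def)
    moreover have "closed (geom_simplex \<tau>)" using that V by (auto intro: closed_geom_simplex finite_subset)
    ultimately show "closedin euclidean (C \<inter> geom_simplex \<tau>)"
      using closedin_closed_trans by auto
  qed
  moreover have "finite ?L" using V by (auto intro: finite_subset[of _ "Pow V"])
  ultimately have "closedin T (\<Union>\<tau>\<in>?L. {u \<in> topspace T. h u \<in> C \<inter> geom_simplex \<tau>})"
    by (intro closedin_Union) auto
  moreover have "(\<Union>\<tau>\<in>?L. {u \<in> topspace T. h u \<in> C \<inter> geom_simplex \<tau>}) = {u \<in> topspace T. h u \<in> C}"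
    using cell by fastforce
  ultimately show "closedin T {u \<in> topspace T. h u \<in> C}" by simp
qed

lemma closedin_le_preimage:
  fixes F G :: "'a \<Rightarrow> real"
  assumes "continuous_map T euclideanreal F" "continuous_map T euclideanreal G"
  shows "closedin T {u \<in> topspace T. F u \<le> G u}"
proof -
  have "closedin T {u \<in> topspace T. F u - G u \<in> {..0}}"
    using assms by (intro closedin_continuous_map_preimage[of T euclideanreal] continuous_map_diff) auto
  then show ?thesis by simp
qed


section \<open>Centers and geodesics depend continuously on their data\<close>

text \<open>For finite \<open>\<sigma>\<close> this is the cone over the simplex without its apex.
  Truncated coordinates stay in it although their sum drops below 1.\<close>

definition weights :: "'v set \<Rightarrow> ('v \<Rightarrow> real) set" where
  "weights \<sigma> = {t. (\<forall>v. 0 \<le> t v) \<and> (\<forall>v. v \<notin> \<sigma> \<longrightarrow> t v = 0) \<and> (\<exists>v. 0 < t v)}"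

locale compact_cat_space = cat_space M d \<kappa> r for M :: "'a set" and d \<kappa> r +
  assumes compact: "compact_space mtopology"
begin

definition geodesic_point :: "'a \<Rightarrow> 'a \<Rightarrow> real \<Rightarrow> 'a" where
  "geodesic_point x y s = (SOME z. z \<in> M \<and> d x z = s * d x y \<and> d z y = (1 - s) * d x y)"

lemma geodesic_point:
  assumes "x \<in> M" "y \<in> M" "s \<in> {0..1}"
  shows "geodesic_point x y s \<in> M" "d x (geodesic_point x y s) = s * d x y"
    "d (geodesic_point x y s) y = (1 - s) * d x y"
proof -
  have "0 \<le> s * d x y" "s * d x y \<le> d x y" using assms by (auto simp: mult_left_le_one_le)
  then obtain z where "z \<in> M" "d x z = s * d x y" "d z y = d x y - s * d x y"
    using between_exists[OF assms(1,2)] by blast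
  then have "\<exists>z. z \<in> M \<and> d x z = s * d x y \<and> d z y = (1 - s) * d x y" by (auto simp: algebra_simps)
  from someI_ex[OF this]
  show "geodesic_point x y s \<in> M" "d x (geodesic_point x y s) = s * d x y"
    "d (geodesic_point x y s) y = (1 - s) * d x y"
    by (simp_all add: geodesic_point_def)
qed

lemma geodesic_point_unique:
  assumes "x \<in> M" "y \<in> M" "s \<in> {0..1}" "d x y < r"
    and z: "z \<in> M" "d x z = s * d x y" "d z y = (1 - s) * d x y"
  shows "z = geodesic_point x y s"
proof -
  note g = geodesic_point[OF assms(1-3)]
  have "x \<in> mball x r" "y \<in> mball x r" using assms r_pos by auto
  then show ?thesis
    using metric_convex_between_unique(1)[OF convex_ball[OF assms(1) r_pos order_refl], of x y z "geodesic_point x y s"]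
      z g r_pos by (simp add: algebra_simps)
qed

text \<open>The two distance equations are closed conditions and determine the point when the ends
  are less than \<open>r\<close> apart, so the graph is closed.\<close>

lemma continuous_map_geodesic_point:
  assumes f: "continuous_map T mtopology f" and g: "continuous_map T mtopology g"
    and s: "continuous_map T euclideanreal s" and s01: "\<And>u. u \<in> topspace T \<Longrightarrow> s u \<in> {0..1}"
    and near: "\<And>u. u \<in> topspace T \<Longrightarrow> d (f u) (g u) < r"
  shows "continuous_map T mtopology (\<lambda>u. geodesic_point (f u) (g u) (s u))" (is "continuous_map _ _ ?h")
proof (rule continuous_map_closed_graph[OF compact])
  have fM: "f u \<in> M" and gM: "g u \<in> M" if "u \<in> topspace T" for u
    using continuous_map_image_subset_topspace[OF f] continuous_map_image_subset_topspace[OF g] that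
    by (auto simp: image_subset_iff)
  show "?h \<in> topspace T \<rightarrow> topspace mtopology"
    using geodesic_point(1) fM gM s01 by auto
  let ?P = "prod_topology T mtopology"
  have c: "continuous_map ?P mtopology (\<lambda>p. f (fst p))" "continuous_map ?P mtopology (\<lambda>p. g (fst p))"
    "continuous_map ?P euclideanreal (\<lambda>p. s (fst p))" "continuous_map ?P mtopology snd"
    using continuous_map_compose[OF continuous_map_fst f, of mtopology]
      continuous_map_compose[OF continuous_map_fst g, of mtopology]
      continuous_map_compose[OF continuous_map_fst s, of mtopology] continuous_map_snd
    by (auto simp: o_def)
  have c1: "continuous_map ?P euclideanreal (\<lambda>p. d (f (fst p)) (snd p) - s (fst p) * d (f (fst p)) (g (fst p)))"
    and c2: "continuous_map ?P euclideanreal (\<lambda>p. d (snd p) (g (fst p)) - (1 - s (fst p)) * d (f (fst p)) (g (fst p)))"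
    using c by (auto intro!: continuous_map_diff continuous_map_real_mult continuous_map_dist)
  have "closedin ?P ({p \<in> topspace ?P. d (f (fst p)) (snd p) - s (fst p) * d (f (fst p)) (g (fst p)) \<in> {0}} \<inter>
      {p \<in> topspace ?P. d (snd p) (g (fst p)) - (1 - s (fst p)) * d (f (fst p)) (g (fst p)) \<in> {0}})"
    using closedin_continuous_map_preimage[OF c1, of "{0}"] closedin_continuous_map_preimage[OF c2, of "{0}"]
    by (intro closedin_Int) auto
  moreover have "\<dots> = {p \<in> topspace T \<times> topspace mtopology. snd p = ?h (fst p)}"
    using geodesic_point geodesic_point_unique near s01 fM gM by auto
  ultimately show "closedin ?P {p \<in> topspace T \<times> topspace mtopology. snd p = ?h (fst p)}" by simp
qed

text \<open>The minimizer of the weighted maximal distance ignores vertices of weight \<open>0\<close> and is invariant under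
  scaling of the weights. So it is compatible with faces and needs no normalization.\<close>

definition cost :: "('v \<Rightarrow> 'a) \<Rightarrow> ('v \<Rightarrow> real) \<Rightarrow> 'a \<Rightarrow> real" where
  "cost f t x = (SUP v. t v * d x (f v))"

definition center :: "('v \<Rightarrow> 'a) \<Rightarrow> ('v \<Rightarrow> real) \<Rightarrow> 'a" where
  "center f t = (SOME x. x \<in> M \<and> (\<forall>y\<in>M. cost f t x \<le> cost f t y))"

text \<open>Vertices outside \<open>\<sigma>\<close> contribute 0, which never exceeds the other
  terms as distances are nonnegative. So the cost does not depend on which simplex carries
  \<open>t\<close>.\<close>

lemma cost_eq_Max:
  assumes \<sigma>: "finite \<sigma>" and t: "t \<in> weights \<sigma>"
  shows "cost f t x = Max ((\<lambda>v. t v * d x (f v)) ` \<sigma>)"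
  unfolding cost_def
proof (rule cSup_eq_maximum)
  have ne: "\<sigma> \<noteq> {}" using t by (force simp: weights_def)
  have "Max ((\<lambda>v. t v * d x (f v)) ` \<sigma>) \<in> (\<lambda>v. t v * d x (f v)) ` \<sigma>"
    using \<sigma> ne by (intro Max_in) auto
  then show M: "Max ((\<lambda>v. t v * d x (f v)) ` \<sigma>) \<in> range (\<lambda>v. t v * d x (f v))" by auto
  fix z assume "z \<in> range (\<lambda>v. t v * d x (f v))"
  then obtain v where z: "z = t v * d x (f v)" by auto
  show "z \<le> Max ((\<lambda>v. t v * d x (f v)) ` \<sigma>)"
  proof (cases "v \<in> \<sigma>")
    case True then show ?thesis using \<sigma> z by auto
  next
    case False
    then have "z = 0" using t z by (auto simp: weights_def)
    moreover have "0 \<le> Max ((\<lambda>v. t v * d x (f v)) ` \<sigma>)"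
      using M t by (auto simp: weights_def)
    ultimately show ?thesis by simp
  qed
qed

lemma continuous_map_cost:
  assumes \<sigma>: "finite \<sigma>" "f ` \<sigma> \<subseteq> M" and t: "\<And>u. u \<in> topspace T \<Longrightarrow> t u \<in> weights \<sigma>"
    and tc: "\<And>v. continuous_map T euclideanreal (\<lambda>u. t u v)" and x: "continuous_map T mtopology x"
  shows "continuous_map T euclideanreal (\<lambda>u. cost f (t u) (x u))"
proof (cases "topspace T = {}")
  case False
  then obtain u where "t u \<in> weights \<sigma>" using t by blast
  then have "\<sigma> \<noteq> {}" by (force simp: weights_def)
  then have "continuous_map T euclideanreal (\<lambda>u. Max ((\<lambda>v. t u v * d (x u) (f v)) ` \<sigma>))"
    using assms by (intro continuous_map_real_Max continuous_map_real_mult continuous_map_dist) auto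
  then show ?thesis by (rule continuous_map_eq) (use t \<sigma> in \<open>simp add: cost_eq_Max\<close>)
qed simp

context
  fixes f :: "'v \<Rightarrow> 'a" and \<sigma> :: "'v set" and D :: real
  assumes \<sigma>: "finite \<sigma>" "f ` \<sigma> \<subseteq> M" and D: "0 < D" "D \<le> r"
    and diam: "\<And>v w. v \<in> \<sigma> \<Longrightarrow> w \<in> \<sigma> \<Longrightarrow> d (f v) (f w) < D"
begin

text \<open>The point supplied by Jung's theorem is a competitor: its cost is at most
  \<open>t v * (3 / 4 * D)\<close>, because \<open>t v\<close> is the largest weight, while the
  minimizer already pays \<open>t v * d x (f v)\<close>.\<close>

lemma minimizer_near:
  assumes t: "t \<in> weights \<sigma>" and x: "\<And>y. y \<in> M \<Longrightarrow> cost f t x \<le> cost f t y"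
    and v: "\<And>w. t w \<le> t v"
  shows "d x (f v) \<le> 3 / 4 * D"
proof -
  obtain w where "0 < t w" using t by (auto simp: weights_def)
  then have tv: "0 < t v" using v[of w] by linarith
  then have v\<sigma>: "v \<in> \<sigma>" using t by (force simp: weights_def)
  then have ne: "\<sigma> \<noteq> {}" by auto
  obtain c where c: "c \<in> M" "\<And>w. w \<in> \<sigma> \<Longrightarrow> d c (f w) \<le> 3 / 4 * D"
  proof -
    have "\<exists>c\<in>M. \<forall>q\<in>f ` \<sigma>. d c q \<le> 3 / 4 * D" by (rule jung) (use \<sigma> D diam ne in auto)
    then show thesis using that by blast
  qed
  have "t v * d x (f v) \<le> cost f t x" unfolding cost_eq_Max[OF \<sigma>(1) t] using \<sigma> v\<sigma> by auto
  also have "\<dots> \<le> cost f t c" by (rule x[OF c(1)])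
  also have "\<dots> \<le> t v * (3 / 4 * D)"
    unfolding cost_eq_Max[OF \<sigma>(1) t]
  proof (rule Max.boundedI)
    fix a assume "a \<in> (\<lambda>v. t v * d c (f v)) ` \<sigma>"
    then obtain w where w: "w \<in> \<sigma>" "a = t w * d c (f w)" by auto
    then show "a \<le> t v * (3 / 4 * D)" using c(2)[OF w(1)] v[of w] tv nonneg by (simp only:) (intro mult_mono, auto)
  qed (use \<sigma> ne in auto)
  finally show ?thesis using tv by simp
qed

text \<open>Both minimizers and all \<open>f w\<close> lie in the ball around \<open>f v\<close> for
  a vertex \<open>v\<close> of maximal weight. The midpoint of two different minimizers is there
  strictly closer to each \<open>f w\<close> than the farther of the two, hence cheaper.\<close>

lemma minimizer_unique:
  assumes t: "t \<in> weights \<sigma>" and x: "x \<in> M" "\<And>z. z \<in> M \<Longrightarrow> cost f t x \<le> cost f t z"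
    and y: "y \<in> M" "\<And>z. z \<in> M \<Longrightarrow> cost f t y \<le> cost f t z"
  shows "x = y"
proof (rule ccontr)
  assume "x \<noteq> y"
  have ne: "\<sigma> \<noteq> {}" using t by (force simp: weights_def)
  have "Max (t ` \<sigma>) \<in> t ` \<sigma>" using \<sigma> ne by (intro Max_in) auto
  then obtain v where v: "v \<in> \<sigma>" "t v = Max (t ` \<sigma>)" by auto
  have tv: "t w \<le> t v" for w
  proof (cases "w \<in> \<sigma>")
    case True then show ?thesis using v \<sigma> by auto
  next
    case False then show ?thesis using t by (auto simp: weights_def)
  qed
  obtain w where "0 < t w" using t by (auto simp: weights_def)
  then have tv0: "0 < t v" using tv[of w] by linarith
  have near: "d x (f v) \<le> 3 / 4 * D" "d y (f v) \<le> 3 / 4 * D"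
    using minimizer_near[OF t x(2) tv] minimizer_near[OF t y(2) tv] by auto
  have fM: "f w \<in> M" if "w \<in> \<sigma>" for w using \<sigma> that by auto
  have xy: "x \<in> mball (f v) r" "y \<in> mball (f v) r"
    using near x y D fM[OF v(1)] commute by auto
  obtain m where m: "m \<in> M" "\<And>q. q \<in> mball (f v) r \<Longrightarrow> d m q < max (d x q) (d y q)"
    using midpoint_closer[OF fM[OF v(1)] xy \<open>x \<noteq> y\<close>] by blast
  have mw: "d m (f w) < max (d x (f w)) (d y (f w))" if "w \<in> \<sigma>" for w
    using m(2)[of "f w"] diam[OF v(1) that] D fM v that by auto
  define c where "c = cost f t x"
  have cy: "cost f t y = c" using x y by (auto simp: c_def intro: antisym)
  have le: "t w * max (d x (f w)) (d y (f w)) \<le> c" if "w \<in> \<sigma>" for w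
  proof -
    have "t w * d z (f w) \<le> cost f t z" for z
      using \<sigma> that by (auto simp: cost_eq_Max[OF \<sigma>(1) t])
    from this[of x] this[of y] have "t w * d x (f w) \<le> c" "t w * d y (f w) \<le> c"
      by (auto simp: cy) (simp add: c_def)
    then show ?thesis by (auto simp: max_def)
  qed
  have "t v * d m (f v) < c"
    using mult_strict_left_mono[OF mw[OF v(1)] tv0] le[OF v(1)] by linarith
  \<comment> \<open>At a vertex of weight 0 coming closer gains nothing; strictness there rests on a
    positive minimal cost.\<close>
  then have c0: "0 < c" using mult_nonneg_nonneg[of "t v" "d m (f v)"] tv0 nonneg by (smt (verit))
  have "t w * d m (f w) < c" if "w \<in> \<sigma>" for w
  proof (cases "t w > 0")
    case True
    then show ?thesis using mult_strict_left_mono[OF mw[OF that] True] le[OF that] by linarith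
  next
    case False
    then have "t w = 0" using t by (auto simp: weights_def intro: antisym)
    then show ?thesis using c0 by simp
  qed
  then have "cost f t m < c"
    unfolding cost_eq_Max[OF \<sigma>(1) t] using \<sigma> ne by (subst Max_less_iff) auto
  then show False using x(2)[OF m(1)] by (simp add: c_def)
qed

lemma minimizer_exists:
  assumes t: "t \<in> weights \<sigma>"
  shows "\<exists>x\<in>M. \<forall>y\<in>M. cost f t x \<le> cost f t y"
proof -
  have ne: "M \<noteq> {}" using t \<sigma> by (force simp: weights_def)
  have "continuous_map mtopology euclideanreal (\<lambda>x. cost f t x)"
    using t \<sigma> by (intro continuous_map_cost[where T = mtopology and x = "\<lambda>x. x"]) auto
  then have "compactin euclideanreal (cost f t ` M)"
    using image_compactin[of mtopology M euclideanreal "cost f t"] compact by (simp add: compact_space_def)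
  then have "compact (cost f t ` M)" by simp
  from compact_attains_inf[OF this] ne show ?thesis by auto
qed

lemma center:
  assumes "t \<in> weights \<sigma>"
  shows "center f t \<in> M" "\<And>y. y \<in> M \<Longrightarrow> cost f t (center f t) \<le> cost f t y"
  using someI_ex[of "\<lambda>x. x \<in> M \<and> (\<forall>y\<in>M. cost f t x \<le> cost f t y)"] minimizer_exists[OF assms]
  unfolding center_def by auto

lemma center_near:
  assumes "t \<in> weights \<sigma>" "\<And>w. t w \<le> t v"
  shows "d (center f t) (f v) \<le> 3 / 4 * D"
  using minimizer_near center assms by blast

text \<open>Being a minimizer is an intersection of closed conditions, one for each competitor,
  since the cost is continuous in weights and point jointly. Uniqueness makes that intersection the
  graph of \<open>center f\<close>.\<close>

lemma continuous_map_center: "continuous_map (top_of_set (weights \<sigma>)) mtopology (center f)"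
proof (rule continuous_map_closed_graph[OF compact])
  let ?T = "top_of_set (weights \<sigma>)"
  let ?P = "prod_topology ?T mtopology"
  show "center f \<in> topspace ?T \<rightarrow> topspace mtopology" using center(1) by auto
  have t: "fst p \<in> weights \<sigma>" if "p \<in> topspace ?P" for p using that by auto
  have tc: "continuous_map ?P euclideanreal (\<lambda>p. fst p v)" for v
  proof -
    have "continuous_map ?T euclideanreal (\<lambda>t. t v)"
      using continuous_on_subset[OF continuous_on_product_coordinates subset_UNIV] by simp
    from continuous_map_compose[OF continuous_map_fst this] show ?thesis by (simp add: o_def)
  qed
  have G: "closedin ?P {p \<in> topspace ?P. cost f (fst p) (snd p) \<le> cost f (fst p) y}" if "y \<in> M" for y
    using that \<sigma> t tc
    by (intro closedin_le_preimage continuous_map_cost[where \<sigma> = \<sigma>] continuous_map_snd) auto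
  show "closedin ?P {p \<in> topspace ?T \<times> topspace mtopology. snd p = center f (fst p)}"
  \<comment> \<open>With no competitors the intersection would be the whole universe instead of the
    empty graph.\<close>
  proof (cases "M = {}")
    case False
    have "{p \<in> topspace ?T \<times> topspace mtopology. snd p = center f (fst p)}
        = (\<Inter>y\<in>M. {p \<in> topspace ?P. cost f (fst p) (snd p) \<le> cost f (fst p) y})"
    proof (intro equalityI subsetI)
      fix p assume "p \<in> {p \<in> topspace ?T \<times> topspace mtopology. snd p = center f (fst p)}"
      then show "p \<in> (\<Inter>y\<in>M. {p \<in> topspace ?P. cost f (fst p) (snd p) \<le> cost f (fst p) y})"
        using center by auto
    next
      fix p assume p: "p \<in> (\<Inter>y\<in>M. {p \<in> topspace ?P. cost f (fst p) (snd p) \<le> cost f (fst p) y})"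
      then have top: "fst p \<in> weights \<sigma>" "snd p \<in> M" using False by auto
      have "snd p = center f (fst p)"
        by (rule minimizer_unique[OF top(1)]) (use p top center[OF top(1)] in auto)
      then show "p \<in> {p \<in> topspace ?T \<times> topspace mtopology. snd p = center f (fst p)}"
        using top by (auto simp: mem_Times_iff)
    qed
    then show ?thesis using G False by (auto intro!: closedin_Inter)
  next
    case True
    then have "topspace mtopology = {}" by (metis topspace_mtopology)
    then have "{p \<in> topspace ?T \<times> topspace mtopology. snd p = center f (fst p)} = {}" by blast
    then show ?thesis by (simp only: closedin_empty)
  qed
qed

end

end

section \<open>Comparison of the path metric with the length metric\<close>

text \<open>Curves of speed at most 1 replace curves of given length: they concatenate directly, and
  the length of the parameter interval bounds their length.\<close>

definition lipschitz_joined :: "'a::metric_space set \<Rightarrow> 'a \<Rightarrow> 'a \<Rightarrow> real \<Rightarrow> bool" where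
  "lipschitz_joined M x y L \<longleftrightarrow> 0 \<le> L \<and> (\<exists>g. g 0 = x \<and> g L = y \<and> (\<forall>t\<in>{0..L}. g t \<in> M) \<and>
     (\<forall>s t. 0 \<le> s \<longrightarrow> s \<le> t \<longrightarrow> t \<le> L \<longrightarrow> dist (g s) (g t) \<le> t - s))"

lemma lipschitz_joined_induced_length:
  assumes "lipschitz_joined M x y L"
  shows "induced_length M dist x y \<le> ennreal L"
proof -
  interpret Metric_space M dist by (simp add: Met_TC.subspace)
  show ?thesis
    using assms induced_length_le_lipschitz[of L] by (auto simp: lipschitz_joined_def)
qed

lemma lipschitz_joined_trans:
  assumes "lipschitz_joined M x y L" "lipschitz_joined M y z L'"
  shows "lipschitz_joined M x z (L + L')"
proof -
  obtain g where g: "0 \<le> L" "g 0 = x" "g L = y" "\<And>t. t \<in> {0..L} \<Longrightarrow> g t \<in> M"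
    "\<And>s t. 0 \<le> s \<Longrightarrow> s \<le> t \<Longrightarrow> t \<le> L \<Longrightarrow> dist (g s) (g t) \<le> t - s"
    using assms(1) by (auto simp: lipschitz_joined_def)
  obtain h where h: "0 \<le> L'" "h 0 = y" "h L' = z" "\<And>t. t \<in> {0..L'} \<Longrightarrow> h t \<in> M"
    "\<And>s t. 0 \<le> s \<Longrightarrow> s \<le> t \<Longrightarrow> t \<le> L' \<Longrightarrow> dist (h s) (h t) \<le> t - s"
    using assms(2) by (auto simp: lipschitz_joined_def)
  define j where "j t = (if t \<le> L then g t else h (t - L))" for t
  have "j 0 = x" "j (L + L') = z" using g h by (auto simp: j_def)
  moreover have "j t \<in> M" if "t \<in> {0..L + L'}" for t using g(4)[of t] h(4)[of "t - L"] that by (auto simp: j_def)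
  moreover have "dist (j s) (j t) \<le> t - s" if st: "0 \<le> s" "s \<le> t" "t \<le> L + L'" for s t
  proof -
    consider "t \<le> L" | "L < s" | "s \<le> L" "L < t" by linarith
    then show ?thesis
    proof cases
      case 1 then show ?thesis using g(5)[of s t] st by (auto simp: j_def)
    next
      case 2 then show ?thesis using h(5)[of "s - L" "t - L"] st by (auto simp: j_def)
    next
      case 3
      have "dist (g s) y \<le> L - s" "dist y (h (t - L)) \<le> t - L"
        using g(3) g(5)[of s L] h(2) h(5)[of 0 "t - L"] 3 st by auto
      then show ?thesis using dist_triangle[of "g s" "h (t - L)" y] 3 by (auto simp: j_def)
    qed
  qed
  ultimately show ?thesis using g(1) h(1) unfolding lipschitz_joined_def
    by (intro conjI exI[of _ j]) auto
qed

lemma lipschitz_joined_segment: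
  fixes x y :: "'a::real_normed_vector"
  assumes "closed_segment x y \<subseteq> M"
  shows "lipschitz_joined M x y (dist x y)"
  unfolding lipschitz_joined_def
proof (intro conjI exI[of _ "\<lambda>t. linepath x y (t / dist x y)"] ballI allI impI)
  fix s t assume st: "0 \<le> s" "s \<le> t" "t \<le> dist x y"
  have "linepath x y a - linepath x y b = (b - a) *\<^sub>R (x - y)" for a b
    by (simp add: linepath_def algebra_simps)
  then have "dist (linepath x y a) (linepath x y b) = \<bar>b - a\<bar> * dist x y" for a b
    by (simp add: dist_norm)
  moreover have "t / dist x y - s / dist x y = (t - s) / dist x y" by (simp add: diff_divide_distrib)
  ultimately show "dist (linepath x y (s / dist x y)) (linepath x y (t / dist x y)) \<le> t - s"
    using st by (cases "x = y") auto
next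
  fix t assume "t \<in> {0..dist x y}"
  then have "t / dist x y \<in> {0..1}" by (cases "x = y") (auto simp: divide_simps)
  then show "linepath x y (t / dist x y) \<in> M"
    using assms linepath_in_path by blast
qed (auto simp: linepath_def)

text \<open>Each point of the segment is within \<open>\<epsilon> / 2\<close> of one end, and that
  end is within \<open>\<epsilon> / 2\<close> of \<open>X\<close>.\<close>

lemma closed_segment_subset_thickening:
  assumes "p \<in> X" "q \<in> X" "dist a p < \<epsilon> / 2" "dist b q < \<epsilon> / 2" "dist a b < \<epsilon>"
  shows "closed_segment a b \<subseteq> thickening \<epsilon> X"
proof
  fix z assume "z \<in> closed_segment a b"
  then have "dist a b = dist a z + dist z b"
    using between[of a b z] by (simp add: between_mem_segment)
  then have "dist a z \<le> \<epsilon> / 2 \<or> dist b z \<le> \<epsilon> / 2" using assms(5) by (auto simp: dist_commute)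
  then have "dist z p < \<epsilon> \<or> dist z q < \<epsilon>"
    using dist_triangle[of z p a] dist_triangle[of z q b] assms(3,4) by (auto simp: dist_commute)
  then show "z \<in> thickening \<epsilon> X" using assms(1,2) by (auto simp: thickening_def dist_norm)
qed

section \<open>Distances in \<open>X\<close> against the path metric of \<open>S\<close>\<close>

locale close_sample =
  fixes X S :: "(real^'n) set" and \<xi> \<beta> \<epsilon> \<eta> :: real
  assumes geo: "geodesic_subspace X"
    and \<xi>: "0 < \<xi>" "\<xi> \<le> 1 / 14"
    and \<beta>: "0 < \<beta>" and \<epsilon>: "0 < \<epsilon>" "\<epsilon> \<le> \<beta>"
    and distortion: "large_scale_distortion \<epsilon> (2 * \<xi> * \<beta>) X \<le> ennreal (1 + \<xi> / (1 + \<xi>))"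
    and \<eta>: "0 < \<eta>" "2 * \<eta> \<le> \<xi> * \<epsilon>"
    and S_near: "S \<subseteq> thickening \<eta> X" and X_near: "X \<subseteq> thickening \<eta> S"
begin

abbreviation "d \<equiv> len_dist X"

lemma complete_length_space: "complete_length_space X d"
  using geo by (simp add: geodesic_subspace_def)

sublocale geodesic_space X d
  by (rule geodesic_space_complete_length_space[OF complete_length_space])

lemma ennreal_d: "x \<in> X \<Longrightarrow> y \<in> X \<Longrightarrow> ennreal (d x y) = induced_length X dist x y"
  using geo by (simp add: geodesic_subspace_def len_dist_def)

lemma dist_le_d: "x \<in> X \<Longrightarrow> y \<in> X \<Longrightarrow> dist x y \<le> d x y"
  using ennreal_d[of x y] induced_length_ge_dist[of dist x y X] by (metis ennreal_le_iff nonneg)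

lemma \<eta>_small: "\<eta> < \<epsilon> / 2"
proof -
  have "\<xi> * \<epsilon> \<le> 1 / 14 * \<epsilon>" using \<xi> \<epsilon> by (intro mult_right_mono) auto
  then show ?thesis using \<eta> \<epsilon> by linarith
qed

text \<open>An \<open>ennreal\<close> quotient can be read as a real one only for a finite positive
  denominator. The joining curve gives finiteness; positivity follows from
  \<open>x \<noteq> y\<close>, which \<open>far\<close> forces.\<close>

lemma d_le_of_thickening:
  assumes xy: "x \<in> X" "y \<in> X" and far: "2 * \<xi> * \<beta> \<le> d x y"
    and joined: "lipschitz_joined (thickening \<epsilon> X) x y L"
  shows "d x y \<le> (1 + \<xi> / (1 + \<xi>)) * L"
proof -
  let ?I = "induced_length (thickening \<epsilon> X) dist x y" and ?c = "1 + \<xi> / (1 + \<xi>)"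
  have c: "0 < ?c" using \<xi> by (simp add: add_pos_pos)
  have L: "0 \<le> L" using joined by (simp add: lipschitz_joined_def)
  have IL: "?I \<le> ennreal L" by (rule lipschitz_joined_induced_length[OF joined])
  then obtain b where b: "?I = ennreal b" "0 \<le> b" by (cases ?I) (auto simp: top_unique)
  have bL: "b \<le> L" using IL b L by simp
  let ?P = "{(x, y). x \<in> X \<and> y \<in> X \<and> ennreal (2 * \<xi> * \<beta>) \<le> induced_length X dist x y}"
  have mem: "(x, y) \<in> ?P" using xy far ennreal_d[OF xy] by (auto simp: ennreal_leI simp flip: ennreal_d)
  have "0 < 2 * \<xi> * \<beta>" using \<xi> \<beta> by simp
  then have "x \<noteq> y" using far xy by auto
  then have "0 < dist x y" by simp
  moreover have "ennreal (dist x y) \<le> ennreal b" using induced_length_ge_dist[of dist x y] b by metis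
  ultimately have b0: "0 < b" using b by (metis ennreal_le_iff less_le_trans)
  have "induced_length X dist x y / ?I \<le> large_scale_distortion \<epsilon> (2 * \<xi> * \<beta>) X"
    unfolding large_scale_distortion_def Let_def using mem
    by (auto intro!: SUP_upper2[of "(x, y)"])
  also have "\<dots> \<le> ennreal ?c" by (rule distortion)
  finally have "ennreal (d x y / b) \<le> ennreal ?c"
    using b0 b nonneg by (simp add: ennreal_d[OF xy, symmetric] divide_ennreal)
  then have "d x y / b \<le> ?c" using c by (metis ennreal_le_iff less_imp_le)
  then have "d x y \<le> ?c * b" using b0 by (simp add: pos_divide_le_eq)
  also have "\<dots> \<le> ?c * L" using bL c by (intro mult_left_mono) auto
  finally show ?thesis .
qed

lemma distortion_factor: "(1 + \<xi> / (1 + \<xi>)) * (1 + \<xi>) = 1 + 2 * \<xi>"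
  using \<xi> by (simp add: field_simps)

text \<open>The polygon of an \<open>\<epsilon>\<close>-path, prolonged to \<open>p\<close> and
  \<open>q\<close>, runs in the thickening and is shorter than \<open>(1 + \<xi>) * \<beta>\<close>.
  The distortion bound equals \<open>(1 + 2 * \<xi>) / (1 + \<xi>)\<close>, exactly the factor
  leading to \<open>D\<close>. Pairs too close for it satisfy the claim anyway.\<close>

lemma d_less_of_path_metric:
  assumes ab: "a \<in> S" "b \<in> S" and p: "p \<in> X" "dist a p < \<eta>" and q: "q \<in> X" "dist b q < \<eta>"
    and pm: "path_metric \<epsilon> S a b < ennreal \<beta>"
  shows "d p q < (1 + 2 * \<xi>) * \<beta>"
proof (cases "2 * \<xi> * \<beta> \<le> d p q")
  case False
  then show ?thesis using \<beta> by (simp add: algebra_simps)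
next
  case True
  obtain k y where y: "eps_path \<epsilon> S a b k y" "ennreal (\<Sum>i\<le>k. norm (y i - y (Suc i))) < ennreal \<beta>"
    using pm unfolding path_metric_def INF_less_iff by auto
  have yS: "y i \<in> S" if "i \<le> Suc k" for i using y that by (auto simp: eps_path_def)
  have near: "\<exists>x\<in>X. dist (y i) x < \<epsilon> / 2" if "i \<le> Suc k" for i
    using yS[OF that] S_near \<eta>_small by (force simp: thickening_def dist_norm)
  let ?T = "thickening \<epsilon> X"
  have "lipschitz_joined ?T (y 0) (y n) (\<Sum>i<n. norm (y i - y (Suc i)))" if "n \<le> Suc k" for n
    using that
  proof (induction n)
    case 0
    obtain x where x: "x \<in> X" "dist (y 0) x < \<epsilon> / 2" using near[of 0] by auto
    have "closed_segment (y 0) (y 0) \<subseteq> ?T"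
      by (rule closed_segment_subset_thickening[OF x(1) x(1) x(2) x(2)]) (use \<epsilon> in simp)
    from lipschitz_joined_segment[OF this] show ?case by simp
  next
    case (Suc n)
    obtain x x' where x: "x \<in> X" "dist (y n) x < \<epsilon> / 2" "x' \<in> X" "dist (y (Suc n)) x' < \<epsilon> / 2"
      using near[of n] near[of "Suc n"] Suc.prems by auto
    have "dist (y n) (y (Suc n)) < \<epsilon>" using y(1) Suc.prems by (auto simp: eps_path_def dist_norm)
    then have "closed_segment (y n) (y (Suc n)) \<subseteq> ?T"
      using closed_segment_subset_thickening x by blast
    from lipschitz_joined_trans[OF Suc.IH lipschitz_joined_segment[OF this]] Suc.prems
    show ?case by (simp add: dist_norm)
  qed
  from this[of "Suc k"] have ab': "lipschitz_joined ?T a b (\<Sum>i\<le>k. norm (y i - y (Suc i)))"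
    using y(1) by (simp add: eps_path_def lessThan_Suc_atMost)
  have "closed_segment p a \<subseteq> ?T" "closed_segment b q \<subseteq> ?T"
    using closed_segment_subset_thickening[of p X p p \<epsilon> a] closed_segment_subset_thickening[of q X q b \<epsilon> q]
      p q \<epsilon> \<eta>_small by (auto simp: dist_commute)
  from lipschitz_joined_trans[OF lipschitz_joined_trans[OF lipschitz_joined_segment[OF this(1)] ab']
      lipschitz_joined_segment[OF this(2)]]
  have "d p q \<le> (1 + \<xi> / (1 + \<xi>)) * (dist p a + (\<Sum>i\<le>k. norm (y i - y (Suc i))) + dist b q)"
    using d_le_of_thickening p q True by blast
  also have "\<dots> < (1 + \<xi> / (1 + \<xi>)) * ((1 + \<xi>) * \<beta>)"
  proof (rule mult_strict_left_mono)
    have "(\<Sum>i\<le>k. norm (y i - y (Suc i))) < \<beta>"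
      using y(2) by (subst (asm) ennreal_less_iff) (auto intro: sum_nonneg)
    moreover have "\<xi> * \<epsilon> \<le> \<xi> * \<beta>" using \<xi> \<epsilon> by (intro mult_left_mono) auto
    ultimately show "dist p a + (\<Sum>i\<le>k. norm (y i - y (Suc i))) + dist b q < (1 + \<xi>) * \<beta>"
      using p q \<eta> by (simp add: dist_commute algebra_simps)
  qed (use \<xi> in \<open>simp add: add_pos_pos\<close>)
  finally show ?thesis using distortion_factor by (simp add: mult.assoc[symmetric])
qed

text \<open>Otherwise the distortion bound would apply to the straight segment from \<open>p\<close>
  to \<open>q\<close>, and its factor is at most 2.\<close>

lemma d_less_of_dist:
  assumes p: "p \<in> X" and q: "q \<in> X" and pq: "dist p q < 2 * \<eta>"
  shows "d p q < 2 * \<xi> * \<beta>"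
proof (rule ccontr)
  assume "\<not> ?thesis"
  then have far: "2 * \<xi> * \<beta> \<le> d p q" by simp
  have "closed_segment p q \<subseteq> thickening \<epsilon> X"
    using closed_segment_subset_thickening[of p X q p \<epsilon> q] p q pq \<epsilon> \<eta>_small by auto
  then have "d p q \<le> (1 + \<xi> / (1 + \<xi>)) * dist p q"
    using d_le_of_thickening[OF p q far] lipschitz_joined_segment by blast
  also have "\<dots> < (1 + \<xi> / (1 + \<xi>)) * (\<xi> * \<epsilon>)"
    using pq \<eta> \<xi> by (intro mult_strict_left_mono) (auto simp: add_pos_pos)
  also have "\<dots> \<le> 2 * (\<xi> * \<beta>)"
    using \<xi> \<epsilon> \<beta> by (intro mult_mono mult_left_mono) auto
  finally show False using far by simp
qed

text \<open>Sampling a geodesic at steps of length at most \<open>(1 - \<xi>) \<epsilon>\<close> costs \<open>\<xi> \<epsilon>\<close> per step.\<close>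

lemma path_metric_less_of_d:
  assumes ab: "a \<in> S" "b \<in> S" and p: "p \<in> X" "dist a p < \<eta>" and q: "q \<in> X" "dist b q < \<eta>"
    and pq: "d p q \<le> (1 - \<xi>)\<^sup>2 * \<beta>"
  shows "path_metric \<epsilon> S a b < ennreal \<beta>"
proof -
  define l where "l = d p q"
  define h where "h = (1 - \<xi>) * \<epsilon>"
  have \<xi>1: "0 < 1 - \<xi>" using \<xi> by simp
  have h: "0 < h" using \<xi>1 \<epsilon> by (simp add: h_def)
  have l: "0 \<le> l" by (simp add: l_def)
  \<comment> \<open>There are \<open>Suc k\<close> steps, at most \<open>l / h + 1\<close> of them.
    Adding one to the floor keeps each step at most \<open>h\<close> and their number positive when
    \<open>l = 0\<close>.\<close>
  define k where "k = nat \<lfloor>l / h\<rfloor>"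
  define m where "m = real (Suc k)"
  have m: "0 < m" by (simp add: m_def)
  have fl: "0 \<le> \<lfloor>l / h\<rfloor>" using l h by simp
  then have "m = of_int \<lfloor>l / h\<rfloor> + 1" by (simp add: m_def k_def)
  then have m1: "m \<le> l / h + 1" and m2: "l / h \<le> m" by linarith+
  have lm: "l / m \<le> h" using m2 h m by (simp add: field_simps)
  obtain g where g: "g 0 = p" "g l = q" "\<And>t. 0 \<le> t \<Longrightarrow> t \<le> l \<Longrightarrow> g t \<in> X"
    "\<And>s t. 0 \<le> s \<Longrightarrow> s \<le> t \<Longrightarrow> t \<le> l \<Longrightarrow> d (g s) (g t) = t - s"
    using geodesic[OF p(1) q(1)] unfolding l_def by metis
  define x where "x i = g (real i * (l / m))" for i
  have in_range: "0 \<le> real i * (l / m) \<and> real i * (l / m) \<le> l" if "i \<le> Suc k" for i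
  proof -
    have "real i * (l / m) \<le> m * (l / m)" using that l m by (intro mult_right_mono) (auto simp: m_def)
    then show ?thesis using l m by simp
  qed
  have xX: "x i \<in> X" if "i \<le> Suc k" for i using in_range[OF that] g(3) by (simp add: x_def)
  have xx: "dist (x i) (x (Suc i)) \<le> l / m" if "i \<le> k" for i
  proof -
    have "real i * (l / m) \<le> real (Suc i) * (l / m)" using l m by (intro mult_right_mono) auto
    then have "d (x i) (x (Suc i)) = real (Suc i) * (l / m) - real i * (l / m)"
      unfolding x_def using in_range[of i] in_range[of "Suc i"] that by (intro g(4)) auto
    also have "\<dots> = l / m" by (simp add: algebra_simps)
    finally show ?thesis using dist_le_d[OF xX xX, of i "Suc i"] that by simp
  qed
  have "real (Suc k) * (l / m) = l" unfolding m_def[symmetric] using m by simp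
  then have x0: "x 0 = p" and xk: "x (Suc k) = q"
    using g(1,2) by (simp_all only: x_def) simp
  have "\<forall>i. \<exists>s. i \<le> Suc k \<longrightarrow> s \<in> S \<and> dist s (x i) < \<eta>"
    using xX X_near by (force simp: thickening_def dist_norm norm_minus_commute)
  then obtain s where s: "\<And>i. i \<le> Suc k \<Longrightarrow> s i \<in> S \<and> dist (s i) (x i) < \<eta>" by metis
  define y where "y i = (if i = 0 then a else if i = Suc k then b else s i)" for i
  have yS: "y i \<in> S" and yx: "dist (y i) (x i) < \<eta>" if "i \<le> Suc k" for i
    using s[OF that] ab p(2) q(2) x0 xk by (auto simp: y_def)
  have step: "norm (y i - y (Suc i)) < l / m + \<xi> * \<epsilon>" if "i \<le> k" for i
  proof -
    have "dist (y i) (y (Suc i)) \<le> dist (y i) (x i) + dist (x i) (x (Suc i)) + dist (y (Suc i)) (x (Suc i))"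
      by metric
    then show ?thesis using yx[of i] yx[of "Suc i"] xx[OF that] that \<eta> by (simp add: dist_norm)
  qed
  have "eps_path \<epsilon> S a b k y"
    unfolding eps_path_def
  proof (intro conjI allI impI)
    show "y 0 = a" "y (Suc k) = b" by (auto simp: y_def)
    show "norm (y i - y (Suc i)) < \<epsilon>" if "i \<le> k" for i
      using step[OF that] lm by (simp add: h_def algebra_simps)
  qed (use yS in auto)
  then have "path_metric \<epsilon> S a b \<le> ennreal (\<Sum>i\<le>k. norm (y i - y (Suc i)))"
    unfolding path_metric_def by (intro INF_lower2[of "(k, y)"]) auto
  also have "\<dots> < ennreal \<beta>"
  proof (rule ennreal_lessI[OF \<beta>])
    have "(\<Sum>i\<le>k. norm (y i - y (Suc i))) < (\<Sum>i\<le>k. l / m + \<xi> * \<epsilon>)"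
      using step by (intro sum_strict_mono) auto
    also have "\<dots> = m * (l / m + \<xi> * \<epsilon>)" by (simp only: sum_constant card_atMost m_def)
    also have "\<dots> = l + m * (\<xi> * \<epsilon>)" using m by (simp add: distrib_left)
    also have "\<dots> \<le> l + (l / h + 1) * (\<xi> * \<epsilon>)"
      using m1 \<xi> \<epsilon> by (intro add_left_mono mult_right_mono) auto
    \<comment> \<open>The origin of the square: sampling stretches the length by
      \<open>1 / (1 - \<xi>)\<close>, and the error \<open>\<xi> * \<epsilon>\<close> of the
      additional step leaves \<open>(1 - \<xi>) * \<beta>\<close> for the stretched length.\<close>
    also have "\<dots> = l / (1 - \<xi>) + \<xi> * \<epsilon>"
      using \<xi>1 \<epsilon> by (simp add: h_def field_simps)
    also have "\<dots> \<le> (1 - \<xi>)\<^sup>2 * \<beta> / (1 - \<xi>) + \<xi> * \<beta>"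
      using pq \<xi>1 \<xi> \<epsilon> by (intro add_mono divide_right_mono mult_left_mono) (auto simp: l_def)
    also have "(1 - \<xi>)\<^sup>2 * \<beta> / (1 - \<xi>) = (1 - \<xi>) * \<beta>" using \<xi>1 by (simp add: power2_eq_square)
    also have "(1 - \<xi>) * \<beta> + \<xi> * \<beta> = \<beta>" by (simp add: algebra_simps)
    finally show "(\<Sum>i\<le>k. norm (y i - y (Suc i))) < \<beta>" .
  qed
  finally show ?thesis .
qed

end

section \<open>The homotopy equivalence\<close>

text \<open>At a zero of \<open>m\<close> the bounded factor cannot keep the product from tending to
  0; elsewhere \<open>m \<noteq> 0\<close> is relatively open, so the continuity of \<open>q\<close>
  on that part suffices. This takes a homotopy across the level where its center is
  undefined.\<close>

lemma continuous_on_mult_bounded: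
  fixes m q :: "'a::topological_space \<Rightarrow> real"
  assumes m: "continuous_on A m" and q: "continuous_on {p\<in>A. m p \<noteq> 0} q" and b: "\<And>p. p \<in> A \<Longrightarrow> \<bar>q p\<bar> \<le> 1"
  shows "continuous_on A (\<lambda>p. m p * q p)"
  unfolding continuous_on_def
proof
  fix x assume x: "x \<in> A"
  have mt: "(m \<longlongrightarrow> m x) (at x within A)" using m x by (simp add: continuous_on_def)
  show "((\<lambda>p. m p * q p) \<longlongrightarrow> m x * q x) (at x within A)"
  proof (cases "m x = 0")
    case True
    have "((\<lambda>p. m p * q p) \<longlongrightarrow> 0) (at x within A)"
    proof (rule tendsto_0_le[of m _ _ 1])
      show "(m \<longlongrightarrow> 0) (at x within A)" using mt True by simp
      show "\<forall>\<^sub>F p in at x within A. norm (m p * q p) \<le> norm (m p) * 1"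
        using b by (auto simp: eventually_at_filter abs_mult intro!: always_eventually mult_right_le_one_le)
    qed
    then show ?thesis using True by simp
  next
    case False
    have "openin (top_of_set A) {p\<in>A. m p \<in> - {0}}"
      using continuous_openin_preimage_gen[OF m, of "- {0}"] by (simp add: vimage_def Int_def open_Compl)
    then obtain U where U: "open U" "{p\<in>A. m p \<noteq> 0} = A \<inter> U" by (auto simp: openin_open)
    have "(q \<longlongrightarrow> q x) (at x within {p\<in>A. m p \<noteq> 0})" using q x False by (simp add: continuous_on_def)
    moreover have "at x within {p\<in>A. m p \<noteq> 0} = at x within A"
      using U x False by (intro at_within_nhd[of x U]) auto
    ultimately show ?thesis using mt by (intro tendsto_mult) auto
  qed
qed

lemma geom_simplex_weights:
  assumes "finite \<sigma>"
  shows "geom_simplex \<sigma> \<subseteq> weights \<sigma>"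
proof
  fix t assume t: "t \<in> geom_simplex \<sigma>"
  have "\<exists>v. 0 < t v"
  proof (rule ccontr)
    assume "\<not> ?thesis"
    then have "sum t \<sigma> \<le> 0" by (intro sum_nonpos) (auto simp: not_less)
    then show False using t by (simp add: geom_simplex_def)
  qed
  then show "t \<in> weights \<sigma>" using t by (auto simp: geom_simplex_def weights_def)
qed

lemma vietoris_rips_subset:
  assumes "\<sigma> \<in> vietoris_rips S d \<beta>" "\<tau> \<subseteq> \<sigma>" "\<tau> \<noteq> {}"
  shows "\<tau> \<in> vietoris_rips S d \<beta>"
  unfolding vietoris_rips_def
proof (intro CollectI conjI)
  have *: "finite \<sigma>" "\<sigma> \<subseteq> S" "\<forall>x\<in>\<sigma>. \<forall>y\<in>\<sigma>. d x y < ennreal \<beta>"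
    using assms(1) by (auto simp: vietoris_rips_def)
  show "finite \<tau>" "\<tau> \<subseteq> S" "\<tau> \<noteq> {}" using *(1,2) assms(2,3) by (auto intro: finite_subset)
  show "\<forall>x\<in>\<tau>. \<forall>y\<in>\<tau>. d x y < ennreal \<beta>" using *(3) assms(2) by blast
qed

locale sample_reconstruction = close_sample X S \<xi> \<beta> \<epsilon> \<eta> + compact_cat_space X "len_dist X" \<kappa> r
  for X S :: "(real^'n) set" and \<xi> \<beta> \<epsilon> \<eta> \<kappa> r :: real +
  assumes D_less: "(1 + 2 * \<xi>) * \<beta> < r"
begin

definition "D = (1 + 2 * \<xi>) * \<beta>"
text \<open>The mesh of the net: the square in \<open>\<theta>\<close> cancels the one in
  \<open>(1 - \<xi>)^2\<close>, so the first radius bound becomes linear in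
  \<open>\<xi>\<close>.\<close>

definition "\<theta> = \<xi>\<^sup>2 * \<beta>"
definition "K = vietoris_rips S (path_metric \<epsilon> S) \<beta>"
definition "f v = (SOME p. p \<in> X \<and> dist v p < \<eta>)"
definition "g x = (SOME v. v \<in> S \<and> dist v x < \<eta>)"

lemma D: "0 < D" "D \<le> r" using D_less \<xi> \<beta> by (auto simp: D_def)

lemma \<theta>: "0 < \<theta>" using \<xi> \<beta> by (simp add: \<theta>_def)

text \<open>The first bound is the one that dictates \<open>\<xi> \<le> 1/14\<close>: there it is an equality.\<close>

lemma radius_bounds:
  "3 / 4 * D + \<theta> \<le> (1 - \<xi>)\<^sup>2 * \<beta>" "2 * \<theta> \<le> (1 - \<xi>)\<^sup>2 * \<beta>" "3 / 4 * D + 2 * \<xi> * \<beta> + \<theta> \<le> D"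
proof -
  have sq: "\<xi>\<^sup>2 \<le> \<xi> * (1 / 14)" using \<xi> by (simp add: power2_eq_square mult_left_mono)
  have e: "(1 - \<xi>)\<^sup>2 = 1 - 2 * \<xi> + \<xi>\<^sup>2" by (simp add: power2_eq_square algebra_simps)
  have "3 / 4 * (1 + 2 * \<xi>) + \<xi>\<^sup>2 \<le> (1 - \<xi>)\<^sup>2" unfolding e using \<xi> by simp
  from mult_right_mono[OF this, of \<beta>] show "3 / 4 * D + \<theta> \<le> (1 - \<xi>)\<^sup>2 * \<beta>"
    using \<beta> by (simp add: D_def \<theta>_def distrib_right mult.assoc)
  have "2 * \<xi>\<^sup>2 \<le> (1 - \<xi>)\<^sup>2" unfolding e using \<xi> sq by simp
  from mult_right_mono[OF this, of \<beta>] show "2 * \<theta> \<le> (1 - \<xi>)\<^sup>2 * \<beta>"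
    using \<beta> by (simp add: \<theta>_def)
  have "3 / 4 * (1 + 2 * \<xi>) + 2 * \<xi> + \<xi>\<^sup>2 \<le> 1 + 2 * \<xi>" unfolding distrib_left using \<xi> sq by linarith
  from mult_right_mono[OF this, of \<beta>] show "3 / 4 * D + 2 * \<xi> * \<beta> + \<theta> \<le> D"
    using \<beta> by (simp add: D_def \<theta>_def distrib_right mult.assoc)
qed

lemma f: "v \<in> S \<Longrightarrow> f v \<in> X \<and> dist v (f v) < \<eta>"
  unfolding f_def by (rule someI_ex) (use S_near in \<open>force simp: thickening_def dist_norm\<close>)

lemma g: "x \<in> X \<Longrightarrow> g x \<in> S \<and> dist (g x) x < \<eta>"
  unfolding g_def by (rule someI_ex) (use X_near in \<open>force simp: thickening_def dist_norm norm_minus_commute\<close>)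

lemma simplex:
  assumes "\<sigma> \<in> K"
  shows "finite \<sigma>" "\<sigma> \<subseteq> S" "\<sigma> \<noteq> {}" "f ` \<sigma> \<subseteq> X"
    "\<And>v w. v \<in> \<sigma> \<Longrightarrow> w \<in> \<sigma> \<Longrightarrow> d (f v) (f w) < D"
proof -
  show \<sigma>: "finite \<sigma>" "\<sigma> \<subseteq> S" "\<sigma> \<noteq> {}" using assms by (auto simp: K_def vietoris_rips_def)
  then show "f ` \<sigma> \<subseteq> X" using f by auto
  fix v w assume "v \<in> \<sigma>" "w \<in> \<sigma>"
  then show "d (f v) (f w) < D"
    unfolding D_def using assms \<sigma> f[of v] f[of w]
    by (intro d_less_of_path_metric[of v w]) (auto simp: K_def vietoris_rips_def)
qed

section \<open>A finite net and its partition of unity\<close>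

definition "C = (SOME C. finite C \<and> C \<subseteq> X \<and> X \<subseteq> (\<Union>c\<in>C. mball c \<theta>))"

lemma C: "finite C" "C \<subseteq> X" "\<And>x. x \<in> X \<Longrightarrow> \<exists>c\<in>C. d c x < \<theta>"
proof -
  have "compactin mtopology X" using compact by (simp add: compact_space_def)
  then have "mtotally_bounded X" by (rule compactin_imp_mtotally_bounded)
  then have "\<exists>C. finite C \<and> C \<subseteq> X \<and> X \<subseteq> (\<Union>c\<in>C. mball c \<theta>)"
    using \<theta> by (simp add: mtotally_bounded_def)
  from someI_ex[OF this] have *: "finite C \<and> C \<subseteq> X \<and> X \<subseteq> (\<Union>c\<in>C. mball c \<theta>)" by (simp only: C_def)
  then show "finite C" "C \<subseteq> X" by auto
  show "\<exists>c\<in>C. d c x < \<theta>" if "x \<in> X" for x using * that by fastforce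
qed

definition "bump x c = max 0 (\<theta> - d c x)"
text \<open>The partition of unity is pushed forward along \<open>g\<close>, which need not be
  injective on the net; hence the sum over a fibre.\<close>

definition "psi x v = (\<Sum>c\<in>C. if g c = v then bump x c else 0) / sum (bump x) C"
definition "near x = g ` {c\<in>C. d c x < \<theta>}"

lemma bump_sum_pos:
  assumes "x \<in> X"
  shows "0 < sum (bump x) C"
proof -
  obtain c where c: "c \<in> C" "d c x < \<theta>" using C(3)[OF assms] by auto
  then have "0 < bump x c" by (simp add: bump_def)
  also have "\<dots> \<le> sum (bump x) C" using C(1) c by (intro member_le_sum) (auto simp: bump_def)
  finally show ?thesis .
qed

lemma psi_bounds: "0 \<le> psi x v" "psi x v \<le> 1"
proof -
  have 1: "0 \<le> (\<Sum>c\<in>C. if g c = v then bump x c else 0)" by (intro sum_nonneg) (auto simp: bump_def)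
  have 2: "(\<Sum>c\<in>C. if g c = v then bump x c else 0) \<le> sum (bump x) C" by (intro sum_mono) (auto simp: bump_def)
  show "0 \<le> psi x v" using 1 2 by (auto simp: psi_def intro!: divide_nonneg_nonneg)
  show "psi x v \<le> 1" using 1 2 by (auto simp: psi_def divide_le_eq_1)
qed

lemma psi_zero: "v \<notin> near x \<Longrightarrow> psi x v = 0"
proof -
  assume v: "v \<notin> near x"
  have "(if g c = v then bump x c else 0) = 0" if "c \<in> C" for c
    using v that by (auto simp: near_def bump_def)
  then have "(\<Sum>c\<in>C. if g c = v then bump x c else 0) = 0" by (rule sum.neutral[OF ballI])
  then show ?thesis by (simp add: psi_def)
qed

lemma near_subset: "near x \<subseteq> g ` C" by (auto simp: near_def)

lemma finite_near: "finite (near x)" using C(1) by (simp add: near_def)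

lemma psi_sum:
  assumes "x \<in> X" and V: "finite V" "near x \<subseteq> V"
  shows "(\<Sum>v\<in>V. psi x v) = 1"
proof -
  have "(\<Sum>v\<in>V. \<Sum>c\<in>C. if g c = v then bump x c else 0) = (\<Sum>c\<in>C. \<Sum>v\<in>V. if g c = v then bump x c else 0)"
    by (rule sum.swap)
  also have "\<dots> = (\<Sum>c\<in>C. bump x c)"
  proof (rule sum.cong[OF refl])
    fix c assume "c \<in> C"
    then have "g c \<in> V \<or> bump x c = 0" using V by (auto simp: near_def bump_def)
    then show "(\<Sum>v\<in>V. if g c = v then bump x c else 0) = bump x c" using V(1) by (auto simp: sum.delta')
  qed
  finally show ?thesis
    using bump_sum_pos[OF assms(1)] by (simp add: psi_def sum_divide_distrib[symmetric])
qed

lemma continuous_map_psi: "continuous_map mtopology euclideanreal (\<lambda>x. psi x v)"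
proof -
  have b: "continuous_map mtopology euclideanreal (\<lambda>x. bump x c)" if "c \<in> C" for c
    unfolding bump_def using that C(2)
    by (intro continuous_map_real_max continuous_map_diff continuous_map_dist) auto
  have "continuous_map mtopology euclideanreal (\<lambda>x. if g c = v then bump x c else 0)" if "c \<in> C" for c
    using b[OF that] by (cases "g c = v") auto
  then show ?thesis unfolding psi_def
    using b C(1) bump_sum_pos by (intro continuous_map_real_divide continuous_map_sum) force+
qed

text \<open>All points concerned lie within \<open>3/4 * D\<close> or \<open>\<theta>\<close> of
  \<open>x\<close>, so a pair that involves a net point is close enough in \<open>X\<close> to be
  joined by an edge. Pairs inside \<open>\<tau>\<close> already span edges.\<close>

lemma simplex_Un_near:
  assumes x: "x \<in> X" and \<tau>: "\<tau> \<in> K \<or> \<tau> = {}" and d\<tau>: "\<And>v. v \<in> \<tau> \<Longrightarrow> d x (f v) \<le> 3 / 4 * D"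
  shows "\<tau> \<union> near x \<in> K"
proof -
  have \<tau>S: "finite \<tau>" "\<tau> \<subseteq> S" using \<tau> simplex by auto
  have cX: "c \<in> X" "d c x < \<theta>" "g c \<in> S" "dist (g c) c < \<eta>" if "c \<in> C" "d c x < \<theta>" for c
    using that C(2) g[of c] by auto
  have vg: "d (f v) c \<le> (1 - \<xi>)\<^sup>2 * \<beta>" if "v \<in> \<tau>" "c \<in> C" "d c x < \<theta>" for v c
  proof -
    have "d (f v) c \<le> d x (f v) + d c x"
      using triangle[of "f v" x c] f[of v] that \<tau>S x cX commute by (auto simp: subset_iff)
    then show ?thesis using d\<tau>[OF that(1)] that radius_bounds(1) by linarith
  qed
  have gg: "d c c' \<le> (1 - \<xi>)\<^sup>2 * \<beta>" if "c \<in> C" "d c x < \<theta>" "c' \<in> C" "d c' x < \<theta>" for c c'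
  proof -
    have "d c c' \<le> d c x + d c' x" using triangle[of c x c'] that x cX commute by auto
    then show ?thesis using that radius_bounds(2) by linarith
  qed
  have "path_metric \<epsilon> S a b < ennreal \<beta>" if ab: "a \<in> \<tau> \<union> near x" "b \<in> \<tau> \<union> near x" for a b
  proof -
    consider "a \<in> \<tau>" "b \<in> \<tau>" | "a \<in> \<tau>" "b \<in> near x" | "a \<in> near x" "b \<in> \<tau>" | "a \<in> near x" "b \<in> near x"
      using ab by blast
    then show ?thesis
    proof cases
      case 1 then show ?thesis using \<tau> by (auto simp: K_def vietoris_rips_def)
    next
      case 2
      then obtain c where c: "b = g c" "c \<in> C" "d c x < \<theta>" by (auto simp: near_def)
      have "a \<in> S" using 2 \<tau>S by auto
      then show ?thesis
        using path_metric_less_of_d[of a b "f a" c] f[of a] cX[OF c(2,3)] vg[OF 2(1) c(2,3)] c(1) by simp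
    next
      case 3
      then obtain c where c: "a = g c" "c \<in> C" "d c x < \<theta>" by (auto simp: near_def)
      have "b \<in> S" using 3 \<tau>S by auto
      then show ?thesis
        using path_metric_less_of_d[of a b c "f b"] f[of b] cX[OF c(2,3)] vg[OF 3(2) c(2,3)] c(1) commute[of c "f b"] by simp
    next
      case 4
      then obtain c c' where c: "a = g c" "c \<in> C" "d c x < \<theta>" "b = g c'" "c' \<in> C" "d c' x < \<theta>"
        by (auto simp: near_def)
      then show ?thesis
        using path_metric_less_of_d[of a b c c'] cX[OF c(2,3)] cX[OF c(5,6)] gg[OF c(2,3,5,6)] by simp
    qed
  qed
  moreover have "near x \<noteq> {}" using C(3)[OF x] by (auto simp: near_def)
  moreover have "near x \<subseteq> S" using cX by (auto simp: near_def)
  ultimately show ?thesis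
    using \<tau>S finite_near by (auto simp: K_def vietoris_rips_def)
qed

lemma psi_simplex:
  assumes "x \<in> X"
  shows "near x \<in> K" "psi x \<in> geom_simplex (near x)"
  using simplex_Un_near[OF assms, of "{}"] psi_bounds psi_zero psi_sum[OF assms finite_near subset_refl]
  by (auto simp: geom_simplex_def)

section \<open>The two maps and the homotopies of their compositions\<close>

lemma center_in:
  assumes "\<sigma> \<in> K" "t \<in> weights \<sigma>"
  shows "center f t \<in> X"
  using center(1)[OF simplex(1,4)[OF assms(1)] D simplex(5)[OF assms(1)] assms(2)] by auto

lemma center_near_top:
  assumes "\<sigma> \<in> K" "t \<in> weights \<sigma>" "\<And>w. t w \<le> t v"
  shows "d (center f t) (f v) \<le> 3 / 4 * D"
  using center_near[OF simplex(1,4)[OF assms(1)] D simplex(5)[OF assms(1)] assms(2,3)] by auto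

lemma continuous_map_center_weights:
  assumes "\<sigma> \<in> K"
  shows "continuous_map (top_of_set (weights \<sigma>)) mtopology (center f)"
  by (rule continuous_map_center[OF simplex(1,4)[OF assms] D simplex(5)[OF assms]])

lemma continuous_map_center_realization: "continuous_map (geom_realization K) mtopology (center f)"
  using continuous_map_from_subtopology_mono[OF continuous_map_center_weights geom_simplex_weights] simplex(1)
  by (intro continuous_map_from_geom_realization) blast

lemma continuous_map_psi_realization: "continuous_map mtopology (geom_realization K) psi"
proof (rule continuous_map_into_geom_realization[of "g ` C"])
  show "\<exists>\<tau>\<in>K. \<tau> \<subseteq> g ` C \<and> psi x \<in> geom_simplex \<tau>" if "x \<in> topspace mtopology" for x
    using psi_simplex[of x] near_subset that by auto
qed (use C(1) continuous_map_psi in auto)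

text \<open>Everything is measured through a vertex \<open>v = g c\<close> of largest weight: the
  center is near \<open>f v\<close>, \<open>f v\<close> is near \<open>c\<close> since both are
  \<open>\<eta>\<close>-close to \<open>v\<close>, and \<open>c\<close> is near \<open>x\<close>.
  The third radius bound adds these up.\<close>

lemma d_center_psi:
  assumes x: "x \<in> X"
  shows "d (center f (psi x)) x < r"
proof -
  note ps = psi_simplex[OF x]
  have fin: "finite (near x)" "near x \<noteq> {}" using simplex[OF ps(1)] by auto
  have "Max (psi x ` near x) \<in> psi x ` near x" using fin by (intro Max_in) auto
  then obtain v where v: "v \<in> near x" "psi x v = Max (psi x ` near x)" by auto
  have top: "psi x w \<le> psi x v" for w
  proof (cases "w \<in> near x")
    case True then show ?thesis using v fin by auto
  next
    case False then show ?thesis using psi_zero psi_bounds by simp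
  qed
  obtain c where c: "v = g c" "c \<in> C" "d c x < \<theta>" using v by (auto simp: near_def)
  have cX: "c \<in> X" using c C by auto
  have gc: "g c \<in> S" "dist (g c) c < \<eta>" using g[OF cX] by auto
  have fv: "f v \<in> X" "dist (g c) (f v) < \<eta>" using f[OF gc(1)] c(1) by auto
  have "dist (f v) c < 2 * \<eta>" using dist_triangle3[of "f v" c "g c"] fv gc by simp
  then have 1: "d (f v) c < 2 * \<xi> * \<beta>" using d_less_of_dist fv cX by blast
  have w: "psi x \<in> weights (near x)" using ps geom_simplex_weights fin by blast
  have zX: "center f (psi x) \<in> X" using center_in ps w by blast
  have 2: "d (center f (psi x)) (f v) \<le> 3 / 4 * D" by (rule center_near_top[OF ps(1) w top])
  have "d (center f (psi x)) x \<le> d (center f (psi x)) (f v) + d (f v) x" "d (f v) x \<le> d (f v) c + d c x"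
    using triangle zX x fv cX by blast+
  then show ?thesis using 1 2 c(3) radius_bounds(3) D(2) by linarith
qed

lemma homotopic_center_psi: "homotopic_with (\<lambda>_. True) mtopology mtopology (center f \<circ> psi) id"
proof -
  let ?T = "prod_topology (top_of_set {0..1::real}) mtopology"
  let ?h = "\<lambda>p. geodesic_point (center f (psi (snd p))) (snd p) (fst p)"
  have cp: "continuous_map mtopology mtopology (\<lambda>x. center f (psi x))"
    using continuous_map_compose[OF continuous_map_psi_realization continuous_map_center_realization] by (simp add: o_def)
  have "continuous_map ?T mtopology ?h"
  proof (rule continuous_map_geodesic_point)
    show "continuous_map ?T mtopology (\<lambda>p. center f (psi (snd p)))"
      using continuous_map_compose[OF continuous_map_snd cp] by (simp add: o_def)
    show "continuous_map ?T mtopology snd" by (rule continuous_map_snd)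
    show "continuous_map ?T euclideanreal fst"
      using continuous_map_fst continuous_map_into_fulltopology by blast
  qed (use d_center_psi in auto)
  moreover have "?h (0, x) = center f (psi x)" "?h (1, x) = x" if "x \<in> X" for x
  proof -
    have M: "center f (psi x) \<in> X"
      using continuous_map_image_subset_topspace[OF cp] that by auto
    show "?h (0, x) = center f (psi x)"
      using geodesic_point(1,2)[OF M that, of 0] M by auto
    show "?h (1, x) = x"
      using geodesic_point(1,3)[OF M that, of 1] that by auto
  qed
  ultimately show ?thesis
    by (subst homotopic_with) (auto intro!: exI[of _ ?h])
qed

text \<open>The homotopy cuts the weights \<open>t\<close> at the level \<open>s\<close>: the part above \<open>s\<close> stays, and the mass of the part
  below \<open>s\<close> is moved to the image of its center. At \<open>s = 0\<close> the center is a junk value, but its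
  coefficient vanishes.\<close>

definition "mass s t = (\<Sum>w | t w \<noteq> 0. min (t w) s)"
definition "truncate s t = (\<lambda>w. min (t w) s)"
definition "deform p = (\<lambda>v. max 0 (snd p v - fst p) + mass (fst p) (snd p) * psi (center f (truncate (fst p) (snd p))) v)"

text \<open>The definition sums over the support, so it needs no simplex; on a fixed simplex the
  mass is a finite sum of continuous functions.\<close>

lemma mass_eq:
  assumes "finite \<sigma>" "t \<in> geom_simplex \<sigma>" "0 \<le> s"
  shows "mass s t = (\<Sum>w\<in>\<sigma>. min (t w) s)"
  unfolding mass_def
  by (rule sum.mono_neutral_left) (use assms in \<open>auto simp: geom_simplex_def\<close>)

lemma mass_0:
  assumes "finite \<sigma>" "t \<in> geom_simplex \<sigma>"
  shows "mass 0 t = 0"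
proof -
  have "(\<Sum>w\<in>\<sigma>. min (t w) 0) = 0"
    using assms(2) by (intro sum.neutral) (auto simp: geom_simplex_def)
  then show ?thesis using mass_eq[OF assms, of 0] by simp
qed

lemma geom_simplex_le_1:
  assumes "finite \<sigma>" "t \<in> geom_simplex \<sigma>"
  shows "t v \<le> 1"
proof (cases "v \<in> \<sigma>")
  case True
  then have "t v \<le> sum t \<sigma>" using assms by (intro member_le_sum) (auto simp: geom_simplex_def)
  then show ?thesis using assms by (simp add: geom_simplex_def)
qed (use assms in \<open>auto simp: geom_simplex_def\<close>)

lemma truncate_weights:
  assumes "finite \<sigma>" "t \<in> geom_simplex \<sigma>" "0 < s"
  shows "truncate s t \<in> weights \<sigma>"
  using geom_simplex_weights[OF assms(1)] assms by (auto simp: weights_def truncate_def subset_iff)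

lemma deform_0:
  assumes "finite \<sigma>" "t \<in> geom_simplex \<sigma>"
  shows "deform (0, t) = t"
  using assms by (auto simp: deform_def geom_simplex_def mass_0[OF assms] fun_eq_iff)

lemma deform_1:
  assumes "finite \<sigma>" "t \<in> geom_simplex \<sigma>"
  shows "deform (1, t) = psi (center f t)"
proof -
  have "min (t v) 1 = t v" "max 0 (t v - 1) = 0" for v using geom_simplex_le_1[OF assms, of v] by auto
  then show ?thesis
    using assms mass_eq[OF assms, of 1] by (auto simp: deform_def truncate_def geom_simplex_def)
qed

text \<open>The vertices whose weight exceeds \<open>s\<close> have maximal truncated weight, so the center of the
  truncated weights is close to all of them.\<close>

lemma deform_simplex:
  assumes \<sigma>: "\<sigma> \<in> K" and t: "t \<in> geom_simplex \<sigma>" and s: "s \<in> {0..1}"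
  shows "\<exists>\<tau>\<in>K. \<tau> \<subseteq> \<sigma> \<union> g ` C \<and> deform (s, t) \<in> geom_simplex \<tau>"
proof (cases "s = 0")
  case True
  then show ?thesis using deform_0[OF simplex(1)[OF \<sigma>] t] \<sigma> t by auto
next
  case False
  then have s0: "0 < s" using s by simp
  note fin = simplex(1)[OF \<sigma>]
  have w: "truncate s t \<in> weights \<sigma>" by (rule truncate_weights[OF fin t s0])
  define x where "x = center f (truncate s t)"
  have x: "x \<in> X" unfolding x_def by (rule center_in[OF \<sigma> w])
  define \<tau> where "\<tau> = {v\<in>\<sigma>. s < t v}"
  have "d x (f v) \<le> 3 / 4 * D" if "v \<in> \<tau>" for v
    unfolding x_def using that by (intro center_near_top[OF \<sigma> w]) (auto simp: \<tau>_def truncate_def)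
  \<comment> \<open>At levels above all weights \<open>\<tau>\<close> is empty and only the vertices
    near the center remain.\<close>
  moreover have "\<tau> \<in> K \<or> \<tau> = {}" using \<sigma> vietoris_rips_subset[of \<sigma> _ _ _ \<tau>] by (auto simp: K_def \<tau>_def)
  ultimately have K: "\<tau> \<union> near x \<in> K" using simplex_Un_near[OF x] by blast
  have t0: "0 \<le> t v" "v \<notin> \<sigma> \<Longrightarrow> t v = 0" for v using t by (auto simp: geom_simplex_def)
  have fin\<tau>: "finite (\<tau> \<union> near x)" using simplex(1)[OF K] .
  have dv: "deform (s, t) v = max 0 (t v - s) + mass s t * psi x v" for v by (simp add: deform_def x_def)
  have m: "mass s t = (\<Sum>w\<in>\<sigma>. min (t w) s)" using mass_eq[OF fin t] s0 by simp
  then have m0: "0 \<le> mass s t" using t0 s0 by (simp add: sum_nonneg)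
  have "deform (s, t) \<in> geom_simplex (\<tau> \<union> near x)"
    unfolding geom_simplex_def
  proof (intro CollectI conjI allI impI)
    show "0 \<le> deform (s, t) v" for v using m0 psi_bounds by (simp add: dv)
    have low: "t v \<le> s" if "v \<notin> \<tau>" for v
      using that t0[of v] s0 by (cases "v \<in> \<sigma>") (auto simp: \<tau>_def)
    show "deform (s, t) v = 0" if "v \<notin> \<tau> \<union> near x" for v
      using that psi_zero low[of v] by (simp add: dv)
    have "(\<Sum>v\<in>\<tau> \<union> near x. max 0 (t v - s)) = (\<Sum>v\<in>\<tau>. max 0 (t v - s))"
      using fin\<tau> low by (intro sum.mono_neutral_right) auto
    also have "\<dots> = (\<Sum>v\<in>\<sigma>. max 0 (t v - s))"
      using fin by (intro sum.mono_neutral_left) (auto simp: \<tau>_def)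
    finally have "sum (deform (s, t)) (\<tau> \<union> near x) = (\<Sum>v\<in>\<sigma>. max 0 (t v - s)) + mass s t"
      using psi_sum[OF x fin\<tau>] by (simp add: dv sum.distrib sum_distrib_left[symmetric])
    \<comment> \<open>The cut splits every weight into a part above and a part below the level, so
      the total is preserved.\<close>
    also have "\<dots> = (\<Sum>v\<in>\<sigma>. max 0 (t v - s) + min (t v) s)" by (simp add: m sum.distrib)
    also have "\<dots> = sum t \<sigma>" by (rule sum.cong) auto
    finally show "sum (deform (s, t)) (\<tau> \<union> near x) = 1" using t by (simp add: geom_simplex_def)
  qed
  moreover have "\<tau> \<union> near x \<subseteq> \<sigma> \<union> g ` C" using near_subset by (auto simp: \<tau>_def)
  ultimately show ?thesis using K by blast
qed

text \<open>Where the mass is nonzero the level is positive and the truncated weights are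
  admissible, so the center varies continuously. The bounded coordinates of \<open>psi\<close> let
  the product extend over the remaining points.\<close>

lemma continuous_on_deform:
  assumes \<sigma>: "\<sigma> \<in> K"
  shows "continuous_on ({0..1} \<times> geom_simplex \<sigma>) (\<lambda>p. deform p v)"
proof -
  let ?A = "{0..1} \<times> geom_simplex \<sigma>"
  note fin = simplex(1)[OF \<sigma>]
  have c1: "continuous_on A (\<lambda>p :: real \<times> (real^'n \<Rightarrow> real). snd p w)" for w A
    using continuous_on_compose[OF continuous_on_snd[OF continuous_on_id]
        continuous_on_subset[OF continuous_on_product_coordinates subset_UNIV], of A w] by (simp add: o_def)
  have c2: "continuous_on A (\<lambda>p :: real \<times> (real^'n \<Rightarrow> real). fst p)" for A
    by (intro continuous_intros)
  have pos: "mass s t \<noteq> 0 \<Longrightarrow> 0 < s" if "(s, t) \<in> ?A" for s t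
    using that mass_0[OF fin, of t] by (cases "s = 0") auto
  have "continuous_on ?A (\<lambda>p. \<Sum>w\<in>\<sigma>. min (snd p w) (fst p))"
    by (intro continuous_on_sum continuous_on_min c1 c2)
  then have m: "continuous_on ?A (\<lambda>p. mass (fst p) (snd p))"
    by (rule continuous_on_eq) (use fin in \<open>auto simp: mass_eq\<close>)
  let ?B = "{p\<in>?A. mass (fst p) (snd p) \<noteq> 0}"
  have "continuous_map (top_of_set ?B) (top_of_set (weights \<sigma>)) (\<lambda>p. truncate (fst p) (snd p))"
    unfolding continuous_map_in_subtopology
  proof
    show "continuous_map (top_of_set ?B) euclidean (\<lambda>p. truncate (fst p) (snd p))"
      unfolding euclidean_product_topology[symmetric] continuous_map_componentwise_UNIV truncate_def
      using c1 c2 by (auto intro!: continuous_on_min)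
    show "(\<lambda>p. truncate (fst p) (snd p)) \<in> topspace (top_of_set ?B) \<rightarrow> weights \<sigma>"
      using truncate_weights[OF fin] pos by auto
  qed
  from continuous_map_compose[OF continuous_map_compose[OF this continuous_map_center_weights[OF \<sigma>]] continuous_map_psi]
  have "continuous_on ?B (\<lambda>p. psi (center f (truncate (fst p) (snd p))) v)" by (simp add: o_def)
  then have "continuous_on ?A (\<lambda>p. mass (fst p) (snd p) * psi (center f (truncate (fst p) (snd p))) v)"
    using m psi_bounds by (intro continuous_on_mult_bounded) auto
  then show ?thesis
    unfolding deform_def by (intro continuous_on_add continuous_on_max continuous_on_diff continuous_on_const c1 c2)
qed

lemma homotopic_psi_center:
  "homotopic_with (\<lambda>_. True) (geom_realization K) (geom_realization K) (psi \<circ> center f) id"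
proof -
  have "continuous_map (prod_topology (top_of_set {0..1}) (geom_realization K)) (geom_realization K) deform"
  proof (rule continuous_map_prod_geom_realization)
    fix \<sigma> assume \<sigma>: "\<sigma> \<in> K"
    show "continuous_map (top_of_set ({0..1} \<times> geom_simplex \<sigma>)) (geom_realization K) deform"
    proof (rule continuous_map_into_geom_realization)
      \<comment> \<open>On a fixed simplex the homotopy meets only its own vertices and the images
        of the net.\<close>
      show "finite (\<sigma> \<union> g ` C)" using C(1) simplex(1)[OF \<sigma>] by simp
      show "\<exists>\<tau>\<in>K. \<tau> \<subseteq> \<sigma> \<union> g ` C \<and> deform p \<in> geom_simplex \<tau>"
        if "p \<in> topspace (top_of_set ({0..1} \<times> geom_simplex \<sigma>))" for p
        using deform_simplex[OF \<sigma>, of "snd p" "fst p"] that by auto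
      show "continuous_map (top_of_set ({0..1} \<times> geom_simplex \<sigma>)) euclideanreal (\<lambda>p. deform p v)" for v
        using continuous_on_deform[OF \<sigma>] by simp
    qed
  qed
  moreover have "deform (0, t) = t" "deform (1, t) = psi (center f t)" if t: "t \<in> topspace (geom_realization K)" for t
  proof -
    obtain \<sigma> where "\<sigma> \<in> K" "t \<in> geom_simplex \<sigma>" using t by auto
    then show "deform (0, t) = t" "deform (1, t) = psi (center f t)"
      using deform_0 deform_1 simplex(1) by blast+
  qed
  ultimately have "homotopic_with (\<lambda>_. True) (geom_realization K) (geom_realization K) id (psi \<circ> center f)"
    by (subst homotopic_with) (auto intro!: exI[of _ deform])
  then show ?thesis by (rule homotopic_with_symD)
qed

lemma homotopy_equivalent: "rips_realization \<epsilon> \<beta> S homotopy_equivalent_space mtopology"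
  unfolding rips_realization_def K_def[symmetric] homotopy_equivalent_space_def
  using continuous_map_center_realization continuous_map_psi_realization homotopic_psi_center homotopic_center_psi
  by blast

end

theorem theorem1:
  fixes X S :: "(real^'n) set" and \<kappa> \<xi> \<beta> \<epsilon> :: real
  assumes "geodesic_subspace X"
    and "compact_space (len_topology X)"
    and "path_connected_space (len_topology X)"
    and "curvature_le \<kappa> X (len_dist X)"
    and "0 < \<xi>" and "\<xi> \<le> 1 / 14"
    and "0 < \<beta>" and "ennreal \<beta> < ennreal (1 / (1 + 2 * \<xi>)) * Delta \<kappa> X"
    and "0 < \<epsilon>" and "\<epsilon> \<le> \<beta>"
    and "large_scale_distortion \<epsilon> (2 * \<xi> * \<beta>) X \<le> ennreal (1 + \<xi> / (1 + \<xi>))"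
    and "compact S" and "S \<noteq> {}"
    and "hausdorff_distance X S < ennreal (1 / 2 * \<xi> * \<epsilon>)"
  shows "rips_realization \<epsilon> \<beta> S homotopy_equivalent_space len_topology X"
proof -
  obtain \<eta> where \<eta>: "0 < \<eta>" "S \<subseteq> thickening \<eta> X" "X \<subseteq> thickening \<eta> S" "ennreal \<eta> < ennreal (1 / 2 * \<xi> * \<epsilon>)"
    using assms(14) unfolding hausdorff_distance_def INF_less_iff by auto
  then have \<eta>2: "2 * \<eta> \<le> \<xi> * \<epsilon>" by (subst (asm) ennreal_less_iff) auto
  define D where "D = (1 + 2 * \<xi>) * \<beta>"
  have c: "0 < 1 + 2 * \<xi>" using assms(5) by simp
  have "ennreal D = ennreal (1 + 2 * \<xi>) * ennreal \<beta>" using c assms(7) by (simp add: D_def ennreal_mult)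
  also have "\<dots> < ennreal (1 + 2 * \<xi>) * (ennreal (1 / (1 + 2 * \<xi>)) * Delta \<kappa> X)"
    using c assms(8) by (intro ennreal_mult_strict_left_mono) auto
  also have "\<dots> = Delta \<kappa> X"
    using c by (simp add: mult.assoc[symmetric] ennreal_mult[symmetric])
  finally have "ennreal D < Delta \<kappa> X" .
  \<comment> \<open>\<open>Delta\<close> may be infinite, so a real \<open>r\<close> is interposed
    between \<open>D\<close> and it.\<close>
  then obtain q where q: "ennreal D < q" "q < Delta \<kappa> X" using dense by blast
  then obtain r where r: "ennreal D < ennreal r" "ennreal r < Delta \<kappa> X"
    by (cases q) auto
  have D0: "0 < D" using c assms(7) by (simp add: D_def)
  then have Dr: "D < r" using r(1) by (subst (asm) ennreal_less_iff) auto
  have r0: "0 < r" using D0 Dr by simp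
  have rho: "ennreal r < convexity_radius X (len_dist X)"
    using r(2) by (auto simp: Delta_def split: if_splits)
  interpret G: geodesic_space X "len_dist X"
    using geodesic_space_complete_length_space assms(1) by (auto simp: geodesic_subspace_def)
  have convex: "metric_convex X (len_dist X) (G.mball x s)" if x: "x \<in> X" and s: "0 < s" "s \<le> r" for x s
  proof -
    have "ennreal r < (SUP r \<in> {r. 0 \<le> r \<and> (\<forall>s. 0 < s \<and> s < r \<longrightarrow> metric_convex X (len_dist X) (G.mball x s))}. ennreal r)"
      using rho x unfolding convexity_radius_def by (meson INF_lower less_le_trans)
    \<comment> \<open>A witness \<open>r'\<close> strictly beyond \<open>r\<close> makes the ball of
      radius \<open>r\<close> itself convex as well.\<close>
    then obtain r' where r': "ennreal r < ennreal r'" "0 \<le> r'"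
      "\<And>s. 0 < s \<Longrightarrow> s < r' \<Longrightarrow> metric_convex X (len_dist X) (G.mball x s)"
      unfolding less_SUP_iff by auto
    then have "r < r'" using r0 by (subst (asm) ennreal_less_iff) auto
    then show ?thesis using r'(3) s by simp
  qed
  have small: "sqrt \<kappa> * r < pi / 4" if "\<kappa> > 0"
  proof -
    have "ennreal r < ennreal (pi / (4 * sqrt \<kappa>))" using r(2) that by (auto simp: Delta_def)
    then have "r < pi / (4 * sqrt \<kappa>)" using r0 by (subst (asm) ennreal_less_iff) auto
    then show ?thesis using that by (simp add: field_simps)
  qed
  interpret sample_reconstruction X S \<xi> \<beta> \<epsilon> \<eta> \<kappa> r
    by unfold_locales (use assms \<eta> \<eta>2 r0 Dr convex small in \<open>auto simp: D_def\<close>)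
  show ?thesis by (rule homotopy_equivalent)
qed

end
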